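(* The category $\mathbf{WHDTS}$ of weak higher dimensional transition systems is locally finitely presentable. The functor $$\omega:\mathbf{WHDTS}\longrightarrow\mathbf{Set}^{\{s\}\cup\Sigma}$$ taking the weak higher dimensional transition system $(S,\mu:L\to\Sigma,(T_n)_{n\ge1})$ to the $(\{s\}\cup\Sigma)$-tuple of sets $(S,(\mu^{-1}(x))_{x\in\Sigma})$ is topological.
   Context: $\Sigma$ is a fixed nonempty set of labels and $s$ is a symbol (the sort of states) not in $\Sigma$. A weak higher dimensional transition system is a triple $(S,\mu:L\to\Sigma,T=\bigcup_{n\ge1}T_n)$ with $S$ a set (states), $L$ a set (actions), $\mu$ a set map (labelling map) and $T_n\subset S\times L^n\times S$ ($n$-transitions) such that: - (Multiset axiom) for every permutation $\sigma$ of $\{1,\dots,n\}$, $n\ge2$, if $(\alpha,u_1,\dots,u_n,\beta)\in T$ then $(\alpha,u_{\sigma(1)},\dots,u_{\sigma(n)},\beta)\in T$; - (Coherence axiom) for $n\ge3$, $p,q\ge1$ with $p+q<n$, if $(\alpha,u_1,\dots,u_n,\beta)$, $(\alpha,u_1,\dots,u_p,\nu_1)$, $(\nu_1,u_{p+1},\dots,u_n,\beta)$, $(\alpha,u_1,\dots,u_{p+q},\nu_2)$, $(\nu_2,u_{p+q+1},\dots,u_n,\beta)$ are transitions, then $(\nu_1,u_{p+1},\dots,u_{p+q},\nu_2)$ is a transition. A morphism $f$ consists of a map $f_0$ on states and a map $\widetilde f$ on actions commuting with the labelling maps, such that $(f_0(\alpha),\widetilde f(u_1),\dots,\widetilde f(u_n),f_0(\beta))$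 is a transition whenever $(\alpha,u_1,\dots,u_n,\beta)$ is. A functor $\omega:\mathcal C\to\mathcal D$ is topological if each cone $(f_i:X\to\omega A_i)_{i\in I}$, $I$ a class, has a unique $\omega$-initial lift $(\overline f_i:A\to A_i)_{i\in I}$, i.e.: (1) $\omega A=X$ and $\omega\overline f_i=f_i$ for each $i\in I$; (2) given $h:\omega B\to X$ with $f_ih=\omega\overline h_i$, $\overline h_i:B\to A_i$ for each $i\in I$, then $h=\omega\overline h$ for a unique $\overline h:B\to A$.
   Formalization: Since fibres of μ are disjoint, ωA = X fails for tuples with overlapping label components; so "topological" is proved with ωA ≅ X (lift unique up to unique isomorphism) over all tuples, and with strict equality over tuples whose components at labels are pairwise disjoint. *)

theory Defs
  imports
    "HOL-Library.FuncSet"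
    "HOL-Library.Disjoint_Sets"
    "HOL-Library.Countable_Set"
    "HOL-Combinatorics.Permutations"
begin

section \<open>Smallness\<close>

text \<open>
  The type \<open>'u\<close> plays the role of the class of all sets. A set (over any type) is small if its
  cardinality is strictly below that of \<open>'u\<close>. The only requirement on \<open>'u\<close> is that its cardinal is
  uncountable and regular. If that cardinal is moreover a strong limit (or if \<open>'u\<close> is a type of all
  ZFC sets), the small subsets of \<open>'u\<close> form a full copy of the category of sets of the corresponding
  universe. Requiring a strong limit would only restrict the choice of \<open>'u\<close>.
\<close>

definition small :: "'u itself \<Rightarrow> 'a set \<Rightarrow> bool" where
  "small U A \<longleftrightarrow> (card_of A, card_of (UNIV :: 'u set)) \<in> ordLess"

definition regular_universe :: "'u itself \<Rightarrow> bool" where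
  "regular_universe U \<longleftrightarrow> uncountable (UNIV :: 'u set) \<and> regularCard (card_of (UNIV :: 'u set))"


section \<open>Categories and functors\<close>

record ('o, 'a) cat =
  Obj :: "'o set"
  Arr :: "'a set"
  Dom :: "'a \<Rightarrow> 'o"
  Cod :: "'a \<Rightarrow> 'o"
  Ident :: "'o \<Rightarrow> 'a"
  Comp :: "'a \<Rightarrow> 'a \<Rightarrow> 'a"

text \<open>\<open>Comp C g f\<close> is ``g after f''; it is meaningful only when \<open>Cod C f = Dom C g\<close>.\<close>

definition hom :: "('o, 'a) cat \<Rightarrow> 'o \<Rightarrow> 'o \<Rightarrow> 'a set" where
  "hom C X Y = {f \<in> Arr C. Dom C f = X \<and> Cod C f = Y}"

definition category :: "('o, 'a) cat \<Rightarrow> bool" where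
  "category C \<longleftrightarrow>
     (\<forall>f \<in> Arr C. Dom C f \<in> Obj C \<and> Cod C f \<in> Obj C) \<and>
     (\<forall>X \<in> Obj C. Ident C X \<in> hom C X X) \<and>
     (\<forall>X \<in> Obj C. \<forall>Y \<in> Obj C. \<forall>Z \<in> Obj C. \<forall>f \<in> hom C X Y. \<forall>g \<in> hom C Y Z.
        Comp C g f \<in> hom C X Z) \<and>
     (\<forall>X \<in> Obj C. \<forall>Y \<in> Obj C. \<forall>f \<in> hom C X Y.
        Comp C f (Ident C X) = f \<and> Comp C (Ident C Y) f = f) \<and>
     (\<forall>W \<in> Obj C. \<forall>X \<in> Obj C. \<forall>Y \<in> Obj C. \<forall>Z \<in> Obj C.
        \<forall>f \<in> hom C W X. \<forall>g \<in> hom C X Y. \<forall>h \<in> hom C Y Z.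
        Comp C h (Comp C g f) = Comp C (Comp C h g) f)"

definition iso :: "('o, 'a) cat \<Rightarrow> 'o \<Rightarrow> 'o \<Rightarrow> 'a \<Rightarrow> bool" where
  "iso C X Y f \<longleftrightarrow>
     f \<in> hom C X Y \<and> (\<exists>g \<in> hom C Y X. Comp C g f = Ident C X \<and> Comp C f g = Ident C Y)"

record ('o, 'a, 'p, 'b) func =
  on_obj :: "'o \<Rightarrow> 'p"
  on_arr :: "'a \<Rightarrow> 'b"

definition is_functor :: "('o, 'a) cat \<Rightarrow> ('p, 'b) cat \<Rightarrow> ('o, 'a, 'p, 'b) func \<Rightarrow> bool" where
  "is_functor C D F \<longleftrightarrow>
     category C \<and> category D \<and>
     (\<forall>X \<in> Obj C. on_obj F X \<in> Obj D) \<and>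
     (\<forall>f \<in> Arr C. on_arr F f \<in> hom D (on_obj F (Dom C f)) (on_obj F (Cod C f))) \<and>
     (\<forall>X \<in> Obj C. on_arr F (Ident C X) = Ident D (on_obj F X)) \<and>
     (\<forall>X \<in> Obj C. \<forall>Y \<in> Obj C. \<forall>Z \<in> Obj C. \<forall>f \<in> hom C X Y. \<forall>g \<in> hom C Y Z.
        on_arr F (Comp C g f) = Comp D (on_arr F g) (on_arr F f))"

definition func_comp ::
  "('p, 'b, 'q, 'c) func \<Rightarrow> ('o, 'a, 'p, 'b) func \<Rightarrow> ('o, 'a, 'q, 'c) func" where
  "func_comp G F = \<lparr>on_obj = on_obj G \<circ> on_obj F, on_arr = on_arr G \<circ> on_arr F\<rparr>"

definition full_subcat :: "('o, 'a) cat \<Rightarrow> ('o \<Rightarrow> bool) \<Rightarrow> ('o, 'a) cat" where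
  "full_subcat C P =
     C\<lparr>Obj := {X \<in> Obj C. P X}, Arr := {f \<in> Arr C. P (Dom C f) \<and> P (Cod C f)}\<rparr>"

text \<open>Families in the power \<open>C\<^sup>J\<close> are extensional functions, so that equality is componentwise.\<close>

definition power_cat :: "('o, 'a) cat \<Rightarrow> 'j set \<Rightarrow> ('j \<Rightarrow> 'o, 'j \<Rightarrow> 'a) cat" where
  "power_cat C J =
     \<lparr>Obj = (J \<rightarrow>\<^sub>E Obj C),
      Arr = (J \<rightarrow>\<^sub>E Arr C),
      Dom = (\<lambda>f. \<lambda>j\<in>J. Dom C (f j)),
      Cod = (\<lambda>f. \<lambda>j\<in>J. Cod C (f j)),
      Ident = (\<lambda>X. \<lambda>j\<in>J. Ident C (X j)),
      Comp = (\<lambda>g f. \<lambda>j\<in>J. Comp C (g j) (f j))\<rparr>"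

record 'e set_map =
  src :: "'e set"
  app :: "'e \<Rightarrow> 'e"
  tgt :: "'e set"

text \<open>The category of the sets belonging to \<open>\<V>\<close> and all maps between them.\<close>

definition set_cat :: "'e set set \<Rightarrow> ('e set, 'e set_map) cat" where
  "set_cat \<V> =
     \<lparr>Obj = \<V>,
      Arr = {f. src f \<in> \<V> \<and> tgt f \<in> \<V> \<and> app f \<in> src f \<rightarrow>\<^sub>E tgt f},
      Dom = src,
      Cod = tgt,
      Ident = (\<lambda>A. \<lparr>src = A, app = (\<lambda>x\<in>A. x), tgt = A\<rparr>),
      Comp = (\<lambda>g f. \<lparr>src = src f, app = compose (src f) (app g) (app f), tgt = tgt g\<rparr>)\<rparr>"


section \<open>Colimits and locally finitely presentable categories\<close>

definition cocone ::
  "('o, 'a) cat \<Rightarrow> ('j, 'k) cat \<Rightarrow> ('j, 'k, 'o, 'a) func \<Rightarrow> 'o \<Rightarrow> ('j \<Rightarrow> 'a) \<Rightarrow> bool" where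
  "cocone C J D X c \<longleftrightarrow>
     X \<in> Obj C \<and>
     (\<forall>j \<in> Obj J. c j \<in> hom C (on_obj D j) X) \<and>
     (\<forall>m \<in> Arr J. Comp C (c (Cod J m)) (on_arr D m) = c (Dom J m))"

definition colimit ::
  "('o, 'a) cat \<Rightarrow> ('j, 'k) cat \<Rightarrow> ('j, 'k, 'o, 'a) func \<Rightarrow> 'o \<Rightarrow> ('j \<Rightarrow> 'a) \<Rightarrow> bool" where
  "colimit C J D X c \<longleftrightarrow>
     cocone C J D X c \<and>
     (\<forall>Y d. cocone C J D Y d \<longrightarrow>
        (\<exists>!h. h \<in> hom C X Y \<and> (\<forall>j \<in> Obj J. Comp C h (c j) = d j)))"

text \<open>
  Every small category (or poset) has an isomorphic copy whose objects and arrows (or elements)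
  are taken from \<open>'u\<close>, so it suffices to let diagrams be indexed by those.
\<close>

definition cocomplete :: "'u itself \<Rightarrow> ('o, 'a) cat \<Rightarrow> bool" where
  "cocomplete U C \<longleftrightarrow>
     (\<forall>(J :: ('u, 'u) cat) D.
        category J \<and> small U (Obj J) \<and> small U (Arr J) \<and> is_functor J C D \<longrightarrow>
        (\<exists>X c. colimit C J D X c))"

definition poset_cat :: "'i set \<Rightarrow> ('i \<Rightarrow> 'i \<Rightarrow> bool) \<Rightarrow> ('i, 'i \<times> 'i) cat" where
  "poset_cat I le =
     \<lparr>Obj = I,
      Arr = {(i, j). i \<in> I \<and> j \<in> I \<and> le i j},
      Dom = fst,
      Cod = snd,
      Ident = (\<lambda>i. (i, i)),
      Comp = (\<lambda>g f. (fst f, snd g))\<rparr>"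

definition directed_poset :: "'i set \<Rightarrow> ('i \<Rightarrow> 'i \<Rightarrow> bool) \<Rightarrow> bool" where
  "directed_poset I le \<longleftrightarrow>
     I \<noteq> {} \<and>
     (\<forall>i \<in> I. le i i) \<and>
     (\<forall>i \<in> I. \<forall>j \<in> I. le i j \<and> le j i \<longrightarrow> i = j) \<and>
     (\<forall>i \<in> I. \<forall>j \<in> I. \<forall>k \<in> I. le i j \<and> le j k \<longrightarrow> le i k) \<and>
     (\<forall>i \<in> I. \<forall>j \<in> I. \<exists>k \<in> I. le i k \<and> le j k)"

text \<open>
  The functor \<open>hom(K, -)\<close>. Its target consists of all sets of arrows, so that no bound on the
  size of the hom-sets is needed.
\<close>

definition hom_functor :: "('o, 'a) cat \<Rightarrow> 'o \<Rightarrow> ('o, 'a, 'a set, 'a set_map) func" where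
  "hom_functor C K =
     \<lparr>on_obj = (\<lambda>X. hom C K X),
      on_arr = (\<lambda>f. \<lparr>src = hom C K (Dom C f),
                      app = (\<lambda>x \<in> hom C K (Dom C f). Comp C f x),
                      tgt = hom C K (Cod C f)\<rparr>)\<rparr>"

definition preserves_directed_colimits ::
  "'u itself \<Rightarrow> ('o, 'a) cat \<Rightarrow> ('p, 'b) cat \<Rightarrow> ('o, 'a, 'p, 'b) func \<Rightarrow> bool" where
  "preserves_directed_colimits U C D F \<longleftrightarrow>
     (\<forall>(I :: 'u set) le E X c.
        small U I \<and> directed_poset I le \<and> is_functor (poset_cat I le) C E \<and>
        colimit C (poset_cat I le) E X c \<longrightarrow>
        colimit D (poset_cat I le) (func_comp F E) (on_obj F X) (\<lambda>i. on_arr F (c i)))"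

definition finitely_presentable :: "'u itself \<Rightarrow> ('o, 'a) cat \<Rightarrow> 'o \<Rightarrow> bool" where
  "finitely_presentable U C K \<longleftrightarrow>
     K \<in> Obj C \<and> preserves_directed_colimits U C (set_cat UNIV) (hom_functor C K)"

definition locally_finitely_presentable :: "'u itself \<Rightarrow> ('o, 'a) cat \<Rightarrow> bool" where
  "locally_finitely_presentable U C \<longleftrightarrow>
     category C \<and> cocomplete U C \<and>
     (\<exists>\<A>. small U \<A> \<and> (\<forall>K \<in> \<A>. finitely_presentable U C K) \<and>
        (\<forall>X \<in> Obj C. \<exists>(I :: 'u set) le D c.
           small U I \<and> directed_poset I le \<and> is_functor (poset_cat I le) C D \<and>
           (\<forall>i \<in> I. on_obj D i \<in> \<A>) \<and> colimit C (poset_cat I le) D X c))"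


section \<open>Topological functors\<close>

text \<open>
  Cones are indexed by an arbitrary set \<open>I\<close> over an arbitrary type \<open>'i\<close>, without any smallness
  condition.
\<close>

definition cone_into ::
  "('o, 'a) cat \<Rightarrow> ('p, 'b) cat \<Rightarrow> ('o, 'a, 'p, 'b) func \<Rightarrow>
   'p \<Rightarrow> 'i set \<Rightarrow> ('i \<Rightarrow> 'o) \<Rightarrow> ('i \<Rightarrow> 'b) \<Rightarrow> bool" where
  "cone_into C D F X I A f \<longleftrightarrow>
     X \<in> Obj D \<and> (\<forall>i \<in> I. A i \<in> Obj C \<and> f i \<in> hom D X (on_obj F (A i)))"

definition initial_lift ::
  "('o, 'a) cat \<Rightarrow> ('p, 'b) cat \<Rightarrow> ('o, 'a, 'p, 'b) func \<Rightarrow>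
   'p \<Rightarrow> 'i set \<Rightarrow> ('i \<Rightarrow> 'o) \<Rightarrow> ('i \<Rightarrow> 'b) \<Rightarrow> 'o \<Rightarrow> ('i \<Rightarrow> 'a) \<Rightarrow> bool" where
  "initial_lift C D F X I A f L g \<longleftrightarrow>
     L \<in> Obj C \<and> (\<forall>i \<in> I. g i \<in> hom C L (A i)) \<and>
     on_obj F L = X \<and> (\<forall>i \<in> I. on_arr F (g i) = f i) \<and>
     (\<forall>B \<in> Obj C. \<forall>h \<in> hom D (on_obj F B) X. \<forall>hb.
        (\<forall>i \<in> I. hb i \<in> hom C B (A i) \<and> Comp D (f i) h = on_arr F (hb i)) \<longrightarrow>
        (\<exists>!k. k \<in> hom C B L \<and> on_arr F k = h))"

definition topological ::
  "'i itself \<Rightarrow> ('o, 'a) cat \<Rightarrow> ('p, 'b) cat \<Rightarrow> ('o, 'a, 'p, 'b) func \<Rightarrow> bool" where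
  "topological TI C D F \<longleftrightarrow>
     is_functor C D F \<and>
     (\<forall>X (I :: 'i set) A f. cone_into C D F X I A f \<longrightarrow>
        (\<exists>!(L, g). g \<in> extensional I \<and> initial_lift C D F X I A f L g))"

text \<open>
  The same notion with the equality \<open>F L = X\<close> replaced by a specified isomorphism
  \<open>\<phi> : F L \<rightarrow> X\<close>; uniqueness of the lift is then uniqueness up to a unique isomorphism.
\<close>

definition initial_lift_upto_iso ::
  "('o, 'a) cat \<Rightarrow> ('p, 'b) cat \<Rightarrow> ('o, 'a, 'p, 'b) func \<Rightarrow>
   'p \<Rightarrow> 'i set \<Rightarrow> ('i \<Rightarrow> 'o) \<Rightarrow> ('i \<Rightarrow> 'b) \<Rightarrow> 'o \<Rightarrow> 'b \<Rightarrow> ('i \<Rightarrow> 'a) \<Rightarrow> bool" where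
  "initial_lift_upto_iso C D F X I A f L \<phi> g \<longleftrightarrow>
     L \<in> Obj C \<and> (\<forall>i \<in> I. g i \<in> hom C L (A i)) \<and>
     iso D (on_obj F L) X \<phi> \<and> (\<forall>i \<in> I. on_arr F (g i) = Comp D (f i) \<phi>) \<and>
     (\<forall>B \<in> Obj C. \<forall>h \<in> hom D (on_obj F B) X. \<forall>hb.
        (\<forall>i \<in> I. hb i \<in> hom C B (A i) \<and> Comp D (f i) h = on_arr F (hb i)) \<longrightarrow>
        (\<exists>!k. k \<in> hom C B L \<and> Comp D \<phi> (on_arr F k) = h))"

definition topological_upto_iso ::
  "'i itself \<Rightarrow> ('o, 'a) cat \<Rightarrow> ('p, 'b) cat \<Rightarrow> ('o, 'a, 'p, 'b) func \<Rightarrow> bool" where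
  "topological_upto_iso TI C D F \<longleftrightarrow>
     is_functor C D F \<and>
     (\<forall>X (I :: 'i set) A f. cone_into C D F X I A f \<longrightarrow>
        (\<exists>L \<phi> g. initial_lift_upto_iso C D F X I A f L \<phi> g) \<and>
        (\<forall>L \<phi> g L' \<phi>' g'.
           initial_lift_upto_iso C D F X I A f L \<phi> g \<and>
           initial_lift_upto_iso C D F X I A f L' \<phi>' g' \<longrightarrow>
           (\<exists>!\<theta>. iso C L L' \<theta> \<and> Comp D \<phi>' (on_arr F \<theta>) = \<phi> \<and>
                 (\<forall>i \<in> I. Comp C (g' i) \<theta> = g i))))"


section \<open>Weak higher dimensional transition systems\<close>

text \<open>
  A transition \<open>(\<alpha>, u\<^sub>1, \<dots>, u\<^sub>n, \<beta>)\<close> is the triple of \<open>\<alpha>\<close>, the list of the \<open>u\<^sub>i\<close>, and \<open>\<beta>\<close>; its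
  dimension \<open>n\<close> is the length of the list, so the union of the \<open>T\<^sub>n\<close> loses no information.
\<close>

record ('u, 'l) whdts =
  states :: "'u set"
  actions :: "'u set"
  labelling :: "'u \<Rightarrow> 'l"
  transitions :: "('u \<times> 'u list \<times> 'u) set"

text \<open>
  In the coherence axiom the lists \<open>us\<close>, \<open>vs\<close>, \<open>ws\<close> are \<open>u\<^sub>1 \<dots> u\<^sub>p\<close>, \<open>u\<^sub>p\<^sub>+\<^sub>1 \<dots> u\<^sub>p\<^sub>+\<^sub>q\<close> and
  \<open>u\<^sub>p\<^sub>+\<^sub>q\<^sub>+\<^sub>1 \<dots> u\<^sub>n\<close>; they are nonempty since \<open>p, q \<ge> 1\<close> and \<open>p + q < n\<close>.
\<close>

definition is_whdts :: "'l set \<Rightarrow> ('u, 'l) whdts \<Rightarrow> bool" where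
  "is_whdts \<Sigma> X \<longleftrightarrow>
     labelling X \<in> actions X \<rightarrow>\<^sub>E \<Sigma> \<and>
     (\<forall>\<alpha> us \<beta>. (\<alpha>, us, \<beta>) \<in> transitions X \<longrightarrow>
        \<alpha> \<in> states X \<and> \<beta> \<in> states X \<and> set us \<subseteq> actions X \<and> length us \<ge> 1) \<and>
     (\<forall>\<alpha> us \<beta> \<sigma>. length us \<ge> 2 \<and> \<sigma> permutes {..<length us} \<and>
        (\<alpha>, us, \<beta>) \<in> transitions X \<longrightarrow> (\<alpha>, permute_list \<sigma> us, \<beta>) \<in> transitions X) \<and>
     (\<forall>\<alpha> us vs ws \<beta> \<nu>\<^sub>1 \<nu>\<^sub>2. us \<noteq> [] \<and> vs \<noteq> [] \<and> ws \<noteq> [] \<and>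
        (\<alpha>, us @ vs @ ws, \<beta>) \<in> transitions X \<and>
        (\<alpha>, us, \<nu>\<^sub>1) \<in> transitions X \<and> (\<nu>\<^sub>1, vs @ ws, \<beta>) \<in> transitions X \<and>
        (\<alpha>, us @ vs, \<nu>\<^sub>2) \<in> transitions X \<and> (\<nu>\<^sub>2, ws, \<beta>) \<in> transitions X \<longrightarrow>
        (\<nu>\<^sub>1, vs, \<nu>\<^sub>2) \<in> transitions X)"

record ('u, 'l) whdts_mor =
  source :: "('u, 'l) whdts"
  on_states :: "'u \<Rightarrow> 'u"
  on_actions :: "'u \<Rightarrow> 'u"
  target :: "('u, 'l) whdts"

definition is_whdts_mor :: "('u, 'l) whdts_mor \<Rightarrow> bool" where
  "is_whdts_mor f \<longleftrightarrow>
     on_states f \<in> states (source f) \<rightarrow>\<^sub>E states (target f) \<and>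
     on_actions f \<in> actions (source f) \<rightarrow>\<^sub>E actions (target f) \<and>
     (\<forall>u \<in> actions (source f). labelling (target f) (on_actions f u) = labelling (source f) u) \<and>
     (\<forall>\<alpha> us \<beta>. (\<alpha>, us, \<beta>) \<in> transitions (source f) \<longrightarrow>
        (on_states f \<alpha>, map (on_actions f) us, on_states f \<beta>) \<in> transitions (target f))"

definition WHDTS :: "'l set \<Rightarrow> (('u, 'l) whdts, ('u, 'l) whdts_mor) cat" where
  "WHDTS \<Sigma> =
     (let Ob = {X. is_whdts \<Sigma> X \<and> small TYPE('u) (states X) \<and> small TYPE('u) (actions X)} in
      \<lparr>Obj = Ob,
       Arr = {f. source f \<in> Ob \<and> target f \<in> Ob \<and> is_whdts_mor f},
       Dom = source,
       Cod = target,
       Ident = (\<lambda>X. \<lparr>source = X, on_states = (\<lambda>x \<in> states X. x),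
                      on_actions = (\<lambda>u \<in> actions X. u), target = X\<rparr>),
       Comp = (\<lambda>g f. \<lparr>source = source f,
                       on_states = compose (states (source f)) (on_states g) (on_states f),
                       on_actions = compose (actions (source f)) (on_actions g) (on_actions f),
                       target = target g\<rparr>)\<rparr>)"

definition fibre :: "('u, 'l) whdts \<Rightarrow> 'l \<Rightarrow> 'u set" where
  "fibre X x = {u \<in> actions X. labelling X u = x}"

definition Set_power :: "'l \<Rightarrow> 'l set \<Rightarrow> ('l \<Rightarrow> 'u set, 'l \<Rightarrow> 'u set_map) cat" where
  "Set_power s \<Sigma> = power_cat (set_cat {A :: 'u set. small TYPE('u) A}) ({s} \<union> \<Sigma>)"

definition omega :: "'l \<Rightarrow> 'l set \<Rightarrow>
  (('u, 'l) whdts, ('u, 'l) whdts_mor, 'l \<Rightarrow> 'u set, 'l \<Rightarrow> 'u set_map) func" where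
  "omega s \<Sigma> =
     \<lparr>on_obj = (\<lambda>X. \<lambda>x \<in> {s} \<union> \<Sigma>. if x = s then states X else fibre X x),
      on_arr = (\<lambda>f. \<lambda>x \<in> {s} \<union> \<Sigma>.
        if x = s
        then \<lparr>src = states (source f), app = on_states f, tgt = states (target f)\<rparr>
        else \<lparr>src = fibre (source f) x, app = restrict (on_actions f) (fibre (source f) x),
              tgt = fibre (target f) x\<rparr>)\<rparr>"

text \<open>
  The fibres of a labelling map are pairwise disjoint, so (as soon as \<open>\<Sigma>\<close> has two elements) a
  tuple of overlapping sets is only isomorphic, not equal, to a tuple in the image of \<open>omega\<close>, and
  the equality \<open>F L = X\<close> of an initial lift cannot be had for it. There are two ways out: weaken
  this equality to a specified isomorphism (\<open>topological_upto_iso\<close>), or keep it and use the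
  following equivalent full subcategory as the target. The subcategory constrains only the
  components at labels, and contains an isomorphic copy of every tuple.
\<close>

definition Set_power_disjoint :: "'l \<Rightarrow> 'l set \<Rightarrow> ('l \<Rightarrow> 'u set, 'l \<Rightarrow> 'u set_map) cat" where
  "Set_power_disjoint s \<Sigma> = full_subcat (Set_power s \<Sigma>) (\<lambda>X. disjoint_family_on X \<Sigma>)"

end

theory Submission
  imports Defs
begin

text \<open>
  A weak higher dimensional transition system is a pair of sets, the states and the labelled actions,
  together with a set of transitions. The multiset and coherence axioms are closure conditions on
  that set: from finitely many transitions they infer another one, whose dimension is not larger.
  Hence the admissible transition sets are stable under arbitrary intersections and under inverse
  image along maps of states and actions (\<open>closed_transitions_Inter\<close>,
  \<open>closed_transitions_vimage\<close>).

  This makes \<open>omega\<close> topological. Over a cone of tuples of sets, the coarsest structure making all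
  maps preserve transitions is an intersection of inverse images, so it satisfies the axioms, and it
  is the initial lift (\<open>initial_lift_initial_system\<close>). It is unique because a morphism above an
  identity is an inclusion of transition sets (\<open>omega_amnestic\<close>). A tuple with overlapping
  components is first replaced by an isomorphic disjoint one, and the lift is carried along the
  isomorphism (\<open>topological_imp_upto_iso\<close>).

  It also yields colimits: quotient the disjoint unions of the states and of the actions, and take
  the transitions generated by the images (\<open>glued_colimit\<close>). For a directed diagram nothing has to
  be generated. The premises of an axiom are finitely many transitions on finitely many states and
  actions, and such a finite piece lifts along a partial section to one stage, where the conclusion
  is available (\<open>finite_lift\<close>, \<open>closed_images\<close>). The same lifting property shows that a system with
  finitely many states, actions and transitions is finitely presentable
  (\<open>finite_imp_finitely_presentable\<close>).

  Finally, every system is the directed union of its finite subsystems: choose finitely many states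
  and actions and truncate at some dimension, which the axioms respect (\<open>stages_colimit\<close>). Copied
  onto a fixed countable set, the finite systems form a small set, since the label set is small and
  the universe is uncountable and regular (\<open>small_fin_systems\<close>).
\<close>


section \<open>Small sets\<close>

lemma small_subset: "small U B \<Longrightarrow> A \<subseteq> B \<Longrightarrow> small U A"
  unfolding small_def using card_of_mono1 ordLeq_ordLess_trans by blast

lemma small_image: "small U A \<Longrightarrow> small U (f ` A)"
  unfolding small_def using card_of_image ordLeq_ordLess_trans by blast

lemma small_inj_on: "inj_on f A \<Longrightarrow> f ` A \<subseteq> B \<Longrightarrow> small U B \<Longrightarrow> small U A"
  using small_image[of U "f ` A" "inv_into A f"] small_subset[of U B "f ` A"] by simp

lemma small_embeds:
  assumes "small TYPE('u) A"
  obtains f :: "'a \<Rightarrow> 'u" where "inj_on f A"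
proof -
  have "(card_of A, card_of (UNIV :: 'u set)) \<in> ordLeq" using assms ordLess_imp_ordLeq unfolding small_def by blast
  then show thesis using that unfolding card_of_ordLeq[symmetric] by blast
qed

lemma infinite_universe: "regular_universe TYPE('u) \<Longrightarrow> infinite (UNIV :: 'u set)"
  unfolding regular_universe_def using countable_finite by auto

text \<open>
  Uncountability of the universe is what makes finite and countable data small; in particular the
  finite systems on a countable carrier will form a small set.
\<close>

lemma small_countable:
  assumes "regular_universe TYPE('u)" and "countable A"
  shows "small TYPE('u) A"
proof (rule ccontr)
  assume "\<not> small TYPE('u) A"
  then have "(card_of (UNIV :: 'u set), card_of A) \<in> ordLeq"
    unfolding small_def by (simp only: not_ordLess_iff_ordLeq[OF card_of_Well_order card_of_Well_order])
  then obtain f :: "'u \<Rightarrow> 'a" where f: "inj f" "f ` UNIV \<subseteq> A"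
    unfolding card_of_ordLeq[symmetric] by blast
  then have "countable (UNIV :: 'u set)"
    by (intro countable_image_inj_on[OF _ f(1)] countable_subset[OF f(2) assms(2)])
  then show False using assms(1) unfolding regular_universe_def by blast
qed

text \<open>
  Regularity of the universe, in the form in which it is used below: gluing a small diagram of small
  sets yields a small set.
\<close>

lemma small_UN:
  assumes "regular_universe TYPE('u)" "small TYPE('u) I" "\<And>i. i \<in> I \<Longrightarrow> small TYPE('u) (A i)"
  shows "small TYPE('u) (\<Union>i\<in>I. A i)"
proof -
  have "stable (card_of (UNIV :: 'u set))"
    using assms(1) infinite_universe[OF assms(1)]
    by (intro regularCard_stable) (auto simp: regular_universe_def Field_card_of card_of_card_order_on)
  then show ?thesis using assms(2,3) unfolding small_def by (rule stable_UNION)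
qed

lemma small_Sigma:
  assumes "regular_universe TYPE('u)" "small TYPE('u) I" "\<And>i. i \<in> I \<Longrightarrow> small TYPE('u) (A i)"
  shows "small TYPE('u) (Sigma I A)"
proof -
  have "small TYPE('u) (\<Union>i\<in>I. Pair i ` A i)"
    by (rule small_UN[OF assms(1,2) small_image[OF assms(3)]])
  moreover have "Sigma I A = (\<Union>i\<in>I. Pair i ` A i)" by auto
  ultimately show ?thesis by simp
qed

lemma small_lists:
  assumes "regular_universe TYPE('u)" "small TYPE('u) A"
  shows "small TYPE('u) (lists A)"
proof -
  have "small TYPE('u) {xs \<in> lists A. length xs = n}" for n
  proof (induction n)
    case 0
    have "{xs \<in> lists A. length xs = 0} \<subseteq> {[]}" by auto
    then show ?case by (rule small_subset[rotated]) (simp add: small_countable[OF assms(1)])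
  next
    case (Suc n)
    have "{xs \<in> lists A. length xs = Suc n} \<subseteq>
        (\<lambda>(x, xs). x # xs) ` (A \<times> {xs \<in> lists A. length xs = n})"
      by (auto simp: length_Suc_conv)
    then show ?case by (rule small_subset[OF small_image[OF small_Sigma[OF assms Suc]]])
  qed
  then have "small TYPE('u) (\<Union>n::nat. {xs \<in> lists A. length xs = n})"
    by (intro small_UN[OF assms(1) small_countable[OF assms(1)]]) auto
  then show ?thesis by (rule small_subset) auto
qed

lemma small_Fpow:
  assumes "regular_universe TYPE('u)" "small TYPE('u) A"
  shows "small TYPE('u) (Fpow A)"
proof -
  have "Fpow A \<subseteq> set ` lists A"
  proof
    fix B assume B: "B \<in> Fpow A"
    then obtain xs where xs: "set xs = B" using finite_list unfolding Fpow_def by auto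
    then have "xs \<in> lists A" using B unfolding Fpow_def by auto
    then show "B \<in> set ` lists A" using xs by blast
  qed
  then show ?thesis by (rule small_subset[OF small_image[OF small_lists[OF assms]]])
qed


section \<open>Categories and functors\<close>

lemma hom_iff: "f \<in> hom C X Y \<longleftrightarrow> f \<in> Arr C \<and> Dom C f = X \<and> Cod C f = Y"
  unfolding hom_def by simp

lemma category_hom_Obj:
  assumes "category C" "f \<in> hom C X Y"
  shows "X \<in> Obj C" "Y \<in> Obj C"
  using assms unfolding category_def hom_iff by auto

lemma category_Arr: "category C \<Longrightarrow> f \<in> Arr C \<Longrightarrow> Dom C f \<in> Obj C \<and> Cod C f \<in> Obj C"
  unfolding category_def by simp

lemma categoryI:
  assumes "\<And>f. f \<in> Arr C \<Longrightarrow> Dom C f \<in> Obj C \<and> Cod C f \<in> Obj C"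
    and "\<And>X. X \<in> Obj C \<Longrightarrow> Ident C X \<in> hom C X X"
    and "\<And>X Y Z f g. f \<in> hom C X Y \<Longrightarrow> g \<in> hom C Y Z \<Longrightarrow> Comp C g f \<in> hom C X Z"
    and "\<And>X Y f. f \<in> hom C X Y \<Longrightarrow> Comp C f (Ident C X) = f"
    and "\<And>X Y f. f \<in> hom C X Y \<Longrightarrow> Comp C (Ident C Y) f = f"
    and "\<And>W X Y Z f g h. f \<in> hom C W X \<Longrightarrow> g \<in> hom C X Y \<Longrightarrow> h \<in> hom C Y Z \<Longrightarrow>
      Comp C h (Comp C g f) = Comp C (Comp C h g) f"
  shows "category C"
  unfolding category_def using assms by simp

lemma category_Ident_hom: "category C \<Longrightarrow> X \<in> Obj C \<Longrightarrow> Ident C X \<in> hom C X X"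
  unfolding category_def by simp

lemma category_Comp_hom:
  assumes "category C" "f \<in> hom C X Y" "g \<in> hom C Y Z"
  shows "Comp C g f \<in> hom C X Z"
proof -
  have "X \<in> Obj C" "Y \<in> Obj C" "Z \<in> Obj C" using assms category_hom_Obj by metis+
  then show ?thesis using assms unfolding category_def by simp
qed

lemma category_Comp_Ident:
  assumes "category C" "f \<in> hom C X Y"
  shows "Comp C f (Ident C X) = f" "Comp C (Ident C Y) f = f"
proof -
  have "X \<in> Obj C" "Y \<in> Obj C" using assms category_hom_Obj by metis+
  then show "Comp C f (Ident C X) = f" "Comp C (Ident C Y) f = f"
    using assms unfolding category_def by simp_all
qed

lemma category_assoc:
  assumes "category C" "f \<in> hom C W X" "g \<in> hom C X Y" "h \<in> hom C Y Z"
  shows "Comp C h (Comp C g f) = Comp C (Comp C h g) f"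
proof -
  have "W \<in> Obj C" "X \<in> Obj C" "Y \<in> Obj C" "Z \<in> Obj C"
    using assms category_hom_Obj by metis+
  then show ?thesis using assms unfolding category_def by simp
qed

lemma functor_categories: "is_functor C D F \<Longrightarrow> category C \<and> category D"
  unfolding is_functor_def by simp

lemma functor_Obj: "is_functor C D F \<Longrightarrow> X \<in> Obj C \<Longrightarrow> on_obj F X \<in> Obj D"
  unfolding is_functor_def by simp

lemma functor_hom:
  "is_functor C D F \<Longrightarrow> f \<in> hom C X Y \<Longrightarrow> on_arr F f \<in> hom D (on_obj F X) (on_obj F Y)"
  unfolding is_functor_def by (auto simp: hom_iff)

lemma functor_Arr:
  "is_functor C D F \<Longrightarrow> f \<in> Arr C \<Longrightarrow> on_arr F f \<in> hom D (on_obj F (Dom C f)) (on_obj F (Cod C f))"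
  unfolding is_functor_def by simp

lemma functor_Ident:
  "is_functor C D F \<Longrightarrow> X \<in> Obj C \<Longrightarrow> on_arr F (Ident C X) = Ident D (on_obj F X)"
  unfolding is_functor_def by simp

lemma functor_Comp:
  assumes "is_functor C D F" "f \<in> hom C X Y" "g \<in> hom C Y Z"
  shows "on_arr F (Comp C g f) = Comp D (on_arr F g) (on_arr F f)"
proof -
  have "X \<in> Obj C" "Y \<in> Obj C" "Z \<in> Obj C"
    using assms functor_categories category_hom_Obj by metis+
  then show ?thesis using assms unfolding is_functor_def by simp
qed

lemma functor_cocone:
  assumes F: "is_functor C D F" and E: "is_functor J C E" and c: "cocone C J E X c"
  shows "cocone D J (func_comp F E) (on_obj F X) (\<lambda>j. on_arr F (c j))"
proof -
  have "Comp D (on_arr F (c (Cod J m))) (on_arr F (on_arr E m)) = on_arr F (c (Dom J m))"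
    if m: "m \<in> Arr J" for m
  proof -
    have "Cod J m \<in> Obj J" using category_Arr[OF conjunct1[OF functor_categories[OF E]] m] by simp
    then have "c (Cod J m) \<in> hom C (on_obj E (Cod J m)) X" using c unfolding cocone_def by simp
    then have "Comp D (on_arr F (c (Cod J m))) (on_arr F (on_arr E m))
        = on_arr F (Comp C (c (Cod J m)) (on_arr E m))"
      using functor_Comp[OF F functor_Arr[OF E m]] by simp
    then show ?thesis using c m unfolding cocone_def by simp
  qed
  moreover have "on_obj F X \<in> Obj D" using c functor_Obj[OF F] unfolding cocone_def by simp
  moreover have "\<forall>j \<in> Obj J. on_arr F (c j) \<in> hom D (on_obj F (on_obj E j)) (on_obj F X)"
    using c functor_hom[OF F] unfolding cocone_def by simp
  ultimately show ?thesis unfolding cocone_def func_comp_def by simp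
qed

lemma set_cat_simps [simp]:
  "Obj (set_cat \<V>) = \<V>" "Dom (set_cat \<V>) = src" "Cod (set_cat \<V>) = tgt"
  "Ident (set_cat \<V>) A = \<lparr>src = A, app = (\<lambda>x\<in>A. x), tgt = A\<rparr>"
  "Comp (set_cat \<V>) g f = \<lparr>src = src f, app = compose (src f) (app g) (app f), tgt = tgt g\<rparr>"
  unfolding set_cat_def by simp_all

lemma set_cat_hom_iff:
  "f \<in> hom (set_cat \<V>) A B \<longleftrightarrow> src f = A \<and> tgt f = B \<and> A \<in> \<V> \<and> B \<in> \<V> \<and> app f \<in> A \<rightarrow>\<^sub>E B"
  unfolding hom_iff by (auto simp: set_cat_def)

lemma set_cat_hom_eqI:
  assumes "f \<in> hom (set_cat \<V>) A B" "g \<in> hom (set_cat \<V>) A B" "\<And>x. x \<in> A \<Longrightarrow> app f x = app g x"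
  shows "f = g"
proof -
  have "app f \<in> A \<rightarrow>\<^sub>E B" "app g \<in> A \<rightarrow>\<^sub>E B" using assms unfolding set_cat_hom_iff by simp_all
  then have "app f = app g" by (rule PiE_ext) (rule assms(3))
  then show ?thesis using assms unfolding set_cat_hom_iff by simp
qed

lemma category_set_cat: "category (set_cat \<V>)"
proof (rule categoryI)
  fix W X Y Z f g h
  assume "f \<in> hom (set_cat \<V>) W X" "g \<in> hom (set_cat \<V>) X Y" "h \<in> hom (set_cat \<V>) Y Z"
  then show "Comp (set_cat \<V>) h (Comp (set_cat \<V>) g f) = Comp (set_cat \<V>) (Comp (set_cat \<V>) h g) f"
    by (auto simp: set_cat_hom_iff compose_def fun_eq_iff PiE_iff)
next
  fix X Y f assume f: "f \<in> hom (set_cat \<V>) X Y"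
  show "Comp (set_cat \<V>) f (Ident (set_cat \<V>) X) = f"
    by (rule set_cat_hom_eqI[OF _ f]) (use f in \<open>auto simp: set_cat_hom_iff compose_def\<close>)
  show "Comp (set_cat \<V>) (Ident (set_cat \<V>) Y) f = f"
    by (rule set_cat_hom_eqI[OF _ f]) (use f in \<open>auto simp: set_cat_hom_iff compose_def\<close>)
qed (auto simp: set_cat_hom_iff compose_def, auto simp: set_cat_def)

lemma power_cat_hom_iff:
  "f \<in> hom (power_cat C J) X Y \<longleftrightarrow>
    X \<in> extensional J \<and> Y \<in> extensional J \<and> f \<in> extensional J \<and> (\<forall>j\<in>J. f j \<in> hom C (X j) (Y j))"
  unfolding hom_iff power_cat_def by (auto simp: PiE_iff extensional_def fun_eq_iff)

lemma category_power_cat: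
  assumes C: "category C"
  shows "category (power_cat C J)"
proof (rule categoryI)
  fix f assume "f \<in> Arr (power_cat C J)"
  then show "Dom (power_cat C J) f \<in> Obj (power_cat C J) \<and> Cod (power_cat C J) f \<in> Obj (power_cat C J)"
    using category_Arr[OF C] by (auto simp: power_cat_def PiE_iff)
next
  fix X assume "X \<in> Obj (power_cat C J)"
  then show "Ident (power_cat C J) X \<in> hom (power_cat C J) X X"
    unfolding power_cat_hom_iff using category_Ident_hom[OF C] by (auto simp: power_cat_def PiE_iff)
next
  fix X Y Z f g assume "f \<in> hom (power_cat C J) X Y" "g \<in> hom (power_cat C J) Y Z"
  then show "Comp (power_cat C J) g f \<in> hom (power_cat C J) X Z"
    unfolding power_cat_hom_iff using category_Comp_hom[OF C] by (auto simp: power_cat_def)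
next
  fix X Y f assume "f \<in> hom (power_cat C J) X Y"
  then show "Comp (power_cat C J) f (Ident (power_cat C J) X) = f"
    and "Comp (power_cat C J) (Ident (power_cat C J) Y) f = f"
    unfolding power_cat_hom_iff using category_Comp_Ident[OF C]
    by (auto simp: power_cat_def intro!: extensionalityI[of _ J])
next
  fix W X Y Z f g h
  assume "f \<in> hom (power_cat C J) W X" "g \<in> hom (power_cat C J) X Y" "h \<in> hom (power_cat C J) Y Z"
  then have "Comp C (h j) (Comp C (g j) (f j)) = Comp C (Comp C (h j) (g j)) (f j)" if "j \<in> J" for j
    using that category_assoc[OF C, of "f j" "W j" "X j" "g j" "Y j" "h j" "Z j"]
    by (simp add: power_cat_hom_iff)
  then show "Comp (power_cat C J) h (Comp (power_cat C J) g f)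
      = Comp (power_cat C J) (Comp (power_cat C J) h g) f"
    by (auto simp: power_cat_def intro!: extensionalityI[of _ J])
qed

lemma full_subcat_simps [simp]:
  "Obj (full_subcat C P) = {X \<in> Obj C. P X}"
  "Dom (full_subcat C P) = Dom C" "Cod (full_subcat C P) = Cod C"
  "Ident (full_subcat C P) = Ident C" "Comp (full_subcat C P) = Comp C"
  unfolding full_subcat_def by simp_all

lemma full_subcat_hom_iff: "f \<in> hom (full_subcat C P) X Y \<longleftrightarrow> f \<in> hom C X Y \<and> P X \<and> P Y"
  unfolding hom_iff by (auto simp: full_subcat_def)

lemma category_full_subcat:
  assumes C: "category C"
  shows "category (full_subcat C P)"
proof (rule categoryI)
  fix f assume "f \<in> Arr (full_subcat C P)"
  then show "Dom (full_subcat C P) f \<in> Obj (full_subcat C P) \<and> Cod (full_subcat C P) f \<in> Obj (full_subcat C P)"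
    using category_Arr[OF C, of f] by (simp add: full_subcat_def)
next
  fix W X Y Z f g h
  assume "f \<in> hom (full_subcat C P) W X" "g \<in> hom (full_subcat C P) X Y" "h \<in> hom (full_subcat C P) Y Z"
  then show "Comp (full_subcat C P) h (Comp (full_subcat C P) g f)
      = Comp (full_subcat C P) (Comp (full_subcat C P) h g) f"
    using category_assoc[OF C, of f W X g Y h Z] by (simp add: full_subcat_hom_iff)
next
  fix X Y Z f g assume "f \<in> hom (full_subcat C P) X Y" "g \<in> hom (full_subcat C P) Y Z"
  then show "Comp (full_subcat C P) g f \<in> hom (full_subcat C P) X Z"
    using category_Comp_hom[OF C, of f X Y g Z] by (simp add: full_subcat_hom_iff)
qed (auto simp: full_subcat_hom_iff intro: category_Ident_hom[OF C] category_Comp_Ident[OF C])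

lemma functor_full_subcat:
  assumes "is_functor C D F" "\<And>X. X \<in> Obj C \<Longrightarrow> P (on_obj F X)"
  shows "is_functor C (full_subcat D P) F"
  using assms category_full_subcat[of D P] category_Arr[of C] unfolding is_functor_def
  by (simp add: full_subcat_hom_iff)

lemma functor_hom_functor:
  assumes C: "category C" and K: "K \<in> Obj C"
  shows "is_functor C (set_cat UNIV) (hom_functor C K)"
  unfolding is_functor_def
proof (intro conjI ballI C category_set_cat)
  fix f assume "f \<in> Arr C"
  then have "f \<in> hom C (Dom C f) (Cod C f)" by (simp add: hom_iff)
  from category_Comp_hom[OF C _ this]
  show "on_arr (hom_functor C K) f \<in>
      hom (set_cat UNIV) (on_obj (hom_functor C K) (Dom C f)) (on_obj (hom_functor C K) (Cod C f))"
    by (simp add: set_cat_hom_iff hom_functor_def)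
next
  fix X assume "X \<in> Obj C"
  from category_Ident_hom[OF C this] category_Comp_Ident[OF C]
  show "on_arr (hom_functor C K) (Ident C X) = Ident (set_cat UNIV) (on_obj (hom_functor C K) X)"
    by (auto simp: hom_functor_def hom_iff fun_eq_iff)
next
  fix X Y Z f g assume f: "f \<in> hom C X Y" and g: "g \<in> hom C Y Z"
  note fg = category_Comp_hom[OF C f g]
  have "Comp C (Comp C g f) x = Comp C g (Comp C f x) \<and> Comp C f x \<in> hom C K Y" if "x \<in> hom C K X" for x
    using category_assoc[OF C that f g] category_Comp_hom[OF C that f] by simp
  then show "on_arr (hom_functor C K) (Comp C g f) =
      Comp (set_cat UNIV) (on_arr (hom_functor C K) g) (on_arr (hom_functor C K) f)"
    using f g fg by (auto simp: hom_functor_def compose_def fun_eq_iff hom_iff)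
qed (simp add: hom_functor_def)


section \<open>Colimits of sets\<close>

text \<open>
  Colimits of sets are handled elementwise, for a diagram given by sets \<open>A j\<close> and maps \<open>a m\<close>.
  This lets the same lemmas serve for the states, for the actions and for the hom-sets of systems.
  A compatible family is a cocone whose codomain is left open.
\<close>

definition compatible :: "('j, 'k) cat \<Rightarrow> ('j \<Rightarrow> 'e set) \<Rightarrow> ('k \<Rightarrow> 'e \<Rightarrow> 'e) \<Rightarrow> ('j \<Rightarrow> 'e \<Rightarrow> 'b) \<Rightarrow> bool" where
  "compatible J A a f \<longleftrightarrow> (\<forall>m \<in> Arr J. \<forall>x \<in> A (Dom J m). f (Cod J m) (a m x) = f (Dom J m) x)"

text \<open>
  The family \<open>c\<close> covers \<open>Q\<close> and identifies only what every cocone must identify. Cocones with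
  values in \<open>'e\<close> suffice as tests: the sets of states, of actions and of morphisms that occur as
  vertices are all sets of elements of the type of \<open>Q\<close>.
\<close>

definition presents_colimit ::
  "('j, 'k) cat \<Rightarrow> ('j \<Rightarrow> 'e set) \<Rightarrow> ('k \<Rightarrow> 'e \<Rightarrow> 'e) \<Rightarrow> ('j \<Rightarrow> 'e \<Rightarrow> 'e) \<Rightarrow> 'e set \<Rightarrow> bool" where
  "presents_colimit J A a c Q \<longleftrightarrow>
     Q \<subseteq> (\<Union>j \<in> Obj J. c j ` A j) \<and>
     (\<forall>f :: 'j \<Rightarrow> 'e \<Rightarrow> 'e. compatible J A a f \<longrightarrow>
        (\<forall>i \<in> Obj J. \<forall>j \<in> Obj J. \<forall>x \<in> A i. \<forall>y \<in> A j. c i x = c j y \<longrightarrow> f i x = f j y))"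

lemma presents_colimit_factor:
  fixes f :: "'j \<Rightarrow> 'e \<Rightarrow> 'e"
  assumes Q: "presents_colimit J A a c Q" and f: "compatible J A a f"
    and Y: "\<And>j x. j \<in> Obj J \<Longrightarrow> x \<in> A j \<Longrightarrow> f j x \<in> Y"
  shows "\<exists>h. h \<in> Q \<rightarrow>\<^sub>E Y \<and> (\<forall>j \<in> Obj J. \<forall>x \<in> A j. c j x \<in> Q \<longrightarrow> h (c j x) = f j x)"
proof -
  have "\<exists>y. \<forall>j \<in> Obj J. \<forall>x \<in> A j. z = c j x \<longrightarrow> f j x = y" for z
  proof (cases "\<exists>j \<in> Obj J. \<exists>x \<in> A j. z = c j x")
    case True
    then obtain i y where i: "i \<in> Obj J" "y \<in> A i" "z = c i y" by blast
    have "f j x = f i y" if "j \<in> Obj J" "x \<in> A j" "z = c j x" for j x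
    proof -
      have "c j x = c i y" using that(3) i(3) by simp
      then show ?thesis using Q f that(1,2) i(1,2) unfolding presents_colimit_def by simp
    qed
    then show ?thesis by blast
  qed blast
  then obtain h where "\<forall>z. \<forall>j \<in> Obj J. \<forall>x \<in> A j. z = c j x \<longrightarrow> f j x = h z" by metis
  then have h: "\<And>z j x. j \<in> Obj J \<Longrightarrow> x \<in> A j \<Longrightarrow> z = c j x \<Longrightarrow> f j x = h z" by blast
  show ?thesis
  proof (intro exI conjI ballI impI)
    show "restrict h Q \<in> Q \<rightarrow>\<^sub>E Y"
    proof (rule restrict_PiE_iff[THEN iffD2], rule ballI)
      fix z assume "z \<in> Q"
      then obtain j x where "j \<in> Obj J" "x \<in> A j" "z = c j x"
        using Q unfolding presents_colimit_def by blast
      then show "h z \<in> Y" using h Y by metis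
    qed
    show "restrict h Q (c j x) = f j x" if "j \<in> Obj J" "x \<in> A j" "c j x \<in> Q" for j x
      using h[OF that(1,2) refl] that(3) by simp
  qed
qed

lemma presents_colimit_cong:
  assumes "\<And>j x. j \<in> Obj J \<Longrightarrow> x \<in> A j \<Longrightarrow> c j x = c' j x"
  shows "presents_colimit J A a c Q \<longleftrightarrow> presents_colimit J A a c' Q"
proof -
  have "(\<Union>j \<in> Obj J. c j ` A j) = (\<Union>j \<in> Obj J. c' j ` A j)" using assms by (auto simp: image_iff)
  then show ?thesis unfolding presents_colimit_def using assms by simp
qed

text \<open>
  If \<open>c i x = c j y\<close> is witnessed by an equality at a later stage \<open>k\<close>, a compatible family
  takes the same value at \<open>x\<close>, at their common image and at \<open>y\<close>.
\<close>

lemma directed_presents_colimit: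
  fixes A :: "'i \<Rightarrow> 'e set"
  assumes "Q \<subseteq> (\<Union>i \<in> I. c i ` A i)"
    and "\<And>i j x y. i \<in> I \<Longrightarrow> j \<in> I \<Longrightarrow> x \<in> A i \<Longrightarrow> y \<in> A j \<Longrightarrow> c i x = c j y \<Longrightarrow>
      \<exists>k \<in> I. le i k \<and> le j k \<and> a (i, k) x = a (j, k) y"
  shows "presents_colimit (poset_cat I le) A a c Q"
  unfolding presents_colimit_def
proof (intro conjI allI impI ballI)
  show "Q \<subseteq> (\<Union>j \<in> Obj (poset_cat I le). c j ` A j)" using assms(1) by (simp add: poset_cat_def)
next
  fix f :: "'i \<Rightarrow> 'e \<Rightarrow> 'e" and i j x y
  assume f: "compatible (poset_cat I le) A a f"
    and ij: "i \<in> Obj (poset_cat I le)" "j \<in> Obj (poset_cat I le)"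
    and xy: "x \<in> A i" "y \<in> A j" "c i x = c j y"
  have "i \<in> I" "j \<in> I" using ij by (simp_all add: poset_cat_def)
  with assms(2)[OF _ _ xy] obtain k where k: "k \<in> I" "le i k" "le j k" "a (i, k) x = a (j, k) y" by blast
  have "f k (a (i', k) x') = f i' x'" if "i' \<in> I" "le i' k" "x' \<in> A i'" for i' x'
    using f that k(1) unfolding compatible_def by (auto simp: poset_cat_def)
  from this[of i x] this[of j y] show "f i x = f j y"
    using k \<open>i \<in> I\<close> \<open>j \<in> I\<close> xy(1,2) by simp
qed

lemma set_cat_colimitI:
  assumes c: "cocone (set_cat UNIV) J G Q c"
    and Q: "presents_colimit J (on_obj G) (\<lambda>m. app (on_arr G m)) (\<lambda>j. app (c j)) Q"
    and J: "category J"
    and G: "\<And>m. m \<in> Arr J \<Longrightarrow> on_arr G m \<in> hom (set_cat UNIV) (on_obj G (Dom J m)) (on_obj G (Cod J m))"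
  shows "colimit (set_cat UNIV) J G Q c"
  unfolding colimit_def
proof (intro conjI allI impI c)
  fix Y d assume d: "cocone (set_cat UNIV) J G Y d"
  have ch: "c j \<in> hom (set_cat UNIV) (on_obj G j) Q" if "j \<in> Obj J" for j
    using c that unfolding cocone_def by blast
  have dh: "d j \<in> hom (set_cat UNIV) (on_obj G j) Y" if "j \<in> Obj J" for j
    using d that unfolding cocone_def by blast
  have "compatible J (on_obj G) (\<lambda>m. app (on_arr G m)) (\<lambda>j. app (d j))"
    unfolding compatible_def
  proof (intro ballI)
    fix m x assume m: "m \<in> Arr J" and x: "x \<in> on_obj G (Dom J m)"
    have "app (Comp (set_cat UNIV) (d (Cod J m)) (on_arr G m)) x = app (d (Dom J m)) x"
      using d m unfolding cocone_def by simp
    then show "app (d (Cod J m)) (app (on_arr G m) x) = app (d (Dom J m)) x"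
      using G[OF m] x by (simp add: set_cat_hom_iff compose_def)
  qed
  moreover have "app (d j) x \<in> Y" if "j \<in> Obj J" "x \<in> on_obj G j" for j x
    using dh[OF that(1)] that(2) by (auto simp: set_cat_hom_iff)
  ultimately obtain h where h: "h \<in> Q \<rightarrow>\<^sub>E Y"
    and hc: "\<And>j x. j \<in> Obj J \<Longrightarrow> x \<in> on_obj G j \<Longrightarrow> app (c j) x \<in> Q \<Longrightarrow> h (app (c j) x) = app (d j) x"
    using presents_colimit_factor[OF Q, of "\<lambda>j. app (d j)" Y] by blast
  have cQ: "app (c j) x \<in> Q" if "j \<in> Obj J" "x \<in> on_obj G j" for j x
    using ch[OF that(1)] that(2) by (auto simp: set_cat_hom_iff)
  show "\<exists>!h. h \<in> hom (set_cat UNIV) Q Y \<and> (\<forall>j\<in>Obj J. Comp (set_cat UNIV) h (c j) = d j)"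
  proof (rule ex1I)
    let ?h = "\<lparr>src = Q, app = h, tgt = Y\<rparr>"
    have hom: "?h \<in> hom (set_cat UNIV) Q Y" using h by (simp add: set_cat_hom_iff)
    have "Comp (set_cat UNIV) ?h (c j) = d j" if j: "j \<in> Obj J" for j
    proof (rule set_cat_hom_eqI[OF category_Comp_hom[OF category_set_cat ch[OF j] hom] dh[OF j]])
      fix x assume "x \<in> on_obj G j"
      then show "app (Comp (set_cat UNIV) ?h (c j)) x = app (d j) x"
        using hc[OF j _ cQ[OF j]] ch[OF j] by (simp add: set_cat_hom_iff compose_def)
    qed
    then show "?h \<in> hom (set_cat UNIV) Q Y \<and> (\<forall>j\<in>Obj J. Comp (set_cat UNIV) ?h (c j) = d j)"
      using hom by blast
    fix k assume k: "k \<in> hom (set_cat UNIV) Q Y \<and> (\<forall>j\<in>Obj J. Comp (set_cat UNIV) k (c j) = d j)"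
    show "k = ?h"
    proof (rule set_cat_hom_eqI[OF _ hom])
      show "k \<in> hom (set_cat UNIV) Q Y" using k by blast
      fix z assume "z \<in> Q"
      then obtain j x where jx: "j \<in> Obj J" "x \<in> on_obj G j" "z = app (c j) x"
        using Q unfolding presents_colimit_def by blast
      have "app k z = app (Comp (set_cat UNIV) k (c j)) x"
        using jx ch[OF jx(1)] by (simp add: set_cat_hom_iff compose_def)
      also have "\<dots> = app (d j) x" using k jx(1) by simp
      also have "\<dots> = app ?h z" using hc[OF jx(1,2) cQ[OF jx(1,2)]] jx(3) by simp
      finally show "app k z = app ?h z" .
    qed
  qed
qed

text \<open>Codes pairs by elements of an infinite universe, to name elements of disjoint unions.\<close>

definition pair_code :: "'u \<times> 'u \<Rightarrow> 'u" where
  "pair_code = (SOME e. inj e)"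

lemma inj_pair_code:
  assumes "infinite (UNIV :: 'u set)"
  shows "inj (pair_code :: 'u \<times> 'u \<Rightarrow> 'u)"
proof -
  have "(card_of (UNIV \<times> UNIV :: ('u \<times> 'u) set), card_of (UNIV :: 'u set)) \<in> ordLeq"
    using card_of_Times_same_infinite[OF assms] ordIso_imp_ordLeq by blast
  then have "\<exists>e :: 'u \<times> 'u \<Rightarrow> 'u. inj e" unfolding card_of_ordLeq[symmetric] by auto
  then show ?thesis unfolding pair_code_def by (rule someI_ex)
qed

definition glue_rel :: "('u, 'k) cat \<Rightarrow> ('u \<Rightarrow> 'u set) \<Rightarrow> ('k \<Rightarrow> 'u \<Rightarrow> 'u) \<Rightarrow> (('u \<times> 'u) \<times> ('u \<times> 'u)) set" where
  "glue_rel J A a = {((Dom J m, x), (Cod J m, a m x)) | m x. m \<in> Arr J \<and> x \<in> A (Dom J m)}"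

text \<open>
  The class of \<open>x \<in> A j\<close> in the disjoint union of the \<open>A j\<close> modulo the equivalence generated by the
  arrows of the diagram. It is named by the code of a chosen member, so that the quotient is again a
  set of elements of the universe.
\<close>

definition glue :: "('u, 'k) cat \<Rightarrow> ('u \<Rightarrow> 'u set) \<Rightarrow> ('k \<Rightarrow> 'u \<Rightarrow> 'u) \<Rightarrow> 'u \<Rightarrow> 'u \<Rightarrow> 'u" where
  "glue J A a j x = pair_code (SOME p. ((j, x), p) \<in> (glue_rel J A a \<union> (glue_rel J A a)\<inverse>)\<^sup>*)"

lemma compatible_glue: "compatible J A a (glue J A a)"
  unfolding compatible_def
proof (intro ballI)
  fix m x assume "m \<in> Arr J" "x \<in> A (Dom J m)"
  then have "((Dom J m, x), (Cod J m, a m x)) \<in> glue_rel J A a" unfolding glue_rel_def by blast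
  then have "((Cod J m, a m x), p) \<in> (glue_rel J A a \<union> (glue_rel J A a)\<inverse>)\<^sup>* \<longleftrightarrow>
      ((Dom J m, x), p) \<in> (glue_rel J A a \<union> (glue_rel J A a)\<inverse>)\<^sup>*" for p
    by (meson Un_iff converse_iff converse_rtrancl_into_rtrancl)
  then show "glue J A a (Cod J m) (a m x) = glue J A a (Dom J m) x" unfolding glue_def by simp
qed

text \<open>
  The kernel of a compatible family is an equivalence relation containing the generating pairs. The
  values of \<open>f\<close> may be of any type: labels and sets of pairs will occur besides elements.
\<close>

lemma glue_eq_imp:
  fixes f :: "'u \<Rightarrow> 'u \<Rightarrow> 'b"
  assumes inf: "infinite (UNIV :: 'u set)" and f: "compatible J A a f"
    and eq: "glue J A a i x = glue J A a j y"
  shows "f i x = f j y"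
proof -
  let ?R = "(glue_rel J A a \<union> (glue_rel J A a)\<inverse>)\<^sup>*"
  have const: "f (fst p) (snd p) = f (fst q) (snd q)" if "(p, q) \<in> ?R" for p q
    using that
  proof induction
    case (step q r)
    then have "f (fst q) (snd q) = f (fst r) (snd r)"
      using f unfolding compatible_def glue_rel_def by auto
    then show ?case using step by simp
  qed simp
  have "(p, SOME q. (p, q) \<in> ?R) \<in> ?R" for p by (rule someI[of _ p]) simp
  from const[OF this]
  have "f (fst p) (snd p) = f (fst (SOME q. (p, q) \<in> ?R)) (snd (SOME q. (p, q) \<in> ?R))" for p .
  from this[of "(i, x)"] this[of "(j, y)"] show ?thesis
    using eq injD[OF inj_pair_code[OF inf]] unfolding glue_def by (metis fst_conv snd_conv)
qed

lemma glue_presents_colimit: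
  fixes J :: "('u, 'k) cat"
  assumes "infinite (UNIV :: 'u set)"
  shows "presents_colimit J A a (glue J A a) (\<Union>j \<in> Obj J. glue J A a j ` A j)"
  unfolding presents_colimit_def using glue_eq_imp[OF assms] by blast


section \<open>Transition sets closed under the two axioms\<close>

text \<open>
  The multiset and coherence axioms, read as closure conditions on a bare set of transitions. Typing
  is kept apart because without it the conditions are stable under arbitrary intersections, the empty
  one included, and under inverse images along arbitrary maps.
\<close>

definition closed_transitions :: "('u \<times> 'u list \<times> 'u) set \<Rightarrow> bool" where
  "closed_transitions T \<longleftrightarrow>
     (\<forall>\<alpha> us \<beta> \<sigma>. length us \<ge> 2 \<and> \<sigma> permutes {..<length us} \<and> (\<alpha>, us, \<beta>) \<in> T \<longrightarrow>
        (\<alpha>, permute_list \<sigma> us, \<beta>) \<in> T) \<and>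
     (\<forall>\<alpha> us vs ws \<beta> \<nu>\<^sub>1 \<nu>\<^sub>2. us \<noteq> [] \<and> vs \<noteq> [] \<and> ws \<noteq> [] \<and>
        (\<alpha>, us @ vs @ ws, \<beta>) \<in> T \<and> (\<alpha>, us, \<nu>\<^sub>1) \<in> T \<and> (\<nu>\<^sub>1, vs @ ws, \<beta>) \<in> T \<and>
        (\<alpha>, us @ vs, \<nu>\<^sub>2) \<in> T \<and> (\<nu>\<^sub>2, ws, \<beta>) \<in> T \<longrightarrow> (\<nu>\<^sub>1, vs, \<nu>\<^sub>2) \<in> T)"

lemma closed_transitionsI:
  assumes "\<And>\<alpha> us \<beta> \<sigma>. length us \<ge> 2 \<Longrightarrow> \<sigma> permutes {..<length us} \<Longrightarrow> (\<alpha>, us, \<beta>) \<in> T \<Longrightarrow>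
      (\<alpha>, permute_list \<sigma> us, \<beta>) \<in> T"
    and "\<And>\<alpha> us vs ws \<beta> \<nu>\<^sub>1 \<nu>\<^sub>2. us \<noteq> [] \<Longrightarrow> vs \<noteq> [] \<Longrightarrow> ws \<noteq> [] \<Longrightarrow>
      (\<alpha>, us @ vs @ ws, \<beta>) \<in> T \<Longrightarrow> (\<alpha>, us, \<nu>\<^sub>1) \<in> T \<Longrightarrow> (\<nu>\<^sub>1, vs @ ws, \<beta>) \<in> T \<Longrightarrow>
      (\<alpha>, us @ vs, \<nu>\<^sub>2) \<in> T \<Longrightarrow> (\<nu>\<^sub>2, ws, \<beta>) \<in> T \<Longrightarrow> (\<nu>\<^sub>1, vs, \<nu>\<^sub>2) \<in> T"
  shows "closed_transitions T"
  unfolding closed_transitions_def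
proof (intro conjI allI impI; elim conjE)
  show "(\<alpha>, permute_list \<sigma> us, \<beta>) \<in> T"
    if "length us \<ge> 2" "\<sigma> permutes {..<length us}" "(\<alpha>, us, \<beta>) \<in> T" for \<alpha> us \<beta> \<sigma>
    using that by (rule assms(1))
  show "(\<nu>\<^sub>1, vs, \<nu>\<^sub>2) \<in> T"
    if "us \<noteq> []" "vs \<noteq> []" "ws \<noteq> []" "(\<alpha>, us @ vs @ ws, \<beta>) \<in> T" "(\<alpha>, us, \<nu>\<^sub>1) \<in> T"
      "(\<nu>\<^sub>1, vs @ ws, \<beta>) \<in> T" "(\<alpha>, us @ vs, \<nu>\<^sub>2) \<in> T" "(\<nu>\<^sub>2, ws, \<beta>) \<in> T"
    for \<alpha> us vs ws \<beta> \<nu>\<^sub>1 \<nu>\<^sub>2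
    using that by (rule assms(2))
qed

lemma closed_transitions_permute:
  assumes "closed_transitions T" "length us \<ge> 2" "\<sigma> permutes {..<length us}" "(\<alpha>, us, \<beta>) \<in> T"
  shows "(\<alpha>, permute_list \<sigma> us, \<beta>) \<in> T"
  by (rule assms(1)[unfolded closed_transitions_def, THEN conjunct1, rule_format]) (intro conjI assms)

lemma closed_transitions_coherent:
  assumes "closed_transitions T" "us \<noteq> []" "vs \<noteq> []" "ws \<noteq> []"
    "(\<alpha>, us @ vs @ ws, \<beta>) \<in> T" "(\<alpha>, us, \<nu>\<^sub>1) \<in> T" "(\<nu>\<^sub>1, vs @ ws, \<beta>) \<in> T"
    "(\<alpha>, us @ vs, \<nu>\<^sub>2) \<in> T" "(\<nu>\<^sub>2, ws, \<beta>) \<in> T"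
  shows "(\<nu>\<^sub>1, vs, \<nu>\<^sub>2) \<in> T"
proof -
  note coh = assms(1)[unfolded closed_transitions_def, THEN conjunct2]
  note coh = coh[THEN spec[of _ \<alpha>], THEN spec[of _ us], THEN spec[of _ vs], THEN spec[of _ ws]]
  note coh = coh[THEN spec[of _ \<beta>], THEN spec[of _ "\<nu>\<^sub>1"], THEN spec[of _ "\<nu>\<^sub>2"]]
  show ?thesis using assms by (intro coh[THEN mp] conjI)
qed

definition all_transitions :: "'u set \<Rightarrow> 'u set \<Rightarrow> ('u \<times> 'u list \<times> 'u) set" where
  "all_transitions S L = {(\<alpha>, us, \<beta>). \<alpha> \<in> S \<and> \<beta> \<in> S \<and> set us \<subseteq> L \<and> us \<noteq> []}"

lemma is_whdts_iff:
  "is_whdts \<Sigma> X \<longleftrightarrow>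
     labelling X \<in> actions X \<rightarrow>\<^sub>E \<Sigma> \<and>
     transitions X \<subseteq> all_transitions (states X) (actions X) \<and>
     closed_transitions (transitions X)"
proof -
  have "transitions X \<subseteq> all_transitions (states X) (actions X) \<longleftrightarrow>
      (\<forall>\<alpha> us \<beta>. (\<alpha>, us, \<beta>) \<in> transitions X \<longrightarrow>
        \<alpha> \<in> states X \<and> \<beta> \<in> states X \<and> set us \<subseteq> actions X \<and> length us \<ge> 1)"
    unfolding all_transitions_def by (auto simp: Suc_le_eq)
  then show ?thesis unfolding is_whdts_def closed_transitions_def by simp
qed

lemma closed_transitions_Inter:
  assumes "\<And>T. T \<in> \<T> \<Longrightarrow> closed_transitions T"
  shows "closed_transitions (\<Inter>\<T>)"
proof (rule closed_transitionsI; rule InterI)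
  fix \<alpha> us \<beta> \<sigma> T
  assume "2 \<le> length us" "\<sigma> permutes {..<length us}" "(\<alpha>, us, \<beta>) \<in> \<Inter>\<T>" "T \<in> \<T>"
  then show "(\<alpha>, permute_list \<sigma> us, \<beta>) \<in> T" using closed_transitions_permute[OF assms] by simp
next
  fix \<alpha> us vs ws \<beta> \<nu>1 \<nu>2 T
  assume T: "T \<in> \<T>" and ne: "us \<noteq> []" "vs \<noteq> []" "ws \<noteq> []"
    and m: "(\<alpha>, us @ vs @ ws, \<beta>) \<in> \<Inter>\<T>" "(\<alpha>, us, \<nu>1) \<in> \<Inter>\<T>" "(\<nu>1, vs @ ws, \<beta>) \<in> \<Inter>\<T>"
      "(\<alpha>, us @ vs, \<nu>2) \<in> \<Inter>\<T>" "(\<nu>2, ws, \<beta>) \<in> \<Inter>\<T>"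
  show "(\<nu>1, vs, \<nu>2) \<in> T"
    by (rule closed_transitions_coherent[OF assms[OF T] ne]) (rule InterD[OF _ T], rule m)+
qed

lemma closed_transitions_Int: "closed_transitions S \<Longrightarrow> closed_transitions T \<Longrightarrow> closed_transitions (S \<inter> T)"
  using closed_transitions_Inter[of "{S, T}"] by auto

lemma closed_transitions_INT: "(\<And>i. i \<in> I \<Longrightarrow> closed_transitions (F i)) \<Longrightarrow> closed_transitions (\<Inter>i\<in>I. F i)"
  by (rule closed_transitions_Inter) auto

lemma closed_transitions_all: "closed_transitions (all_transitions S L)"
proof (rule closed_transitionsI)
  fix \<alpha> us \<beta> \<sigma>
  assume "2 \<le> length us" "\<sigma> permutes {..<length us}" "(\<alpha>, us, \<beta>) \<in> all_transitions S L"
  then show "(\<alpha>, permute_list \<sigma> us, \<beta>) \<in> all_transitions S L"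
    unfolding all_transitions_def by (auto simp flip: length_greater_0_conv)
qed (simp add: all_transitions_def)

text \<open>
  Neither axiom leads to a transition of higher dimension than its premises. This is what allows a
  system to be truncated at a given dimension.
\<close>

lemma closed_transitions_length_le: "closed_transitions {(\<alpha>, us, \<beta>). length us \<le> n}"
  by (rule closed_transitionsI) simp_all

definition map_transition :: "('a \<Rightarrow> 'b) \<Rightarrow> ('a \<Rightarrow> 'b) \<Rightarrow> 'a \<times> 'a list \<times> 'a \<Rightarrow> 'b \<times> 'b list \<times> 'b" where
  "map_transition p r = map_prod p (map_prod (map r) p)"

lemma map_transition_simp [simp]: "map_transition p r (\<alpha>, us, \<beta>) = (p \<alpha>, map r us, p \<beta>)"
  unfolding map_transition_def by simp

lemma map_transition_comp:
  "map_transition p r (map_transition p' r' t) = map_transition (p \<circ> p') (r \<circ> r') t"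
  by (cases t) simp

lemma map_transition_cong:
  assumes "t \<in> all_transitions S L" "\<And>x. x \<in> S \<Longrightarrow> p x = p' x" "\<And>x. x \<in> L \<Longrightarrow> r x = r' x"
  shows "map_transition p r t = map_transition p' r' t"
  using assms unfolding all_transitions_def by (auto simp: subset_iff)

lemma map_transition_all:
  assumes "t \<in> all_transitions S L" "\<And>x. x \<in> S \<Longrightarrow> p x \<in> S'" "\<And>x. x \<in> L \<Longrightarrow> r x \<in> L'"
  shows "map_transition p r t \<in> all_transitions S' L'"
  using assms unfolding all_transitions_def by (auto simp: subset_iff)

text \<open>
  The axioms only permute, cut and concatenate lists of actions, and \<open>map\<close> commutes with all of
  these.
\<close>

lemma closed_transitions_vimage:
  assumes "closed_transitions T"
  shows "closed_transitions {t. map_transition p r t \<in> T}"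
proof (rule closed_transitionsI)
  fix \<alpha> us \<beta> \<sigma>
  assume "2 \<le> length us" "\<sigma> permutes {..<length us}" "(\<alpha>, us, \<beta>) \<in> {t. map_transition p r t \<in> T}"
  then show "(\<alpha>, permute_list \<sigma> us, \<beta>) \<in> {t. map_transition p r t \<in> T}"
    using closed_transitions_permute[OF assms, of "map r us"] by (simp add: permute_list_map)
next
  fix \<alpha> us vs ws \<beta> \<nu>1 \<nu>2
  let ?T = "{t. map_transition p r t \<in> T}"
  assume "us \<noteq> []" "vs \<noteq> []" "ws \<noteq> []" "(\<alpha>, us @ vs @ ws, \<beta>) \<in> ?T" "(\<alpha>, us, \<nu>1) \<in> ?T"
    "(\<nu>1, vs @ ws, \<beta>) \<in> ?T" "(\<alpha>, us @ vs, \<nu>2) \<in> ?T" "(\<nu>2, ws, \<beta>) \<in> ?T"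
  then show "(\<nu>1, vs, \<nu>2) \<in> ?T"
    using closed_transitions_coherent[OF assms, of "map r us" "map r vs" "map r ws" "p \<alpha>" "p \<beta>" "p \<nu>1" "p \<nu>2"]
    by simp
qed

definition generated :: "('u \<times> 'u list \<times> 'u) set \<Rightarrow> ('u \<times> 'u list \<times> 'u) set" where
  "generated T\<^sub>0 = \<Inter>{T. closed_transitions T \<and> T\<^sub>0 \<subseteq> T}"

lemma closed_transitions_generated: "closed_transitions (generated T\<^sub>0)"
  unfolding generated_def by (rule closed_transitions_Inter) simp

lemma generated_subset: "T\<^sub>0 \<subseteq> generated T\<^sub>0"
  unfolding generated_def by blast

lemma generated_least: "closed_transitions T \<Longrightarrow> T\<^sub>0 \<subseteq> T \<Longrightarrow> generated T\<^sub>0 \<subseteq> T"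
  unfolding generated_def by blast


section \<open>The category of weak higher dimensional transition systems\<close>

abbreviation push :: "('u, 'l) whdts_mor \<Rightarrow> 'u \<times> 'u list \<times> 'u \<Rightarrow> 'u \<times> 'u list \<times> 'u" where
  "push f \<equiv> map_transition (on_states f) (on_actions f)"

lemma WHDTS_simps [simp]:
  "Dom (WHDTS \<Sigma>) = source" "Cod (WHDTS \<Sigma>) = target"
  "Ident (WHDTS \<Sigma>) X = \<lparr>source = X, on_states = (\<lambda>x \<in> states X. x), on_actions = (\<lambda>u \<in> actions X. u), target = X\<rparr>"
  unfolding WHDTS_def Let_def by simp_all

lemma WHDTS_Comp:
  "Comp (WHDTS \<Sigma>) g f = \<lparr>source = source f,
     on_states = compose (states (source f)) (on_states g) (on_states f),
     on_actions = compose (actions (source f)) (on_actions g) (on_actions f), target = target g\<rparr>"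
  unfolding WHDTS_def Let_def by simp_all

lemma WHDTS_Obj_iff:
  fixes X :: "('u, 'l) whdts"
  shows "X \<in> Obj (WHDTS \<Sigma>) \<longleftrightarrow> is_whdts \<Sigma> X \<and> small TYPE('u) (states X) \<and> small TYPE('u) (actions X)"
  unfolding WHDTS_def Let_def by simp

lemma WHDTS_hom_iff:
  "f \<in> hom (WHDTS \<Sigma>) X Y \<longleftrightarrow>
     source f = X \<and> target f = Y \<and> X \<in> Obj (WHDTS \<Sigma>) \<and> Y \<in> Obj (WHDTS \<Sigma>) \<and>
     on_states f \<in> states X \<rightarrow>\<^sub>E states Y \<and> on_actions f \<in> actions X \<rightarrow>\<^sub>E actions Y \<and>
     (\<forall>u \<in> actions X. labelling Y (on_actions f u) = labelling X u) \<and>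
     (\<forall>t \<in> transitions X. push f t \<in> transitions Y)"
  unfolding hom_iff by (auto simp: WHDTS_def Let_def is_whdts_mor_def)

lemma WHDTS_Arr_hom: "f \<in> Arr (WHDTS \<Sigma>) \<Longrightarrow> f \<in> hom (WHDTS \<Sigma>) (source f) (target f)"
  unfolding hom_iff by simp

lemma WHDTS_mor:
  assumes "f \<in> hom (WHDTS \<Sigma>) X Y"
  shows "source f = X" "target f = Y" "X \<in> Obj (WHDTS \<Sigma>)" "Y \<in> Obj (WHDTS \<Sigma>)"
    and "x \<in> states X \<Longrightarrow> on_states f x \<in> states Y"
    and "u \<in> actions X \<Longrightarrow> on_actions f u \<in> actions Y"
    and "u \<in> actions X \<Longrightarrow> labelling Y (on_actions f u) = labelling X u"
    and "t \<in> transitions X \<Longrightarrow> push f t \<in> transitions Y"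
  using assms unfolding WHDTS_hom_iff by auto

lemma WHDTS_transition_typed:
  "X \<in> Obj (WHDTS \<Sigma>) \<Longrightarrow> t \<in> transitions X \<Longrightarrow> t \<in> all_transitions (states X) (actions X)"
  unfolding WHDTS_Obj_iff is_whdts_iff by auto

lemma WHDTS_closed: "X \<in> Obj (WHDTS \<Sigma>) \<Longrightarrow> closed_transitions (transitions X)"
  unfolding WHDTS_Obj_iff is_whdts_iff by auto

lemma WHDTS_labelling: "X \<in> Obj (WHDTS \<Sigma>) \<Longrightarrow> labelling X \<in> actions X \<rightarrow>\<^sub>E \<Sigma>"
  unfolding WHDTS_Obj_iff is_whdts_iff by auto

lemma WHDTS_hom_eqI:
  assumes f: "f \<in> hom (WHDTS \<Sigma>) X Y" and g: "g \<in> hom (WHDTS \<Sigma>) X Y"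
    and s: "\<And>x. x \<in> states X \<Longrightarrow> on_states f x = on_states g x"
    and a: "\<And>u. u \<in> actions X \<Longrightarrow> on_actions f u = on_actions g u"
  shows "f = g"
proof -
  have "on_states f \<in> states X \<rightarrow>\<^sub>E states Y" "on_states g \<in> states X \<rightarrow>\<^sub>E states Y"
    "on_actions f \<in> actions X \<rightarrow>\<^sub>E actions Y" "on_actions g \<in> actions X \<rightarrow>\<^sub>E actions Y"
    using f g unfolding WHDTS_hom_iff by simp_all
  then have "on_states f = on_states g" "on_actions f = on_actions g"
    using PiE_ext s a by metis+
  then show ?thesis using f g unfolding WHDTS_hom_iff by simp
qed

lemma WHDTS_Comp_apply:
  assumes "f \<in> hom (WHDTS \<Sigma>) X Y"
  shows "x \<in> states X \<Longrightarrow> on_states (Comp (WHDTS \<Sigma>) g f) x = on_states g (on_states f x)"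
    and "u \<in> actions X \<Longrightarrow> on_actions (Comp (WHDTS \<Sigma>) g f) u = on_actions g (on_actions f u)"
    and "t \<in> transitions X \<Longrightarrow> push (Comp (WHDTS \<Sigma>) g f) t = push g (push f t)"
proof -
  show s: "on_states (Comp (WHDTS \<Sigma>) g f) x = on_states g (on_states f x)" if "x \<in> states X" for x
    using WHDTS_mor(1)[OF assms] that by (simp add: WHDTS_Comp compose_def)
  show a: "on_actions (Comp (WHDTS \<Sigma>) g f) u = on_actions g (on_actions f u)" if "u \<in> actions X" for u
    using WHDTS_mor(1)[OF assms] that by (simp add: WHDTS_Comp compose_def)
  assume "t \<in> transitions X"
  then have "t \<in> all_transitions (states X) (actions X)"
    using WHDTS_transition_typed WHDTS_mor(3)[OF assms] by metis
  from map_transition_cong[OF this s a]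
  show "push (Comp (WHDTS \<Sigma>) g f) t = push g (push f t)"
    by (simp add: map_transition_def prod.map_comp comp_def split: prod.splits)
qed

lemma WHDTS_Comp_hom:
  assumes f: "f \<in> hom (WHDTS \<Sigma>) X Y" and g: "g \<in> hom (WHDTS \<Sigma>) Y Z"
  shows "Comp (WHDTS \<Sigma>) g f \<in> hom (WHDTS \<Sigma>) X Z"
  unfolding WHDTS_hom_iff
proof (intro conjI ballI)
  show "on_states (Comp (WHDTS \<Sigma>) g f) \<in> states X \<rightarrow>\<^sub>E states Z"
    using WHDTS_mor(1,5)[OF f] WHDTS_mor(5)[OF g] by (auto simp: WHDTS_Comp compose_def)
  show "on_actions (Comp (WHDTS \<Sigma>) g f) \<in> actions X \<rightarrow>\<^sub>E actions Z"
    using WHDTS_mor(1,6)[OF f] WHDTS_mor(6)[OF g] by (auto simp: WHDTS_Comp compose_def)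
  fix u assume u: "u \<in> actions X"
  show "labelling Z (on_actions (Comp (WHDTS \<Sigma>) g f) u) = labelling X u"
    unfolding WHDTS_Comp_apply(2)[OF f u] using u WHDTS_mor(6,7)[OF f] WHDTS_mor(7)[OF g] by simp
next
  fix t assume t: "t \<in> transitions X"
  show "push (Comp (WHDTS \<Sigma>) g f) t \<in> transitions Z"
    unfolding WHDTS_Comp_apply(3)[OF f t] using t WHDTS_mor(8)[OF f] WHDTS_mor(8)[OF g] by simp
qed (use WHDTS_mor[OF f] WHDTS_mor[OF g] in \<open>simp_all add: WHDTS_Comp\<close>)

lemma WHDTS_Ident_apply:
  "x \<in> states X \<Longrightarrow> on_states (Ident (WHDTS \<Sigma>) X) x = x"
  "u \<in> actions X \<Longrightarrow> on_actions (Ident (WHDTS \<Sigma>) X) u = u"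
  "X \<in> Obj (WHDTS \<Sigma>) \<Longrightarrow> t \<in> transitions X \<Longrightarrow> push (Ident (WHDTS \<Sigma>) X) t = t"
proof -
  assume "X \<in> Obj (WHDTS \<Sigma>)" "t \<in> transitions X"
  then have "t \<in> all_transitions (states X) (actions X)" by (rule WHDTS_transition_typed)
  from map_transition_cong[OF this, of _ id _ id]
  show "push (Ident (WHDTS \<Sigma>) X) t = t" by (simp add: map_transition_def map_prod.id)
qed simp_all

lemma WHDTS_Ident_hom: "X \<in> Obj (WHDTS \<Sigma>) \<Longrightarrow> Ident (WHDTS \<Sigma>) X \<in> hom (WHDTS \<Sigma>) X X"
  unfolding WHDTS_hom_iff using WHDTS_Ident_apply(3)[of X \<Sigma>] by simp

lemma category_WHDTS:
  fixes \<Sigma> :: "'l set"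
  shows "category (WHDTS \<Sigma> :: (('u, 'l) whdts, ('u, 'l) whdts_mor) cat)"
proof (rule categoryI)
  fix f assume "f \<in> Arr (WHDTS \<Sigma> :: (('u, 'l) whdts, ('u, 'l) whdts_mor) cat)"
  then show "Dom (WHDTS \<Sigma>) f \<in> Obj (WHDTS \<Sigma>) \<and> Cod (WHDTS \<Sigma>) f \<in> Obj (WHDTS \<Sigma>)"
    by (simp add: WHDTS_def Let_def)
next
  fix X Y f assume f: "f \<in> hom (WHDTS \<Sigma>) X (Y :: ('u, 'l) whdts)"
  note id = WHDTS_Ident_hom[OF WHDTS_mor(3)[OF f]] WHDTS_Ident_hom[OF WHDTS_mor(4)[OF f]]
  show "Comp (WHDTS \<Sigma>) f (Ident (WHDTS \<Sigma>) X) = f"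
  proof (rule WHDTS_hom_eqI[OF WHDTS_Comp_hom[OF id(1) f] f])
    fix x assume "x \<in> states X"
    then show "on_states (Comp (WHDTS \<Sigma>) f (Ident (WHDTS \<Sigma>) X)) x = on_states f x"
      using WHDTS_Comp_apply(1)[OF id(1)] WHDTS_Ident_apply(1) by metis
  next
    fix x assume "x \<in> actions X"
    then show "on_actions (Comp (WHDTS \<Sigma>) f (Ident (WHDTS \<Sigma>) X)) x = on_actions f x"
      using WHDTS_Comp_apply(2)[OF id(1)] WHDTS_Ident_apply(2) by metis
  qed
  show "Comp (WHDTS \<Sigma>) (Ident (WHDTS \<Sigma>) Y) f = f"
  proof (rule WHDTS_hom_eqI[OF WHDTS_Comp_hom[OF f id(2)] f])
    fix x assume "x \<in> states X"
    then show "on_states (Comp (WHDTS \<Sigma>) (Ident (WHDTS \<Sigma>) Y) f) x = on_states f x"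
      using WHDTS_Comp_apply(1)[OF f] WHDTS_Ident_apply(1) WHDTS_mor(5)[OF f] by metis
  next
    fix x assume "x \<in> actions X"
    then show "on_actions (Comp (WHDTS \<Sigma>) (Ident (WHDTS \<Sigma>) Y) f) x = on_actions f x"
      using WHDTS_Comp_apply(2)[OF f] WHDTS_Ident_apply(2) WHDTS_mor(6)[OF f] by metis
  qed
next
  fix W X Y Z :: "('u, 'l) whdts" and f g h
  assume f: "f \<in> hom (WHDTS \<Sigma>) W X" and g: "g \<in> hom (WHDTS \<Sigma>) X Y" and h: "h \<in> hom (WHDTS \<Sigma>) Y Z"
  note fg = WHDTS_Comp_hom[OF f g] and gh = WHDTS_Comp_hom[OF g h]
  show "Comp (WHDTS \<Sigma>) h (Comp (WHDTS \<Sigma>) g f) = Comp (WHDTS \<Sigma>) (Comp (WHDTS \<Sigma>) h g) f"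
  proof (rule WHDTS_hom_eqI[OF WHDTS_Comp_hom[OF fg h] WHDTS_Comp_hom[OF f gh]])
    fix x assume x: "x \<in> states W"
    show "on_states (Comp (WHDTS \<Sigma>) h (Comp (WHDTS \<Sigma>) g f)) x
        = on_states (Comp (WHDTS \<Sigma>) (Comp (WHDTS \<Sigma>) h g) f) x"
      unfolding WHDTS_Comp_apply(1)[OF fg x] WHDTS_Comp_apply(1)[OF f x]
        WHDTS_Comp_apply(1)[OF g WHDTS_mor(5)[OF f x]] ..
  next
    fix x assume x: "x \<in> actions W"
    show "on_actions (Comp (WHDTS \<Sigma>) h (Comp (WHDTS \<Sigma>) g f)) x
        = on_actions (Comp (WHDTS \<Sigma>) (Comp (WHDTS \<Sigma>) h g) f) x"
      unfolding WHDTS_Comp_apply(2)[OF fg x] WHDTS_Comp_apply(2)[OF f x]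
        WHDTS_Comp_apply(2)[OF g WHDTS_mor(6)[OF f x]] ..
  qed
qed (rule WHDTS_Ident_hom WHDTS_Comp_hom; assumption)+


section \<open>Colimits of weak higher dimensional transition systems\<close>

text \<open>
  A colimit of systems is a colimit on states and on actions in which the images of the given
  transitions generate all transitions. The induced maps preserve labels because every action comes
  from some stage. They preserve transitions because the transitions that they send into those of the
  target form a closed set, which therefore only has to contain the generators.
\<close>

lemma WHDTS_colimitI:
  fixes D :: "('j, 'k, ('u, 'l) whdts, ('u, 'l) whdts_mor) func" and \<Sigma> :: "'l set"
  assumes D: "is_functor J (WHDTS \<Sigma>) D" and c: "cocone (WHDTS \<Sigma>) J D X c"
    and S: "presents_colimit J (\<lambda>j. states (on_obj D j)) (\<lambda>m. on_states (on_arr D m))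
      (\<lambda>j. on_states (c j)) (states X)"
    and A: "presents_colimit J (\<lambda>j. actions (on_obj D j)) (\<lambda>m. on_actions (on_arr D m))
      (\<lambda>j. on_actions (c j)) (actions X)"
    and T: "\<And>T. closed_transitions T \<Longrightarrow>
      (\<And>j t. j \<in> Obj J \<Longrightarrow> t \<in> transitions (on_obj D j) \<Longrightarrow> push (c j) t \<in> T) \<Longrightarrow> transitions X \<subseteq> T"
  shows "colimit (WHDTS \<Sigma>) J D X c"
  unfolding colimit_def
proof (intro conjI allI impI c)
  fix Y d assume d: "cocone (WHDTS \<Sigma>) J D Y d"
  have ch: "c j \<in> hom (WHDTS \<Sigma>) (on_obj D j) X" if "j \<in> Obj J" for j
    using c that unfolding cocone_def by blast
  have dh: "d j \<in> hom (WHDTS \<Sigma>) (on_obj D j) Y" if "j \<in> Obj J" for j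
    using d that unfolding cocone_def by blast
  have X: "X \<in> Obj (WHDTS \<Sigma>)" and Y: "Y \<in> Obj (WHDTS \<Sigma>)"
    using c d unfolding cocone_def by auto
  have dm: "Comp (WHDTS \<Sigma>) (d (Cod J m)) (on_arr D m) = d (Dom J m)" if "m \<in> Arr J" for m
    using d that unfolding cocone_def by blast
  have "compatible J (\<lambda>j. states (on_obj D j)) (\<lambda>m. on_states (on_arr D m)) (\<lambda>j. on_states (d j))"
    unfolding compatible_def
    using WHDTS_Comp_apply(1)[OF functor_Arr[OF D]] dm by metis
  from presents_colimit_factor[OF S this, of "states Y"] WHDTS_mor(5)[OF dh]
  obtain hs where hs: "hs \<in> states X \<rightarrow>\<^sub>E states Y" and hs': "\<forall>j \<in> Obj J. \<forall>x \<in> states (on_obj D j).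
      on_states (c j) x \<in> states X \<longrightarrow> hs (on_states (c j) x) = on_states (d j) x" by blast
  have hsc: "hs (on_states (c j) x) = on_states (d j) x" if "j \<in> Obj J" "x \<in> states (on_obj D j)" for j x
    using hs' that WHDTS_mor(5)[OF ch] by simp
  have "compatible J (\<lambda>j. actions (on_obj D j)) (\<lambda>m. on_actions (on_arr D m)) (\<lambda>j. on_actions (d j))"
    unfolding compatible_def
    using WHDTS_Comp_apply(2)[OF functor_Arr[OF D]] dm by metis
  from presents_colimit_factor[OF A this, of "actions Y"] WHDTS_mor(6)[OF dh]
  obtain ha where ha: "ha \<in> actions X \<rightarrow>\<^sub>E actions Y" and ha': "\<forall>j \<in> Obj J. \<forall>u \<in> actions (on_obj D j).
      on_actions (c j) u \<in> actions X \<longrightarrow> ha (on_actions (c j) u) = on_actions (d j) u" by blast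
  have hac: "ha (on_actions (c j) u) = on_actions (d j) u" if "j \<in> Obj J" "u \<in> actions (on_obj D j)" for j u
    using ha' that WHDTS_mor(6)[OF ch] by simp
  have S_ex: "\<exists>j \<in> Obj J. \<exists>x \<in> states (on_obj D j). z = on_states (c j) x" if "z \<in> states X" for z
    using S that unfolding presents_colimit_def by blast
  have A_ex: "\<exists>j \<in> Obj J. \<exists>u \<in> actions (on_obj D j). z = on_actions (c j) u" if "z \<in> actions X" for z
    using A that unfolding presents_colimit_def by blast
  let ?h = "\<lparr>source = X, on_states = hs, on_actions = ha, target = Y\<rparr>"
  have h: "?h \<in> hom (WHDTS \<Sigma>) X Y"
    unfolding WHDTS_hom_iff
  proof (intro conjI ballI)
    fix z assume "z \<in> actions X"
    then obtain j u where ju: "j \<in> Obj J" "u \<in> actions (on_obj D j)" "z = on_actions (c j) u"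
      using A_ex by blast
    then show "labelling Y (on_actions ?h z) = labelling X z"
      using hac[OF ju(1,2)] WHDTS_mor(7)[OF ch[OF ju(1)] ju(2)] WHDTS_mor(7)[OF dh[OF ju(1)] ju(2)] by simp
  next
    have "transitions X \<subseteq> {t. push ?h t \<in> transitions Y}"
    proof (rule T[OF closed_transitions_vimage[OF WHDTS_closed[OF Y]]])
      fix j t assume j: "j \<in> Obj J" and t: "t \<in> transitions (on_obj D j)"
      have "push ?h (push (c j) t) = map_transition (hs \<circ> on_states (c j)) (ha \<circ> on_actions (c j)) t"
        by (cases t) simp
      also have "\<dots> = push (d j) t"
        by (rule map_transition_cong[OF WHDTS_transition_typed[OF WHDTS_mor(3)[OF ch[OF j]] t]])
          (simp_all add: hsc[OF j] hac[OF j])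
      finally show "push (c j) t \<in> {t. push ?h t \<in> transitions Y}"
        using WHDTS_mor(8)[OF dh[OF j] t] by simp
    qed
    then show "push ?h t \<in> transitions Y" if "t \<in> transitions X" for t using that by blast
  qed (use hs ha X Y in simp_all)
  show "\<exists>!h. h \<in> hom (WHDTS \<Sigma>) X Y \<and> (\<forall>j\<in>Obj J. Comp (WHDTS \<Sigma>) h (c j) = d j)"
  proof (rule ex1I)
    have "Comp (WHDTS \<Sigma>) ?h (c j) = d j" if j: "j \<in> Obj J" for j
    proof (rule WHDTS_hom_eqI[OF WHDTS_Comp_hom[OF ch[OF j] h] dh[OF j]])
      fix x assume x: "x \<in> states (on_obj D j)"
      show "on_states (Comp (WHDTS \<Sigma>) ?h (c j)) x = on_states (d j) x"
        unfolding WHDTS_Comp_apply(1)[OF ch[OF j] x] using hsc[OF j x] by simp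
    next
      fix x assume x: "x \<in> actions (on_obj D j)"
      show "on_actions (Comp (WHDTS \<Sigma>) ?h (c j)) x = on_actions (d j) x"
        unfolding WHDTS_Comp_apply(2)[OF ch[OF j] x] using hac[OF j x] by simp
    qed
    then show "?h \<in> hom (WHDTS \<Sigma>) X Y \<and> (\<forall>j\<in>Obj J. Comp (WHDTS \<Sigma>) ?h (c j) = d j)"
      using h by blast
    fix k assume k: "k \<in> hom (WHDTS \<Sigma>) X Y \<and> (\<forall>j\<in>Obj J. Comp (WHDTS \<Sigma>) k (c j) = d j)"
    then have kc: "Comp (WHDTS \<Sigma>) k (c j) = d j" if "j \<in> Obj J" for j using that by blast
    show "k = ?h"
    proof (rule WHDTS_hom_eqI[OF conjunct1[OF k] h])
      fix z assume "z \<in> states X"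
      then obtain j x where jx: "j \<in> Obj J" "x \<in> states (on_obj D j)" "z = on_states (c j) x"
        using S_ex by blast
      then show "on_states k z = on_states ?h z"
        using WHDTS_Comp_apply(1)[OF ch[OF jx(1)] jx(2), of k, unfolded kc[OF jx(1)]] hsc[OF jx(1,2)] by simp
    next
      fix z assume "z \<in> actions X"
      then obtain j x where jx: "j \<in> Obj J" "x \<in> actions (on_obj D j)" "z = on_actions (c j) x"
        using A_ex by blast
      then show "on_actions k z = on_actions ?h z"
        using WHDTS_Comp_apply(2)[OF ch[OF jx(1)] jx(2), of k, unfolded kc[OF jx(1)]] hac[OF jx(1,2)] by simp
    qed
  qed
qed

definition glue_states :: "('u, 'k) cat \<Rightarrow> ('u, 'k, ('u, 'l) whdts, ('u, 'l) whdts_mor) func \<Rightarrow> 'u \<Rightarrow> 'u \<Rightarrow> 'u" where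
  "glue_states J D = glue J (\<lambda>j. states (on_obj D j)) (\<lambda>m. on_states (on_arr D m))"

definition glue_actions :: "('u, 'k) cat \<Rightarrow> ('u, 'k, ('u, 'l) whdts, ('u, 'l) whdts_mor) func \<Rightarrow> 'u \<Rightarrow> 'u \<Rightarrow> 'u" where
  "glue_actions J D = glue J (\<lambda>j. actions (on_obj D j)) (\<lambda>m. on_actions (on_arr D m))"

text \<open>
  The choice in the labelling is between equal labels (\<open>glued_labelling\<close>): compatible actions have the
  same label.
\<close>

definition glued_whdts ::
  "('u, 'k) cat \<Rightarrow> ('u, 'k, ('u, 'l) whdts, ('u, 'l) whdts_mor) func \<Rightarrow> ('u, 'l) whdts" where
  "glued_whdts J D = (let L = (\<Union>j \<in> Obj J. glue_actions J D j ` actions (on_obj D j)) in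
     \<lparr>states = (\<Union>j \<in> Obj J. glue_states J D j ` states (on_obj D j)),
      actions = L,
      labelling = (\<lambda>z \<in> L. SOME l. \<exists>j \<in> Obj J. \<exists>u \<in> actions (on_obj D j).
        z = glue_actions J D j u \<and> l = labelling (on_obj D j) u),
      transitions = generated (\<Union>j \<in> Obj J.
        map_transition (glue_states J D j) (glue_actions J D j) ` transitions (on_obj D j))\<rparr>)"

definition glued_cocone ::
  "('u, 'k) cat \<Rightarrow> ('u, 'k, ('u, 'l) whdts, ('u, 'l) whdts_mor) func \<Rightarrow> 'u \<Rightarrow> ('u, 'l) whdts_mor" where
  "glued_cocone J D j =
     \<lparr>source = on_obj D j, on_states = restrict (glue_states J D j) (states (on_obj D j)),
      on_actions = restrict (glue_actions J D j) (actions (on_obj D j)), target = glued_whdts J D\<rparr>"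

lemma glued_whdts_simps:
  "states (glued_whdts J D) = (\<Union>j \<in> Obj J. glue_states J D j ` states (on_obj D j))"
  "actions (glued_whdts J D) = (\<Union>j \<in> Obj J. glue_actions J D j ` actions (on_obj D j))"
  "transitions (glued_whdts J D) = generated (\<Union>j \<in> Obj J.
     map_transition (glue_states J D j) (glue_actions J D j) ` transitions (on_obj D j))"
  unfolding glued_whdts_def Let_def by simp_all

context
  fixes J :: "('u, 'k) cat" and \<Sigma> :: "'l set"
    and D :: "('u, 'k, ('u, 'l) whdts, ('u, 'l) whdts_mor) func"
  assumes univ: "regular_universe TYPE('u)" and small_J: "small TYPE('u) (Obj J)"
    and D: "is_functor J (WHDTS \<Sigma>) D"
begin

lemma diagram_Obj: "j \<in> Obj J \<Longrightarrow> on_obj D j \<in> Obj (WHDTS \<Sigma>)"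
  using functor_Obj[OF D] .

lemma glued_labelling:
  assumes j: "j \<in> Obj J" and u: "u \<in> actions (on_obj D j)"
  shows "labelling (glued_whdts J D) (glue_actions J D j u) = labelling (on_obj D j) u"
proof -
  let ?P = "\<lambda>l. \<exists>i \<in> Obj J. \<exists>v \<in> actions (on_obj D i).
        glue_actions J D j u = glue_actions J D i v \<and> l = labelling (on_obj D i) v"
  have "compatible J (\<lambda>j. actions (on_obj D j)) (\<lambda>m. on_actions (on_arr D m)) (\<lambda>j. labelling (on_obj D j))"
    unfolding compatible_def using WHDTS_mor(7)[OF functor_Arr[OF D]] by blast
  from glue_eq_imp[OF infinite_universe[OF univ] this]
  have "labelling (on_obj D j) u = labelling (on_obj D i) v"
    if "glue_actions J D j u = glue_actions J D i v" for i v
    using that unfolding glue_actions_def by blast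
  then have "l = labelling (on_obj D j) u" if "?P l" for l using that by metis
  moreover have "?P (labelling (on_obj D j) u)" using j u by blast
  ultimately have "(SOME l. ?P l) = labelling (on_obj D j) u" by (rule some_equality[rotated])
  moreover have "glue_actions J D j u \<in> (\<Union>j \<in> Obj J. glue_actions J D j ` actions (on_obj D j))"
    using j u by blast
  ultimately show ?thesis unfolding glued_whdts_def Let_def by simp
qed

lemma glued_Obj: "glued_whdts J D \<in> Obj (WHDTS \<Sigma>)"
  unfolding WHDTS_Obj_iff is_whdts_iff
proof (intro conjI)
  show "small TYPE('u) (states (glued_whdts J D))" "small TYPE('u) (actions (glued_whdts J D))"
    unfolding glued_whdts_simps using diagram_Obj
    by (auto intro!: small_UN[OF univ small_J] small_image simp: WHDTS_Obj_iff)
  show "labelling (glued_whdts J D) \<in> actions (glued_whdts J D) \<rightarrow>\<^sub>E \<Sigma>"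
  proof
    fix z assume "z \<in> actions (glued_whdts J D)"
    then obtain j u where ju: "j \<in> Obj J" "u \<in> actions (on_obj D j)" "z = glue_actions J D j u"
      unfolding glued_whdts_simps by blast
    then show "labelling (glued_whdts J D) z \<in> \<Sigma>"
      using glued_labelling[OF ju(1,2)] WHDTS_labelling[OF diagram_Obj[OF ju(1)]] by auto
  qed (simp add: glued_whdts_def Let_def)
  have "map_transition (glue_states J D j) (glue_actions J D j) t
      \<in> all_transitions (states (glued_whdts J D)) (actions (glued_whdts J D))"
    if "j \<in> Obj J" "t \<in> transitions (on_obj D j)" for j t
    by (rule map_transition_all[OF WHDTS_transition_typed[OF diagram_Obj that(2)]])
      (use that in \<open>auto simp: glued_whdts_simps\<close>)
  then show "transitions (glued_whdts J D)
      \<subseteq> all_transitions (states (glued_whdts J D)) (actions (glued_whdts J D))"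
    unfolding glued_whdts_simps(3) by (intro generated_least closed_transitions_all) auto
  show "closed_transitions (transitions (glued_whdts J D))"
    unfolding glued_whdts_simps(3) by (rule closed_transitions_generated)
qed

lemma push_glued_cocone:
  assumes "j \<in> Obj J" "t \<in> transitions (on_obj D j)"
  shows "push (glued_cocone J D j) t = map_transition (glue_states J D j) (glue_actions J D j) t"
  by (rule map_transition_cong[OF WHDTS_transition_typed[OF diagram_Obj assms(2)]])
    (use assms in \<open>auto simp: glued_cocone_def\<close>)

lemma glued_cocone_hom: "j \<in> Obj J \<Longrightarrow> glued_cocone J D j \<in> hom (WHDTS \<Sigma>) (on_obj D j) (glued_whdts J D)"
  unfolding WHDTS_hom_iff
proof (intro conjI ballI)
  assume j: "j \<in> Obj J"
  fix t assume t: "t \<in> transitions (on_obj D j)"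
  show "push (glued_cocone J D j) t \<in> transitions (glued_whdts J D)"
    unfolding push_glued_cocone[OF j t] glued_whdts_simps(3)
    using j t by (intro subsetD[OF generated_subset]) blast
qed (auto simp: glued_cocone_def glued_labelling glued_Obj diagram_Obj glued_whdts_simps)

theorem glued_colimit: "colimit (WHDTS \<Sigma>) J D (glued_whdts J D) (glued_cocone J D)"
proof (rule WHDTS_colimitI[OF D])
  note inf = infinite_universe[OF univ]
  have compS: "compatible J (\<lambda>j. states (on_obj D j)) (\<lambda>m. on_states (on_arr D m)) (glue_states J D)"
    and compA: "compatible J (\<lambda>j. actions (on_obj D j)) (\<lambda>m. on_actions (on_arr D m)) (glue_actions J D)"
    unfolding glue_states_def glue_actions_def by (rule compatible_glue)+
  show "cocone (WHDTS \<Sigma>) J D (glued_whdts J D) (glued_cocone J D)"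
    unfolding cocone_def
  proof (intro conjI ballI glued_Obj glued_cocone_hom)
    fix m assume m: "m \<in> Arr J"
    have DC: "Dom J m \<in> Obj J" "Cod J m \<in> Obj J"
      using category_Arr[OF conjunct1[OF functor_categories[OF D]] m] by simp_all
    note Dm = functor_Arr[OF D m]
    show "Comp (WHDTS \<Sigma>) (glued_cocone J D (Cod J m)) (on_arr D m) = glued_cocone J D (Dom J m)"
    proof (rule WHDTS_hom_eqI[OF WHDTS_Comp_hom[OF Dm glued_cocone_hom[OF DC(2)]] glued_cocone_hom[OF DC(1)]])
      fix x assume x: "x \<in> states (on_obj D (Dom J m))"
      show "on_states (Comp (WHDTS \<Sigma>) (glued_cocone J D (Cod J m)) (on_arr D m)) x
          = on_states (glued_cocone J D (Dom J m)) x"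
        unfolding WHDTS_Comp_apply(1)[OF Dm x]
        using compS m x WHDTS_mor(5)[OF Dm x] by (simp add: glued_cocone_def compatible_def)
    next
      fix x assume x: "x \<in> actions (on_obj D (Dom J m))"
      show "on_actions (Comp (WHDTS \<Sigma>) (glued_cocone J D (Cod J m)) (on_arr D m)) x
          = on_actions (glued_cocone J D (Dom J m)) x"
        unfolding WHDTS_Comp_apply(2)[OF Dm x]
        using compA m x WHDTS_mor(6)[OF Dm x] by (simp add: glued_cocone_def compatible_def)
    qed
  qed
  show "presents_colimit J (\<lambda>j. states (on_obj D j)) (\<lambda>m. on_states (on_arr D m))
      (\<lambda>j. on_states (glued_cocone J D j)) (states (glued_whdts J D))"
    using glue_presents_colimit[OF inf, of J "\<lambda>j. states (on_obj D j)" "\<lambda>m. on_states (on_arr D m)"]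
    unfolding glued_whdts_simps glue_states_def[symmetric]
    by (subst presents_colimit_cong[where c' = "glue_states J D"]) (simp_all add: glued_cocone_def)
  show "presents_colimit J (\<lambda>j. actions (on_obj D j)) (\<lambda>m. on_actions (on_arr D m))
      (\<lambda>j. on_actions (glued_cocone J D j)) (actions (glued_whdts J D))"
    using glue_presents_colimit[OF inf, of J "\<lambda>j. actions (on_obj D j)" "\<lambda>m. on_actions (on_arr D m)"]
    unfolding glued_whdts_simps glue_actions_def[symmetric]
    by (subst presents_colimit_cong[where c' = "glue_actions J D"]) (simp_all add: glued_cocone_def)
  fix T
  assume T: "closed_transitions T"
    and sub: "\<And>j t. j \<in> Obj J \<Longrightarrow> t \<in> transitions (on_obj D j) \<Longrightarrow> push (glued_cocone J D j) t \<in> T"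
  show "transitions (glued_whdts J D) \<subseteq> T"
    unfolding glued_whdts_simps(3) using sub push_glued_cocone
    by (intro generated_least T) auto
qed

end

lemma cocomplete_WHDTS:
  fixes \<Sigma> :: "'l set"
  assumes "regular_universe TYPE('u)"
  shows "cocomplete TYPE('u) (WHDTS \<Sigma> :: (('u, 'l) whdts, ('u, 'l) whdts_mor) cat)"
  unfolding cocomplete_def using glued_colimit[OF assms] by blast


section \<open>Directed colimits\<close>

lemma poset_cat_simps [simp]:
  "Obj (poset_cat I le) = I" "Dom (poset_cat I le) = fst" "Cod (poset_cat I le) = snd"
  "Ident (poset_cat I le) i = (i, i)" "Comp (poset_cat I le) g f = (fst f, snd g)"
  unfolding poset_cat_def by simp_all

lemma poset_cat_Arr_iff [simp]: "(i, j) \<in> Arr (poset_cat I le) \<longleftrightarrow> i \<in> I \<and> j \<in> I \<and> le i j"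
  unfolding poset_cat_def by simp

lemma poset_cat_hom_iff: "f \<in> hom (poset_cat I le) i j \<longleftrightarrow> f = (i, j) \<and> i \<in> I \<and> j \<in> I \<and> le i j"
  unfolding hom_iff by (cases f) auto

lemma directed_poset_refl: "directed_poset I le \<Longrightarrow> i \<in> I \<Longrightarrow> le i i"
  unfolding directed_poset_def by simp

lemma directed_poset_trans:
  "directed_poset I le \<Longrightarrow> le i j \<Longrightarrow> le j k \<Longrightarrow> i \<in> I \<Longrightarrow> j \<in> I \<Longrightarrow> k \<in> I \<Longrightarrow> le i k"
  unfolding directed_poset_def by blast

lemma directed_poset_ub:
  assumes "directed_poset I le" "i \<in> I" "j \<in> I"
  obtains k where "k \<in> I" "le i k" "le j k"
  using assms unfolding directed_poset_def by blast

lemma category_poset_cat: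
  assumes "directed_poset I le"
  shows "category (poset_cat I le)"
  by (rule categoryI)
    (auto simp: poset_cat_hom_iff directed_poset_refl[OF assms] intro: directed_poset_trans[OF assms])

text \<open>
  Induction on \<open>P\<close>: directedness provides a stage beyond two given ones. Passing to a common later
  stage for finitely many states, actions or transitions is always an instance of this.
\<close>

lemma directed_eventually_finite:
  assumes dir: "directed_poset I le" and "finite P" and i: "i \<in> I"
    and ex: "\<And>p. p \<in> P \<Longrightarrow> \<exists>k \<in> I. \<Phi> p k"
    and mono: "\<And>p k l. p \<in> P \<Longrightarrow> k \<in> I \<Longrightarrow> l \<in> I \<Longrightarrow> le k l \<Longrightarrow> \<Phi> p k \<Longrightarrow> \<Phi> p l"
  shows "\<exists>k \<in> I. le i k \<and> (\<forall>p \<in> P. \<Phi> p k)"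
  using \<open>finite P\<close> ex mono
proof (induction P)
  case empty
  then show ?case using i directed_poset_refl[OF dir] by blast
next
  case (insert q P)
  have "\<exists>k \<in> I. le i k \<and> (\<forall>p \<in> P. \<Phi> p k)"
    by (rule insert.IH) (rule insert.prems; simp)+
  then obtain k where k: "k \<in> I" "le i k" "\<forall>p \<in> P. \<Phi> p k" by blast
  obtain j where j: "j \<in> I" "\<Phi> q j" using insert.prems(1)[of q] by blast
  obtain l where l: "l \<in> I" "le k l" "le j l" by (rule directed_poset_ub[OF dir k(1) j(1)])
  have "\<Phi> p l" if "p \<in> insert q P" for p
    using that insert.prems(2)[OF that _ l(1)] k(1,3) j l by auto
  moreover have "le i l" by (rule directed_poset_trans[OF dir k(2) l(2) i k(1) l(1)])
  ultimately show ?case using l(1) by blast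
qed

text \<open>
  The usual elementwise description of a directed colimit of sets.
\<close>

definition directed_cover ::
  "'i set \<Rightarrow> ('i \<Rightarrow> 'i \<Rightarrow> bool) \<Rightarrow> ('i \<Rightarrow> 'e set) \<Rightarrow> ('i \<times> 'i \<Rightarrow> 'e \<Rightarrow> 'e) \<Rightarrow> ('i \<Rightarrow> 'e \<Rightarrow> 'e) \<Rightarrow> 'e set \<Rightarrow> bool" where
  "directed_cover I le A a c Q \<longleftrightarrow>
     Q \<subseteq> (\<Union>i \<in> I. c i ` A i) \<and>
     (\<forall>i \<in> I. \<forall>j \<in> I. \<forall>x \<in> A i. \<forall>y \<in> A j. c i x = c j y \<longrightarrow>
        (\<exists>k \<in> I. le i k \<and> le j k \<and> a (i, k) x = a (j, k) y))"

lemma directed_coverE: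
  assumes "directed_cover I le A a c Q" "i \<in> I" "j \<in> I" "x \<in> A i" "y \<in> A j" "c i x = c j y"
  obtains k where "k \<in> I" "le i k" "le j k" "a (i, k) x = a (j, k) y"
  using assms unfolding directed_cover_def by blast

lemma directed_cover_lift:
  assumes "directed_cover I le A a c Q" "z \<in> Q"
  obtains i x where "i \<in> I" "x \<in> A i" "c i x = z"
  using assms unfolding directed_cover_def by blast

lemma directed_cover_cong:
  assumes "\<And>i x. i \<in> I \<Longrightarrow> x \<in> A i \<Longrightarrow> c i x = c' i x"
  shows "directed_cover I le A a c Q \<longleftrightarrow> directed_cover I le A a c' Q"
proof -
  have "(\<Union>i \<in> I. c i ` A i) = (\<Union>i \<in> I. c' i ` A i)" using assms by (auto simp: image_iff)
  then show ?thesis unfolding directed_cover_def using assms by simp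
qed

text \<open>
  Along maps \<open>h\<close> and \<open>h'\<close> commuting with the cocones, lifts of \<open>h z\<close> are lifts of \<open>z\<close> and
  identifications in \<open>Q\<close> become identifications in \<open>R\<close>.
\<close>

lemma directed_cover_retract:
  assumes R: "directed_cover I le A a q R"
    and h: "\<And>z. z \<in> Q \<Longrightarrow> h z \<in> R \<and> h' (h z) = z"
    and hc: "\<And>i x. i \<in> I \<Longrightarrow> x \<in> A i \<Longrightarrow> h (c i x) = q i x"
    and hq: "\<And>i x. i \<in> I \<Longrightarrow> x \<in> A i \<Longrightarrow> h' (q i x) = c i x"
  shows "directed_cover I le A a c Q"
  unfolding directed_cover_def
proof (intro conjI ballI impI subsetI)
  fix z assume "z \<in> Q"
  then have z: "h z \<in> R" "h' (h z) = z" using h by blast+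
  from z(1) obtain i x where "i \<in> I" "x \<in> A i" "q i x = h z" by (rule directed_cover_lift[OF R])
  then show "z \<in> (\<Union>i \<in> I. c i ` A i)" using hq z(2) by force
next
  fix i j x y assume ij: "i \<in> I" "j \<in> I" and xy: "x \<in> A i" "y \<in> A j" and eq: "c i x = c j y"
  have "q i x = q j y" using hc[OF ij(1) xy(1)] hc[OF ij(2) xy(2)] eq by simp
  from directed_coverE[OF R ij xy this]
  show "\<exists>k \<in> I. le i k \<and> le j k \<and> a (i, k) x = a (j, k) y" by blast
qed

lemma directed_cover_presents_colimit:
  assumes "directed_cover I le A a c Q"
  shows "presents_colimit (poset_cat I le) A a c Q"
proof (rule directed_presents_colimit)
  show "Q \<subseteq> (\<Union>i \<in> I. c i ` A i)" using assms unfolding directed_cover_def by simp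
  fix i j x y assume "i \<in> I" "j \<in> I" "x \<in> A i" "y \<in> A j" "c i x = c j y"
  from directed_coverE[OF assms this]
  show "\<exists>k \<in> I. le i k \<and> le j k \<and> a (i, k) x = a (j, k) y" by blast
qed

locale directed_sets =
  fixes I :: "'i set" and le and A :: "'i \<Rightarrow> 'e set" and a :: "'i \<times> 'i \<Rightarrow> 'e \<Rightarrow> 'e"
  assumes dir: "directed_poset I le"
    and a_in: "i \<in> I \<Longrightarrow> j \<in> I \<Longrightarrow> le i j \<Longrightarrow> x \<in> A i \<Longrightarrow> a (i, j) x \<in> A j"
    and a_comp: "i \<in> I \<Longrightarrow> j \<in> I \<Longrightarrow> k \<in> I \<Longrightarrow> le i j \<Longrightarrow> le j k \<Longrightarrow> x \<in> A i \<Longrightarrow>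
      a (j, k) (a (i, j) x) = a (i, k) x"
begin

lemma eq_at_later_stage:
  assumes "i \<in> I" "j \<in> I" "k \<in> I" "l \<in> I" "le i k" "le j k" "le k l" "x \<in> A i" "y \<in> A j"
    and eq: "a (i, k) x = a (j, k) y"
  shows "a (i, l) x = a (j, l) y"
  using a_comp[of i k l x] a_comp[of j k l y] assms by simp

text \<open>
  The pointwise equalities of two lists are finite in number, so one later stage serves for all.
\<close>

lemma cover_list:
  assumes cov: "directed_cover I le A a c Q" and i: "i \<in> I" and j: "j \<in> I"
  shows "set xs \<subseteq> A i \<Longrightarrow> set ys \<subseteq> A j \<Longrightarrow> map (c i) xs = map (c j) ys \<Longrightarrow>
    \<exists>k \<in> I. le i k \<and> le j k \<and> map (a (i, k)) xs = map (a (j, k)) ys"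
proof (induction xs arbitrary: ys)
  case Nil
  obtain k where "k \<in> I" "le i k" "le j k" by (rule directed_poset_ub[OF dir i j])
  then show ?case using Nil by auto
next
  case (Cons x xs zs)
  then obtain y ys where zs: "zs = y # ys" by (cases zs) auto
  have xy: "x \<in> A i" "y \<in> A j" "c i x = c j y" and
    tl: "set xs \<subseteq> A i" "set ys \<subseteq> A j" "map (c i) xs = map (c j) ys"
    using Cons.prems zs by simp_all
  obtain k where k: "k \<in> I" "le i k" "le j k" "a (i, k) x = a (j, k) y"
    by (rule directed_coverE[OF cov i j xy])
  obtain l where l: "l \<in> I" "le i l" "le j l" "map (a (i, l)) xs = map (a (j, l)) ys"
    using Cons.IH[OF tl] by blast
  obtain m where m: "m \<in> I" "le k m" "le l m" by (rule directed_poset_ub[OF dir k(1) l(1)])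
  have "map (a (i, m)) xs = map (a (l, m)) (map (a (i, l)) xs)"
    using a_comp[OF i l(1) m(1) l(2) m(3)] tl(1) by auto
  also have "\<dots> = map (a (j, m)) ys"
    unfolding l(4) using a_comp[OF j l(1) m(1) l(3) m(3)] tl(2) by auto
  finally have "map (a (i, m)) xs = map (a (j, m)) ys" .
  moreover have "a (i, m) x = a (j, m) y"
    by (rule eq_at_later_stage[OF i j k(1) m(1) k(2,3) m(2) xy(1,2) k(4)])
  moreover have "le i m" by (rule directed_poset_trans[OF dir k(2) m(2) i k(1) m(1)])
  moreover have "le j m" by (rule directed_poset_trans[OF dir k(3) m(2) j k(1) m(1)])
  ultimately show ?case using m(1) zs by auto
qed

end

text \<open>
  To each \<open>x \<in> A i\<close> associate the set \<open>f i x\<close> of all \<open>(j, y)\<close> that become equal to it at some later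
  stage. Directedness makes \<open>f\<close> compatible, so equal glued classes give equal sets, and
  \<open>(j, y) \<in> f j y\<close> then lies in \<open>f i x\<close>.
\<close>

lemma directed_glue_cover:
  fixes I :: "'u set"
  assumes inf: "infinite (UNIV :: 'u set)" and "directed_sets I le A a"
  shows "directed_cover I le A a (glue (poset_cat I le) A a)
    (\<Union>i \<in> I. glue (poset_cat I le) A a i ` A i)"
  unfolding directed_cover_def
proof (intro conjI ballI impI)
  interpret directed_sets I le A a by fact
  define f where "f = (\<lambda>i x. {(j, y). j \<in> I \<and> y \<in> A j \<and>
    (\<exists>k \<in> I. le i k \<and> le j k \<and> a (i, k) x = a (j, k) y)})"
  have step: "f i' (a (i, i') x) = f i x" if i: "i \<in> I" "i' \<in> I" "le i i'" and x: "x \<in> A i" for i i' x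
  proof (intro subset_antisym subsetI)
    fix q assume "q \<in> f i' (a (i, i') x)"
    then obtain j y k where q: "q = (j, y)" and j: "j \<in> I" "y \<in> A j"
      and k: "k \<in> I" "le i' k" "le j k" "a (i', k) (a (i, i') x) = a (j, k) y" unfolding f_def by auto
    have "le i k" by (rule directed_poset_trans[OF dir i(3) k(2) i(1,2) k(1)])
    moreover have "a (i, k) x = a (j, k) y" using a_comp[OF i(1,2) k(1) i(3) k(2) x] k(4) by simp
    ultimately show "q \<in> f i x" unfolding f_def q using j k(1,3) by auto
  next
    fix q assume "q \<in> f i x"
    then obtain j y k where q: "q = (j, y)" and j: "j \<in> I" "y \<in> A j"
      and k: "k \<in> I" "le i k" "le j k" "a (i, k) x = a (j, k) y" unfolding f_def by auto
    obtain l where l: "l \<in> I" "le k l" "le i' l" by (rule directed_poset_ub[OF dir k(1) i(2)])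
    have "a (i', l) (a (i, i') x) = a (i, l) x" by (rule a_comp[OF i(1,2) l(1) i(3) l(3) x])
    also have "\<dots> = a (j, l) y"
      by (rule eq_at_later_stage[OF i(1) j(1) k(1) l(1) k(2,3) l(2) x j(2) k(4)])
    finally have "a (i', l) (a (i, i') x) = a (j, l) y" .
    moreover have "le j l" by (rule directed_poset_trans[OF dir k(3) l(2) j(1) k(1) l(1)])
    ultimately show "q \<in> f i' (a (i, i') x)" unfolding f_def q using j l by auto
  qed
  then have comp: "compatible (poset_cat I le) A a f"
    unfolding compatible_def by (auto simp del: split_paired_All)
  fix i j x y assume ij: "i \<in> I" "j \<in> I" and xy: "x \<in> A i" "y \<in> A j"
    and eq: "glue (poset_cat I le) A a i x = glue (poset_cat I le) A a j y"
  have "f i x = f j y" by (rule glue_eq_imp[OF inf comp eq])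
  moreover have "(j, y) \<in> f j y" unfolding f_def using ij xy directed_poset_refl[OF dir ij(2)] by auto
  ultimately have "(j, y) \<in> f i x" by simp
  then show "\<exists>k \<in> I. le i k \<and> le j k \<and> a (i, k) x = a (j, k) y" unfolding f_def by auto
qed simp

locale directed_cocone =
  fixes \<Sigma> :: "'l set" and I :: "'i set" and le
    and E :: "('i, 'i \<times> 'i, ('u, 'l) whdts, ('u, 'l) whdts_mor) func" and X c
  assumes directed: "directed_poset I le"
    and E: "is_functor (poset_cat I le) (WHDTS \<Sigma>) E"
    and c: "cocone (WHDTS \<Sigma>) (poset_cat I le) E X c"
begin

lemma E_hom: "i \<in> I \<Longrightarrow> j \<in> I \<Longrightarrow> le i j \<Longrightarrow> on_arr E (i, j) \<in> hom (WHDTS \<Sigma>) (on_obj E i) (on_obj E j)"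
  using functor_hom[OF E, of "(i, j)" i j] by (simp add: poset_cat_hom_iff)

lemma E_comp:
  assumes "i \<in> I" "j \<in> I" "k \<in> I" "le i j" "le j k"
  shows "Comp (WHDTS \<Sigma>) (on_arr E (j, k)) (on_arr E (i, j)) = on_arr E (i, k)"
  using functor_Comp[OF E, of "(i, j)" i j "(j, k)" k] assms by (simp add: poset_cat_hom_iff)

lemma c_hom: "i \<in> I \<Longrightarrow> c i \<in> hom (WHDTS \<Sigma>) (on_obj E i) X"
  using c unfolding cocone_def by simp

lemma c_comp: "i \<in> I \<Longrightarrow> j \<in> I \<Longrightarrow> le i j \<Longrightarrow> Comp (WHDTS \<Sigma>) (c j) (on_arr E (i, j)) = c i"
  using c[unfolded cocone_def, THEN conjunct2, THEN conjunct2, THEN bspec, of "(i, j)"] by simp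

lemma c_states: "i \<in> I \<Longrightarrow> j \<in> I \<Longrightarrow> le i j \<Longrightarrow> x \<in> states (on_obj E i) \<Longrightarrow>
    on_states (c j) (on_states (on_arr E (i, j)) x) = on_states (c i) x"
  using WHDTS_Comp_apply(1)[OF E_hom] c_comp by metis

lemma c_actions: "i \<in> I \<Longrightarrow> j \<in> I \<Longrightarrow> le i j \<Longrightarrow> u \<in> actions (on_obj E i) \<Longrightarrow>
    on_actions (c j) (on_actions (on_arr E (i, j)) u) = on_actions (c i) u"
  using WHDTS_Comp_apply(2)[OF E_hom] c_comp by metis

lemma directed_states: "directed_sets I le (\<lambda>i. states (on_obj E i)) (\<lambda>m. on_states (on_arr E m))"
proof
  fix i j k x assume "i \<in> I" "j \<in> I" "k \<in> I" "le i j" "le j k" "x \<in> states (on_obj E i)"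
  then show "on_states (on_arr E (j, k)) (on_states (on_arr E (i, j)) x) = on_states (on_arr E (i, k)) x"
    using WHDTS_Comp_apply(1)[OF E_hom, of i j x "on_arr E (j, k)"] E_comp[of i j k] by simp
qed (auto simp: directed intro: WHDTS_mor(5)[OF E_hom])

lemma directed_actions: "directed_sets I le (\<lambda>i. actions (on_obj E i)) (\<lambda>m. on_actions (on_arr E m))"
proof
  fix i j k x assume "i \<in> I" "j \<in> I" "k \<in> I" "le i j" "le j k" "x \<in> actions (on_obj E i)"
  then show "on_actions (on_arr E (j, k)) (on_actions (on_arr E (i, j)) x) = on_actions (on_arr E (i, k)) x"
    using WHDTS_Comp_apply(2)[OF E_hom, of i j x "on_arr E (j, k)"] E_comp[of i j k] by simp
qed (auto simp: directed intro: WHDTS_mor(6)[OF E_hom])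

sublocale S: directed_sets I le "\<lambda>i. states (on_obj E i)" "\<lambda>m. on_states (on_arr E m)"
  by (rule directed_states)

sublocale A: directed_sets I le "\<lambda>i. actions (on_obj E i)" "\<lambda>m. on_actions (on_arr E m)"
  by (rule directed_actions)

definition covers :: bool where
  "covers \<longleftrightarrow>
     directed_cover I le (\<lambda>i. states (on_obj E i)) (\<lambda>m. on_states (on_arr E m)) (\<lambda>i. on_states (c i)) (states X) \<and>
     directed_cover I le (\<lambda>i. actions (on_obj E i)) (\<lambda>m. on_actions (on_arr E m)) (\<lambda>i. on_actions (c i)) (actions X)"

definition images :: "('u \<times> 'u list \<times> 'u) set" where
  "images = (\<Union>i \<in> I. push (c i) ` transitions (on_obj E i))"

text \<open>
  Chosen preimages \<open>p\<close>, \<open>r\<close> of the states and actions of \<open>t\<close> need not carry \<open>t\<close> to a transition.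
  But some transition \<open>s\<close> at another stage is mapped to \<open>t\<close>, so \<open>s\<close> and the chosen lift of \<open>t\<close> have
  the same image in \<open>X\<close>. They agree at a later stage.
\<close>

lemma images_lift_later:
  assumes covers and i: "i \<in> I" and t: "t \<in> images" "t \<in> all_transitions FS FA"
    and p: "\<And>x. x \<in> FS \<Longrightarrow> p x \<in> states (on_obj E i) \<and> on_states (c i) (p x) = x"
    and r: "\<And>u. u \<in> FA \<Longrightarrow> r u \<in> actions (on_obj E i) \<and> on_actions (c i) (r u) = u"
  shows "\<exists>k \<in> I. le i k \<and> map_transition (on_states (on_arr E (i, k)) \<circ> p)
    (on_actions (on_arr E (i, k)) \<circ> r) t \<in> transitions (on_obj E k)"
proof -
  note covS = conjunct1[OF \<open>covers\<close>[unfolded covers_def]]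
  note covA = conjunct2[OF \<open>covers\<close>[unfolded covers_def]]
  obtain \<alpha> us \<beta> where t_eq: "t = (\<alpha>, us, \<beta>)" by (cases t)
  have typed: "\<alpha> \<in> FS" "\<beta> \<in> FS" "set us \<subseteq> FA" using t(2) unfolding t_eq all_transitions_def by auto
  obtain j s where j: "j \<in> I" and s: "s \<in> transitions (on_obj E j)" "push (c j) s = t"
    using t(1) unfolding images_def by blast
  obtain a l b where s_eq: "s = (a, l, b)" by (cases s)
  have s_typed: "a \<in> states (on_obj E j)" "b \<in> states (on_obj E j)" "set l \<subseteq> actions (on_obj E j)"
    using WHDTS_transition_typed[OF functor_Obj[OF E] s(1)] j unfolding s_eq all_transitions_def by auto
  have eqs: "on_states (c j) a = \<alpha>" "map (on_actions (c j)) l = us" "on_states (c j) b = \<beta>"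
    using s(2) unfolding s_eq t_eq by simp_all
  have r_us: "map (on_actions (c i)) (map r us) = us" "set (map r us) \<subseteq> actions (on_obj E i)"
    using r typed(3) by (auto simp: subset_iff intro: map_idI)
  have "on_states (c j) a = on_states (c i) (p \<alpha>)" using eqs(1) p typed(1) by simp
  from directed_coverE[OF covS j i s_typed(1) _ this] p[OF typed(1)]
  obtain k1 where k1: "k1 \<in> I" "le j k1" "le i k1"
    "on_states (on_arr E (j, k1)) a = on_states (on_arr E (i, k1)) (p \<alpha>)" by blast
  have "on_states (c j) b = on_states (c i) (p \<beta>)" using eqs(3) p typed(2) by simp
  from directed_coverE[OF covS j i s_typed(2) _ this] p[OF typed(2)]
  obtain k2 where k2: "k2 \<in> I" "le j k2" "le i k2"
    "on_states (on_arr E (j, k2)) b = on_states (on_arr E (i, k2)) (p \<beta>)" by blast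
  have "map (on_actions (c j)) l = map (on_actions (c i)) (map r us)" using eqs(2) r_us(1) by simp
  from A.cover_list[OF covA j i s_typed(3) r_us(2) this]
  obtain k3 where k3: "k3 \<in> I" "le j k3" "le i k3"
    "map (on_actions (on_arr E (j, k3))) l = map (on_actions (on_arr E (i, k3))) (map r us)" by blast
  obtain m where m: "m \<in> I" "le k1 m" "le k2 m" by (rule directed_poset_ub[OF directed k1(1) k2(1)])
  obtain k where k: "k \<in> I" "le m k" "le k3 k" by (rule directed_poset_ub[OF directed m(1) k3(1)])
  have k1k: "le k1 k" by (rule directed_poset_trans[OF directed m(2) k(2) k1(1) m(1) k(1)])
  have k2k: "le k2 k" by (rule directed_poset_trans[OF directed m(3) k(2) k2(1) m(1) k(1)])
  have jk: "le j k" by (rule directed_poset_trans[OF directed k1(2) k1k j k1(1) k(1)])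
  have ik: "le i k" by (rule directed_poset_trans[OF directed k1(3) k1k i k1(1) k(1)])
  have "on_states (on_arr E (j, k)) a = on_states (on_arr E (i, k)) (p \<alpha>)"
    using S.eq_at_later_stage[OF j i k1(1) k(1) k1(2,3) k1k s_typed(1) _ k1(4)] p[OF typed(1)] by simp
  moreover have "on_states (on_arr E (j, k)) b = on_states (on_arr E (i, k)) (p \<beta>)"
    using S.eq_at_later_stage[OF j i k2(1) k(1) k2(2,3) k2k s_typed(2) _ k2(4)] p[OF typed(2)] by simp
  moreover have "map (on_actions (on_arr E (j, k))) l = map (on_actions (on_arr E (i, k))) (map r us)"
  proof -
    have "map (on_actions (on_arr E (j, k))) l
        = map (on_actions (on_arr E (k3, k))) (map (on_actions (on_arr E (j, k3))) l)"
      using A.a_comp[OF j k3(1) k(1) k3(2) k(3)] s_typed(3) by auto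
    also have "\<dots> = map (on_actions (on_arr E (i, k))) (map r us)"
      unfolding k3(4) using A.a_comp[OF i k3(1) k(1) k3(3) k(3)] r_us(2) by auto
    finally show ?thesis .
  qed
  ultimately have "push (on_arr E (j, k)) s =
      map_transition (on_states (on_arr E (i, k)) \<circ> p) (on_actions (on_arr E (i, k)) \<circ> r) t"
    unfolding s_eq t_eq by simp
  then show ?thesis using WHDTS_mor(8)[OF E_hom[OF j k(1) jk] s(1)] k(1) ik by auto
qed

text \<open>
  Any finite piece of the vertex lifts to a single stage along a partial section \<open>(p, r)\<close> of the
  cocone. Both the closure of the images under the axioms and the factorisation of morphisms out of
  finite systems follow from this.
\<close>

lemma finite_lift:
  assumes covers and fin: "finite FS" "finite FA" "finite P"
    and sub: "FS \<subseteq> states X" "FA \<subseteq> actions X" "P \<subseteq> images" "P \<subseteq> all_transitions FS FA"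
  shows "\<exists>k \<in> I. \<exists>p r.
    (\<forall>x \<in> FS. p x \<in> states (on_obj E k) \<and> on_states (c k) (p x) = x) \<and>
    (\<forall>u \<in> FA. r u \<in> actions (on_obj E k) \<and> on_actions (c k) (r u) = u) \<and>
    (\<forall>t \<in> P. map_transition p r t \<in> transitions (on_obj E k))"
proof -
  note covS = conjunct1[OF \<open>covers\<close>[unfolded covers_def]]
  note covA = conjunct2[OF \<open>covers\<close>[unfolded covers_def]]
  obtain i0 where i0: "i0 \<in> I" using directed unfolding directed_poset_def by blast
  let ?\<Phi> = "\<lambda>x k. \<exists>y \<in> states (on_obj E k). on_states (c k) y = x"
  let ?\<Psi> = "\<lambda>x k. \<exists>y \<in> actions (on_obj E k). on_actions (c k) y = x"
  have monoS: "?\<Phi> x l" if kl: "k \<in> I" "l \<in> I" "le k l" and "?\<Phi> x k" for x k l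
    using that(4) c_states[OF kl] S.a_in[OF kl] by metis
  have monoA: "?\<Psi> x l" if kl: "k \<in> I" "l \<in> I" "le k l" and "?\<Psi> x k" for x k l
    using that(4) c_actions[OF kl] A.a_in[OF kl] by metis
  have "\<exists>k \<in> I. ?\<Phi> x k" if "x \<in> FS" for x
    using directed_cover_lift[OF covS subsetD[OF sub(1) that]] by metis
  then have "\<exists>k \<in> I. le i0 k \<and> (\<forall>x \<in> FS. ?\<Phi> x k)"
  proof (rule directed_eventually_finite[OF directed fin(1) i0])
    fix x k l assume "k \<in> I" "l \<in> I" "le k l" "?\<Phi> x k"
    then show "?\<Phi> x l" by (rule monoS)
  qed
  then
  obtain i1 where i1: "i1 \<in> I" "\<forall>x \<in> FS. ?\<Phi> x i1" by blast
  have "\<exists>k \<in> I. ?\<Psi> x k" if "x \<in> FA" for x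
    using directed_cover_lift[OF covA subsetD[OF sub(2) that]] by metis
  then have "\<exists>k \<in> I. le i1 k \<and> (\<forall>x \<in> FA. ?\<Psi> x k)"
  proof (rule directed_eventually_finite[OF directed fin(2) i1(1)])
    fix x k l assume "k \<in> I" "l \<in> I" "le k l" "?\<Psi> x k"
    then show "?\<Psi> x l" by (rule monoA)
  qed
  then
  obtain i where i: "i \<in> I" "le i1 i" "\<forall>x \<in> FA. ?\<Psi> x i" by blast
  have "\<forall>x \<in> FS. ?\<Phi> x i" using i1(2) monoS[OF i1(1) i(1,2)] by blast
  then obtain p where p: "\<forall>x \<in> FS. p x \<in> states (on_obj E i) \<and> on_states (c i) (p x) = x"
    using bchoice[of FS "\<lambda>x y. y \<in> states (on_obj E i) \<and> on_states (c i) y = x"] by blast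
  obtain r where r: "\<forall>x \<in> FA. r x \<in> actions (on_obj E i) \<and> on_actions (c i) (r x) = x"
    using i(3) bchoice[of FA "\<lambda>x y. y \<in> actions (on_obj E i) \<and> on_actions (c i) y = x"] by blast
  let ?p = "\<lambda>k. on_states (on_arr E (i, k)) \<circ> p" and ?r = "\<lambda>k. on_actions (on_arr E (i, k)) \<circ> r"
  let ?\<Theta> = "\<lambda>t k. le i k \<and> map_transition (?p k) (?r k) t \<in> transitions (on_obj E k)"
  have "\<exists>k \<in> I. ?\<Theta> t k" if "t \<in> P" for t
    using images_lift_later[OF \<open>covers\<close> i(1) subsetD[OF sub(3) that] subsetD[OF sub(4) that]] p r by blast
  moreover have "?\<Theta> t l" if t: "t \<in> P" and k: "k \<in> I" and l: "l \<in> I" "le k l" and \<Theta>: "?\<Theta> t k" for t k l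
  proof
    have ik: "le i k" using \<Theta> by blast
    show "le i l" by (rule directed_poset_trans[OF directed ik l(2) i(1) k l(1)])
    have "map_transition (?p l) (?r l) t = map_transition (on_states (on_arr E (k, l)) \<circ> ?p k)
        (on_actions (on_arr E (k, l)) \<circ> ?r k) t"
      by (rule map_transition_cong[OF subsetD[OF sub(4) t]])
        (use p r S.a_comp[OF i(1) k l(1) ik l(2)] A.a_comp[OF i(1) k l(1) ik l(2)] in simp_all)
    also have "\<dots> = push (on_arr E (k, l)) (map_transition (?p k) (?r k) t)"
      by (cases t) simp
    finally show "map_transition (?p l) (?r l) t \<in> transitions (on_obj E l)"
      using WHDTS_mor(8)[OF E_hom[OF k l]] \<Theta> by simp
  qed
  ultimately obtain k where k: "k \<in> I" "le i k" "\<forall>t \<in> P. ?\<Theta> t k"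
    using directed_eventually_finite[OF directed fin(3) i(1), of ?\<Theta>] by blast
  have "\<forall>x \<in> FS. ?p k x \<in> states (on_obj E k) \<and> on_states (c k) (?p k x) = x"
    using p c_states[OF i(1) k(1,2)] S.a_in[OF i(1) k(1,2)] by simp
  moreover have "\<forall>u \<in> FA. ?r k u \<in> actions (on_obj E k) \<and> on_actions (c k) (?r k u) = u"
    using r c_actions[OF i(1) k(1,2)] A.a_in[OF i(1) k(1,2)] by simp
  ultimately show ?thesis using k(1,3) by blast
qed

lemma images_typed: "t \<in> images \<Longrightarrow> t \<in> all_transitions (states X) (actions X)"
proof -
  assume "t \<in> images"
  then obtain j s where "j \<in> I" "s \<in> transitions (on_obj E j)" "push (c j) s = t"
    unfolding images_def by blast
  then show ?thesis
    using WHDTS_mor(8)[OF c_hom] WHDTS_transition_typed[OF WHDTS_mor(4)[OF c_hom]] by metis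
qed

text \<open>
  Lift \<open>P\<close> along a partial section \<open>(p, r)\<close> into a stage \<open>k\<close>. The transitions carried by
  \<open>(p, r)\<close> into those of stage \<open>k\<close> form a closed set containing \<open>P\<close>, hence \<open>t\<close>; and \<open>c k\<close>
  maps the lift of \<open>t\<close> back to \<open>t\<close>.
\<close>

lemma images_contain_consequences:
  assumes covers and P: "finite P" "P \<subseteq> images"
    and t: "\<And>T. closed_transitions T \<Longrightarrow> P \<subseteq> T \<Longrightarrow> t \<in> T"
  shows "t \<in> images"
proof -
  define FS where "FS = (\<Union>(\<alpha>, us, \<beta>) \<in> P. {\<alpha>, \<beta>})"
  define FA where "FA = (\<Union>(\<alpha>, us, \<beta>) \<in> P. set us)"
  have fin: "finite FS" "finite FA" unfolding FS_def FA_def using P(1) by auto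
  have typed: "(\<alpha>, us, \<beta>) \<in> all_transitions (states X) (actions X)" if "(\<alpha>, us, \<beta>) \<in> P" for \<alpha> us \<beta>
    using images_typed that P(2) by blast
  then have sub: "FS \<subseteq> states X" "FA \<subseteq> actions X"
    unfolding FS_def FA_def all_transitions_def by fastforce+
  have P_typed: "P \<subseteq> all_transitions FS FA"
    using typed unfolding FS_def FA_def all_transitions_def by fastforce
  from finite_lift[OF \<open>covers\<close> fin P(1) sub P(2) P_typed]
  obtain k p r where k: "k \<in> I"
    and p: "\<forall>x \<in> FS. p x \<in> states (on_obj E k) \<and> on_states (c k) (p x) = x"
    and r: "\<forall>u \<in> FA. r u \<in> actions (on_obj E k) \<and> on_actions (c k) (r u) = u"
    and lift: "\<forall>t \<in> P. map_transition p r t \<in> transitions (on_obj E k)" by blast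
  let ?T = "all_transitions FS FA \<inter> {t. map_transition p r t \<in> transitions (on_obj E k)}"
  have "t \<in> ?T"
  proof (rule t)
    show "closed_transitions ?T"
      using functor_Obj[OF E, of k] k
      by (intro closed_transitions_Int closed_transitions_all closed_transitions_vimage WHDTS_closed) simp
  qed (use P_typed lift in auto)
  moreover from this have "push (c k) (map_transition p r t) = t"
    using map_transition_cong[of t FS FA "on_states (c k) \<circ> p" id "on_actions (c k) \<circ> r" id] p r
    by (cases t) simp
  ultimately show ?thesis unfolding images_def
    by (intro UN_I[OF k] image_eqI[of _ _ "map_transition p r t"]) simp_all
qed

text \<open>
  Each axiom has finitely many premises (one and five), so \<open>images_contain_consequences\<close> applies.
  Hence in a directed colimit no transition has to be added to the images of the given ones.
\<close>

lemma closed_images: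
  assumes covers
  shows "closed_transitions images"
proof (rule closed_transitionsI)
  fix \<alpha> us \<beta> \<sigma>
  assume "2 \<le> length us" "\<sigma> permutes {..<length us}" and t: "(\<alpha>, us, \<beta>) \<in> images"
  then show "(\<alpha>, permute_list \<sigma> us, \<beta>) \<in> images"
    by (intro images_contain_consequences[OF assms, of "{(\<alpha>, us, \<beta>)}"] closed_transitions_permute) auto
next
  fix \<alpha> us vs ws \<beta> \<nu>1 \<nu>2
  assume ne: "us \<noteq> []" "vs \<noteq> []" "ws \<noteq> []"
    and m: "(\<alpha>, us @ vs @ ws, \<beta>) \<in> images" "(\<alpha>, us, \<nu>1) \<in> images" "(\<nu>1, vs @ ws, \<beta>) \<in> images"
      "(\<alpha>, us @ vs, \<nu>2) \<in> images" "(\<nu>2, ws, \<beta>) \<in> images"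
  let ?P = "{(\<alpha>, us @ vs @ ws, \<beta>), (\<alpha>, us, \<nu>1), (\<nu>1, vs @ ws, \<beta>), (\<alpha>, us @ vs, \<nu>2), (\<nu>2, ws, \<beta>)}"
  show "(\<nu>1, vs, \<nu>2) \<in> images"
  proof (rule images_contain_consequences[OF assms, of ?P])
    fix T assume T: "closed_transitions T" "?P \<subseteq> T"
    show "(\<nu>1, vs, \<nu>2) \<in> T" by (rule closed_transitions_coherent[OF T(1) ne, of \<alpha> \<beta>]) (use T(2) in simp_all)
  qed (use m in simp_all)
qed

end


text \<open>
  The glued colimit has these properties by \<open>directed_glue_cover\<close> and \<open>closed_images\<close>. They pass to any other colimit along the
  comparison morphisms \<open>h : X \<rightarrow> Y\<close> and \<open>h' : Y \<rightarrow> X\<close>, for which \<open>h' h\<close> is the identity.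
\<close>

lemma directed_colimit_covers:
  fixes I :: "'u set" and E :: "('u, 'u \<times> 'u, ('u, 'l) whdts, ('u, 'l) whdts_mor) func"
    and \<Sigma> :: "'l set"
  assumes univ: "regular_universe TYPE('u)" and "small TYPE('u) I" and dir: "directed_poset I le"
    and E: "is_functor (poset_cat I le) (WHDTS \<Sigma>) E"
    and X: "colimit (WHDTS \<Sigma>) (poset_cat I le) E X c"
  shows "directed_cocone.covers I le E X c" and "transitions X \<subseteq> directed_cocone.images I E c"
proof -
  let ?P = "poset_cat I le" and ?W = "WHDTS \<Sigma> :: (('u, 'l) whdts, ('u, 'l) whdts_mor) cat"
  define Y where "Y = glued_whdts ?P E"
  define q where "q = glued_cocone ?P E"
  have Y: "colimit ?W ?P E Y q"
    unfolding Y_def q_def by (rule glued_colimit[OF univ _ E]) (simp add: assms(2))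
  have cX: "cocone ?W ?P E X c" and cY: "cocone ?W ?P E Y q"
    using X Y unfolding colimit_def by simp_all
  interpret C: directed_cocone \<Sigma> I le E X c by unfold_locales (fact dir E cX)+
  interpret G: directed_cocone \<Sigma> I le E Y q by unfold_locales (fact dir E cY)+
  have Gcov: "G.covers"
    unfolding G.covers_def
  proof
    have "directed_cover I le (\<lambda>i. states (on_obj E i)) (\<lambda>m. on_states (on_arr E m)) (glue_states ?P E) (states Y)"
      using directed_glue_cover[OF infinite_universe[OF univ] G.directed_states]
      unfolding Y_def glued_whdts_simps glue_states_def by simp
    then show "directed_cover I le (\<lambda>i. states (on_obj E i)) (\<lambda>m. on_states (on_arr E m)) (\<lambda>i. on_states (q i)) (states Y)"
      by (subst directed_cover_cong[where c' = "glue_states ?P E"]) (simp_all add: q_def glued_cocone_def)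
    have "directed_cover I le (\<lambda>i. actions (on_obj E i)) (\<lambda>m. on_actions (on_arr E m)) (glue_actions ?P E) (actions Y)"
      using directed_glue_cover[OF infinite_universe[OF univ] G.directed_actions]
      unfolding Y_def glued_whdts_simps glue_actions_def by simp
    then show "directed_cover I le (\<lambda>i. actions (on_obj E i)) (\<lambda>m. on_actions (on_arr E m)) (\<lambda>i. on_actions (q i)) (actions Y)"
      by (subst directed_cover_cong[where c' = "glue_actions ?P E"]) (simp_all add: q_def glued_cocone_def)
  qed
  have "map_transition (glue_states ?P E j) (glue_actions ?P E j) t = push (q j) t"
    if "j \<in> I" "t \<in> transitions (on_obj E j)" for j t
    unfolding q_def by (rule push_glued_cocone[OF univ _ E, symmetric]) (use assms(2) that in simp_all)
  then have "(\<Union>j \<in> I. map_transition (glue_states ?P E j) (glue_actions ?P E j) ` transitions (on_obj E j))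
      \<subseteq> G.images"
    unfolding G.images_def by auto
  then have Gtr: "transitions Y \<subseteq> G.images"
    unfolding Y_def glued_whdts_simps by (intro generated_least G.closed_images Gcov) simp
  obtain h where h: "h \<in> hom ?W X Y" and hc: "\<And>i. i \<in> I \<Longrightarrow> Comp ?W h (c i) = q i"
    using X cY unfolding colimit_def by (auto dest!: spec ex1_implies_ex)
  obtain h' where h': "h' \<in> hom ?W Y X" and hq: "\<And>i. i \<in> I \<Longrightarrow> Comp ?W h' (q i) = c i"
    using Y cX unfolding colimit_def by (auto dest!: spec ex1_implies_ex)
  have XO: "X \<in> Obj ?W" using cX unfolding cocone_def by blast
  have hh: "Comp ?W h' h = Ident ?W X"
  proof -
    have "Comp ?W (Comp ?W h' h) (c i) = c i" if i: "i \<in> I" for i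
      using category_assoc[OF category_WHDTS C.c_hom[OF i] h h'] hc[OF i] hq[OF i] by simp
    moreover have "Comp ?W (Ident ?W X) (c i) = c i" if i: "i \<in> I" for i
      by (rule category_Comp_Ident(2)[OF category_WHDTS C.c_hom[OF i]])
    moreover have "\<exists>!k. k \<in> hom ?W X X \<and> (\<forall>i \<in> I. Comp ?W k (c i) = c i)"
      using X cX unfolding colimit_def by simp
    ultimately show ?thesis
      using WHDTS_Comp_hom[OF h h'] WHDTS_Ident_hom[OF XO] by (blast elim: ex1E)
  qed
  have hcS: "on_states h (on_states (c i) x) = on_states (q i) x"
    if "i \<in> I" "x \<in> states (on_obj E i)" for i x
    using WHDTS_Comp_apply(1)[OF C.c_hom[OF that(1)] that(2), of h] hc[OF that(1)] by simp
  have hcA: "on_actions h (on_actions (c i) x) = on_actions (q i) x"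
    if "i \<in> I" "x \<in> actions (on_obj E i)" for i x
    using WHDTS_Comp_apply(2)[OF C.c_hom[OF that(1)] that(2), of h] hc[OF that(1)] by simp
  have hqS: "on_states h' (on_states (q i) x) = on_states (c i) x"
    if "i \<in> I" "x \<in> states (on_obj E i)" for i x
    using WHDTS_Comp_apply(1)[OF G.c_hom[OF that(1)] that(2), of h'] hq[OF that(1)] by simp
  have hqA: "on_actions h' (on_actions (q i) x) = on_actions (c i) x"
    if "i \<in> I" "x \<in> actions (on_obj E i)" for i x
    using WHDTS_Comp_apply(2)[OF G.c_hom[OF that(1)] that(2), of h'] hq[OF that(1)] by simp
  have retS: "on_states h z \<in> states Y \<and> on_states h' (on_states h z) = z" if "z \<in> states X" for z
    using WHDTS_mor(5)[OF h that] WHDTS_Comp_apply(1)[OF h that, of h'] that hh by simp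
  have retA: "on_actions h z \<in> actions Y \<and> on_actions h' (on_actions h z) = z" if "z \<in> actions X" for z
    using WHDTS_mor(6)[OF h that] WHDTS_Comp_apply(2)[OF h that, of h'] that hh by simp
  show "C.covers"
    unfolding C.covers_def
    using directed_cover_retract[OF conjunct1[OF Gcov[unfolded G.covers_def]] retS hcS hqS]
      directed_cover_retract[OF conjunct2[OF Gcov[unfolded G.covers_def]] retA hcA hqA] by blast
  show "transitions X \<subseteq> C.images"
  proof
    fix t assume t: "t \<in> transitions X"
    have "push h t \<in> G.images" using Gtr WHDTS_mor(8)[OF h t] by blast
    then obtain i s where i: "i \<in> I" and s: "s \<in> transitions (on_obj E i)" "push h t = push (q i) s"
      unfolding G.images_def by blast
    have "t = push h' (push h t)"
      using WHDTS_Comp_apply(3)[OF h t, of h'] WHDTS_Ident_apply(3)[OF XO t] hh by simp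
    also have "\<dots> = push (c i) s"
      unfolding s(2) using WHDTS_Comp_apply(3)[OF G.c_hom[OF i] s(1), of h'] hq[OF i] by simp
    finally show "t \<in> C.images" unfolding C.images_def using i s(1) by blast
  qed
qed

section \<open>Finite systems are finitely presentable\<close>

lemma hom_functor_simps:
  "on_obj (hom_functor C K) X = hom C K X"
  "x \<in> hom C K X \<Longrightarrow> f \<in> hom C X Y \<Longrightarrow> app (on_arr (hom_functor C K) f) x = Comp C f x"
  unfolding hom_functor_def by (simp_all add: hom_iff)

text \<open>
  The image of \<open>K\<close> is a finite piece of \<open>X\<close>, which \<open>finite_lift\<close> lifts to a stage; composing \<open>f\<close>
  with the partial section factors it.
\<close>

lemma (in directed_cocone) hom_factors:
  assumes covers and "transitions X \<subseteq> images"
    and fin: "finite (states K)" "finite (actions K)" "finite (transitions K)"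
    and f: "f \<in> hom (WHDTS \<Sigma>) K X"
  shows "\<exists>k \<in> I. \<exists>g \<in> hom (WHDTS \<Sigma>) K (on_obj E k). Comp (WHDTS \<Sigma>) (c k) g = f"
proof -
  let ?FS = "on_states f ` states K" and ?FA = "on_actions f ` actions K" and ?P = "push f ` transitions K"
  have sub: "?FS \<subseteq> states X" "?FA \<subseteq> actions X" "?P \<subseteq> images"
    using WHDTS_mor(5,6,8)[OF f] assms(2) by blast+
  have "?P \<subseteq> all_transitions ?FS ?FA"
    by (intro image_subsetI map_transition_all[OF WHDTS_transition_typed[OF WHDTS_mor(3)[OF f]]]) auto
  from finite_lift[OF \<open>covers\<close> fin[THEN finite_imageI] sub this]
  obtain k p r where k: "k \<in> I"
    and p: "\<forall>x \<in> ?FS. p x \<in> states (on_obj E k) \<and> on_states (c k) (p x) = x"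
    and r: "\<forall>u \<in> ?FA. r u \<in> actions (on_obj E k) \<and> on_actions (c k) (r u) = u"
    and lift: "\<forall>t \<in> ?P. map_transition p r t \<in> transitions (on_obj E k)"
    by (elim bexE exE conjE) (rule that)
  note ck = c_hom[OF k]
  define g where "g = \<lparr>source = K, on_states = restrict (p \<circ> on_states f) (states K),
    on_actions = restrict (r \<circ> on_actions f) (actions K), target = on_obj E k\<rparr>"
  have g: "g \<in> hom (WHDTS \<Sigma>) K (on_obj E k)"
    unfolding WHDTS_hom_iff
  proof (intro conjI ballI)
    fix u assume u: "u \<in> actions K"
    show "labelling (on_obj E k) (on_actions g u) = labelling K u"
      using r u WHDTS_mor(7)[OF ck, of "r (on_actions f u)"] WHDTS_mor(7)[OF f u] by (simp add: g_def)
  next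
    fix t assume t: "t \<in> transitions K"
    have "push g t = map_transition (p \<circ> on_states f) (r \<circ> on_actions f) t"
      by (rule map_transition_cong[OF WHDTS_transition_typed[OF WHDTS_mor(3)[OF f] t]]) (simp_all add: g_def)
    also have "\<dots> = map_transition p r (push f t)" by (cases t) simp
    finally show "push g t \<in> transitions (on_obj E k)" using lift t by simp
  qed (use p r WHDTS_mor(3)[OF f] WHDTS_mor(3)[OF ck] in \<open>auto simp: g_def\<close>)
  have "Comp (WHDTS \<Sigma>) (c k) g = f"
  proof (rule WHDTS_hom_eqI[OF WHDTS_Comp_hom[OF g ck] f])
    fix x assume x: "x \<in> states K"
    show "on_states (Comp (WHDTS \<Sigma>) (c k) g) x = on_states f x"
      unfolding WHDTS_Comp_apply(1)[OF g x] using p x by (simp add: g_def)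
  next
    fix x assume x: "x \<in> actions K"
    show "on_actions (Comp (WHDTS \<Sigma>) (c k) g) x = on_actions f x"
      unfolding WHDTS_Comp_apply(2)[OF g x] using r x by (simp add: g_def)
  qed
  then show ?thesis using k g by blast
qed

lemma (in directed_cocone) hom_factors_unique:
  assumes covers and fin: "finite (states K)" "finite (actions K)"
    and i: "i \<in> I" and j: "j \<in> I"
    and f: "f \<in> hom (WHDTS \<Sigma>) K (on_obj E i)" and g: "g \<in> hom (WHDTS \<Sigma>) K (on_obj E j)"
    and eq: "Comp (WHDTS \<Sigma>) (c i) f = Comp (WHDTS \<Sigma>) (c j) g"
  shows "\<exists>k \<in> I. le i k \<and> le j k \<and> Comp (WHDTS \<Sigma>) (on_arr E (i, k)) f = Comp (WHDTS \<Sigma>) (on_arr E (j, k)) g"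
proof -
  note covS = conjunct1[OF \<open>covers\<close>[unfolded covers_def]]
  note covA = conjunct2[OF \<open>covers\<close>[unfolded covers_def]]
  obtain k0 where k0: "k0 \<in> I" "le i k0" "le j k0" by (rule directed_poset_ub[OF directed i j])
  let ?\<Phi> = "\<lambda>x k. le i k \<and> le j k \<and>
    on_states (on_arr E (i, k)) (on_states f x) = on_states (on_arr E (j, k)) (on_states g x)"
  let ?\<Psi> = "\<lambda>x k. le i k \<and> le j k \<and>
    on_actions (on_arr E (i, k)) (on_actions f x) = on_actions (on_arr E (j, k)) (on_actions g x)"
  have "\<exists>k \<in> I. le k0 k \<and> (\<forall>x \<in> states K. ?\<Phi> x k)"
  proof (rule directed_eventually_finite[OF directed fin(1) k0(1)])
    fix x assume x: "x \<in> states K"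
    have "on_states (c i) (on_states f x) = on_states (c j) (on_states g x)"
      using WHDTS_Comp_apply(1)[OF f x, of "c i"] WHDTS_Comp_apply(1)[OF g x, of "c j"] eq by simp
    from directed_coverE[OF covS i j WHDTS_mor(5)[OF f x] WHDTS_mor(5)[OF g x] this]
    show "\<exists>k \<in> I. ?\<Phi> x k" by blast
  next
    fix x k l assume x: "x \<in> states K" and k: "k \<in> I" and l: "l \<in> I" "le k l" and \<Phi>: "?\<Phi> x k"
    then show "?\<Phi> x l"
      using S.eq_at_later_stage[OF i j k l(1) _ _ l(2) WHDTS_mor(5)[OF f x] WHDTS_mor(5)[OF g x]]
        directed_poset_trans[OF directed _ l(2) i k l(1)] directed_poset_trans[OF directed _ l(2) j k l(1)]
      by simp
  qed
  then obtain k1 where k1: "k1 \<in> I" "le k0 k1" "\<forall>x \<in> states K. ?\<Phi> x k1" by blast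
  have "\<exists>k \<in> I. le k1 k \<and> (\<forall>x \<in> actions K. ?\<Psi> x k)"
  proof (rule directed_eventually_finite[OF directed fin(2) k1(1)])
    fix x assume x: "x \<in> actions K"
    have "on_actions (c i) (on_actions f x) = on_actions (c j) (on_actions g x)"
      using WHDTS_Comp_apply(2)[OF f x, of "c i"] WHDTS_Comp_apply(2)[OF g x, of "c j"] eq by simp
    from directed_coverE[OF covA i j WHDTS_mor(6)[OF f x] WHDTS_mor(6)[OF g x] this]
    show "\<exists>k \<in> I. ?\<Psi> x k" by blast
  next
    fix x k l assume x: "x \<in> actions K" and k: "k \<in> I" and l: "l \<in> I" "le k l" and \<Psi>: "?\<Psi> x k"
    then show "?\<Psi> x l"
      using A.eq_at_later_stage[OF i j k l(1) _ _ l(2) WHDTS_mor(6)[OF f x] WHDTS_mor(6)[OF g x]]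
        directed_poset_trans[OF directed _ l(2) i k l(1)] directed_poset_trans[OF directed _ l(2) j k l(1)]
      by simp
  qed
  then obtain k where k: "k \<in> I" "le k1 k" "\<forall>x \<in> actions K. ?\<Psi> x k" by blast
  have ik1: "le i k1" by (rule directed_poset_trans[OF directed k0(2) k1(2) i k0(1) k1(1)])
  have jk1: "le j k1" by (rule directed_poset_trans[OF directed k0(3) k1(2) j k0(1) k1(1)])
  have ik: "le i k" by (rule directed_poset_trans[OF directed ik1 k(2) i k1(1) k(1)])
  have jk: "le j k" by (rule directed_poset_trans[OF directed jk1 k(2) j k1(1) k(1)])
  have "Comp (WHDTS \<Sigma>) (on_arr E (i, k)) f = Comp (WHDTS \<Sigma>) (on_arr E (j, k)) g"
  proof (rule WHDTS_hom_eqI[OF WHDTS_Comp_hom[OF f E_hom[OF i k(1) ik]] WHDTS_Comp_hom[OF g E_hom[OF j k(1) jk]]])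
    fix x assume x: "x \<in> states K"
    then show "on_states (Comp (WHDTS \<Sigma>) (on_arr E (i, k)) f) x = on_states (Comp (WHDTS \<Sigma>) (on_arr E (j, k)) g) x"
      unfolding WHDTS_Comp_apply(1)[OF f x] WHDTS_Comp_apply(1)[OF g x]
      using S.eq_at_later_stage[OF i j k1(1) k(1) ik1 jk1 k(2) WHDTS_mor(5)[OF f x] WHDTS_mor(5)[OF g x]] k1(3)
      by simp
  next
    fix x assume x: "x \<in> actions K"
    then show "on_actions (Comp (WHDTS \<Sigma>) (on_arr E (i, k)) f) x = on_actions (Comp (WHDTS \<Sigma>) (on_arr E (j, k)) g) x"
      unfolding WHDTS_Comp_apply(2)[OF f x] WHDTS_Comp_apply(2)[OF g x] using k(3) by simp
  qed
  then show ?thesis using k(1) ik jk by blast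
qed

lemma finite_imp_finitely_presentable:
  fixes K :: "('u, 'l) whdts" and \<Sigma> :: "'l set"
  assumes univ: "regular_universe TYPE('u)" and K: "K \<in> Obj (WHDTS \<Sigma>)"
    and fin: "finite (states K)" "finite (actions K)" "finite (transitions K)"
  shows "finitely_presentable TYPE('u) (WHDTS \<Sigma>) K"
  unfolding finitely_presentable_def preserves_directed_colimits_def
proof (intro conjI K allI impI; elim conjE)
  let ?W = "WHDTS \<Sigma> :: (('u, 'l) whdts, ('u, 'l) whdts_mor) cat"
  fix I :: "'u set" and le E X c
  assume I: "small TYPE('u) I" and dir: "directed_poset I le"
    and E: "is_functor (poset_cat I le) ?W E" and X: "colimit ?W (poset_cat I le) E X c"
  note covers = directed_colimit_covers(1)[OF univ I dir E X]
    and images = directed_colimit_covers(2)[OF univ I dir E X]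
  have c: "cocone ?W (poset_cat I le) E X c" using X unfolding colimit_def by blast
  interpret directed_cocone \<Sigma> I le E X c by unfold_locales (fact dir E c)+
  let ?H = "hom_functor ?W K"
  have H: "is_functor ?W (set_cat UNIV) ?H" by (rule functor_hom_functor[OF category_WHDTS K])
  have "directed_cover I le (on_obj (func_comp ?H E)) (\<lambda>m. app (on_arr (func_comp ?H E) m))
      (\<lambda>i. app (on_arr ?H (c i))) (hom ?W K X)"
    unfolding directed_cover_def
  proof (intro conjI ballI impI subsetI)
    fix f assume "f \<in> hom ?W K X"
    from hom_factors[OF covers images fin this]
    obtain k g where k: "k \<in> I" and g: "g \<in> hom ?W K (on_obj E k)" "Comp ?W (c k) g = f" by blast
    have "app (on_arr ?H (c k)) g = f" using hom_functor_simps(2)[OF g(1) c_hom[OF k]] g(2) by simp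
    then show "f \<in> (\<Union>i \<in> I. app (on_arr ?H (c i)) ` on_obj (func_comp ?H E) i)"
      using k g(1) by (auto simp: func_comp_def hom_functor_simps(1))
  next
    fix i j f g assume i: "i \<in> I" and j: "j \<in> I"
      and f: "f \<in> on_obj (func_comp ?H E) i" and g: "g \<in> on_obj (func_comp ?H E) j"
      and eq: "app (on_arr ?H (c i)) f = app (on_arr ?H (c j)) g"
    have f: "f \<in> hom ?W K (on_obj E i)" and g: "g \<in> hom ?W K (on_obj E j)"
      using f g by (simp_all add: func_comp_def hom_functor_simps(1))
    have "Comp ?W (c i) f = Comp ?W (c j) g"
      using eq hom_functor_simps(2)[OF f c_hom[OF i]] hom_functor_simps(2)[OF g c_hom[OF j]] by simp
    from hom_factors_unique[OF covers fin(1,2) i j f g this]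
    obtain k where k: "k \<in> I" "le i k" "le j k"
      and eq: "Comp ?W (on_arr E (i, k)) f = Comp ?W (on_arr E (j, k)) g" by blast
    have "app (on_arr (func_comp ?H E) (i, k)) f = app (on_arr (func_comp ?H E) (j, k)) g"
      using hom_functor_simps(2)[OF f E_hom[OF i k(1,2)]] hom_functor_simps(2)[OF g E_hom[OF j k(1,3)]] eq
      by (simp add: func_comp_def)
    then show "\<exists>k \<in> I. le i k \<and> le j k \<and>
        app (on_arr (func_comp ?H E) (i, k)) f = app (on_arr (func_comp ?H E) (j, k)) g"
      using k by blast
  qed
  then have pres: "presents_colimit (poset_cat I le) (on_obj (func_comp ?H E))
      (\<lambda>m. app (on_arr (func_comp ?H E) m)) (\<lambda>i. app (on_arr ?H (c i))) (on_obj ?H X)"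
    unfolding hom_functor_simps(1) by (rule directed_cover_presents_colimit)
  show "colimit (set_cat UNIV) (poset_cat I le) (func_comp ?H E) (on_obj ?H X) (\<lambda>i. on_arr ?H (c i))"
  proof (rule set_cat_colimitI[OF functor_cocone[OF H E c] pres category_poset_cat[OF dir]])
    fix m assume "m \<in> Arr (poset_cat I le)"
    from functor_hom[OF H functor_Arr[OF E this]]
    show "on_arr (func_comp ?H E) m \<in> hom (set_cat UNIV)
        (on_obj (func_comp ?H E) (Dom (poset_cat I le) m)) (on_obj (func_comp ?H E) (Cod (poset_cat I le) m))"
      by (simp add: func_comp_def)
  qed
qed


section \<open>Every system is a directed colimit of finite ones\<close>

definition fin_systems :: "'l set \<Rightarrow> 'u set \<Rightarrow> ('u, 'l) whdts set" where
  "fin_systems \<Sigma> N = {K. is_whdts \<Sigma> K \<and> states K \<in> Fpow N \<and> actions K \<in> Fpow N \<and> finite (transitions K)}"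

text \<open>
  A finite system is determined by its finite sets of states, actions and transitions together with
  the graph of its labelling.
\<close>

lemma small_fin_systems:
  fixes N :: "'u set"
  assumes univ: "regular_universe TYPE('u)" and \<Sigma>: "small TYPE('u) \<Sigma>" and N: "small TYPE('u) N"
  shows "small TYPE('u) (fin_systems \<Sigma> N)"
proof (rule small_inj_on)
  let ?code = "\<lambda>K :: ('u, 'l) whdts. (states K, actions K, (\<lambda>u. (u, labelling K u)) ` actions K, transitions K)"
  let ?B = "Fpow N \<times> Fpow N \<times> Fpow (N \<times> \<Sigma>) \<times> Fpow (N \<times> lists N \<times> N)"
  show "inj_on ?code (fin_systems \<Sigma> N)"
  proof (rule inj_onI)
    fix K K' assume K: "K \<in> fin_systems \<Sigma> N" and K': "K' \<in> fin_systems \<Sigma> N" and eq: "?code K = ?code K'"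
    have "labelling K u = labelling K' u" if "u \<in> actions K" for u
      using eq that by (auto simp: image_iff set_eq_iff)
    moreover have "labelling K \<in> extensional (actions K)" "labelling K' \<in> extensional (actions K)"
      using K K' eq unfolding fin_systems_def is_whdts_iff by (auto simp: PiE_iff)
    ultimately have "labelling K = labelling K'" by (intro extensionalityI[of _ "actions K"])
    then show "K = K'" using eq by simp
  qed
  show "?code ` fin_systems \<Sigma> N \<subseteq> ?B"
  proof (intro image_subsetI)
    fix K assume K: "K \<in> fin_systems \<Sigma> N"
    have lab: "labelling K \<in> actions K \<rightarrow>\<^sub>E \<Sigma>" and tr: "transitions K \<subseteq> all_transitions (states K) (actions K)"
      and fin: "finite (states K)" "states K \<subseteq> N" "finite (actions K)" "actions K \<subseteq> N" "finite (transitions K)"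
      using K unfolding fin_systems_def is_whdts_iff Fpow_def by auto
    have "transitions K \<subseteq> N \<times> lists N \<times> N"
      using tr fin(2,4) unfolding all_transitions_def by fastforce
    moreover have "(\<lambda>u. (u, labelling K u)) ` actions K \<subseteq> N \<times> \<Sigma>" using lab fin(4) by auto
    ultimately show "?code K \<in> ?B" using fin unfolding Fpow_def by simp
  qed
  show "small TYPE('u) ?B"
    by (intro small_Sigma small_Fpow small_lists univ \<Sigma> N)
qed

lemma fin_systems_Obj:
  fixes K :: "('u, 'l) whdts"
  assumes univ: "regular_universe TYPE('u)" and "K \<in> fin_systems \<Sigma> N"
  shows "K \<in> Obj (WHDTS \<Sigma>)"
  using assms(2) unfolding WHDTS_Obj_iff fin_systems_def Fpow_def
  by (auto intro!: small_countable[OF univ] countable_finite)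

text \<open>
  A finite subsystem of \<open>X\<close> is cut out by finitely many states, finitely many actions and a bound on
  the dimension of its transitions. These triples are ordered componentwise, and \<open>\<kappa>\<close> turns them into
  elements of the universe. The injections \<open>number B\<close> move a finite set \<open>B\<close> into a fixed set \<open>N\<close>, which
  makes the isomorphic copies of all these subsystems range over a small set.
\<close>

locale finite_subsystems =
  fixes \<Sigma> :: "'l set" and X :: "('u, 'l) whdts" and N :: "'u set"
    and number :: "'u set \<Rightarrow> 'u \<Rightarrow> 'u" and \<kappa> :: "'u set \<times> 'u set \<times> nat \<Rightarrow> 'u"
  assumes univ: "regular_universe TYPE('u)"
    and X: "X \<in> Obj (WHDTS \<Sigma>)"
    and number: "finite B \<Longrightarrow> inj_on (number B) B \<and> number B ` B \<subseteq> N"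
    and \<kappa>: "inj_on \<kappa> (Fpow (states X) \<times> Fpow (actions X) \<times> UNIV)"
begin

definition Index :: "'u set" where
  "Index = \<kappa> ` (Fpow (states X) \<times> Fpow (actions X) \<times> UNIV)"

definition dec :: "'u \<Rightarrow> 'u set \<times> 'u set \<times> nat" where
  "dec = inv_into (Fpow (states X) \<times> Fpow (actions X) \<times> UNIV) \<kappa>"

definition S :: "'u \<Rightarrow> 'u set" where "S i = fst (dec i)"
definition L :: "'u \<Rightarrow> 'u set" where "L i = fst (snd (dec i))"
definition dim :: "'u \<Rightarrow> nat" where "dim i = snd (snd (dec i))"

definition below :: "'u \<Rightarrow> 'u \<Rightarrow> bool" where
  "below i j \<longleftrightarrow> S i \<subseteq> S j \<and> L i \<subseteq> L j \<and> dim i \<le> dim j"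

definition unnumber :: "'u set \<Rightarrow> 'u \<Rightarrow> 'u" where "unnumber B = inv_into B (number B)"

text \<open>
  The copy on \<open>N\<close> of the subsystem of index \<open>i\<close>. Without the bound on the dimension a system with
  finitely many states and actions could still have infinitely many transitions.
\<close>

definition stage :: "'u \<Rightarrow> ('u, 'l) whdts" where
  "stage i =
     \<lparr>states = number (S i) ` S i, actions = number (L i) ` L i,
      labelling = (\<lambda>u \<in> number (L i) ` L i. labelling X (unnumber (L i) u)),
      transitions = all_transitions (number (S i) ` S i) (number (L i) ` L i) \<inter>
        {t. map_transition (unnumber (S i)) (unnumber (L i)) t \<in> transitions X} \<inter> {(\<alpha>, us, \<beta>). length us \<le> dim i}\<rparr>"

definition stages :: "('u, 'u \<times> 'u, ('u, 'l) whdts, ('u, 'l) whdts_mor) func" where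
  "stages =
     \<lparr>on_obj = stage,
      on_arr = (\<lambda>(i, j). \<lparr>source = stage i,
        on_states = restrict (number (S j) \<circ> unnumber (S i)) (states (stage i)),
        on_actions = restrict (number (L j) \<circ> unnumber (L i)) (actions (stage i)), target = stage j\<rparr>)\<rparr>"

definition incl :: "'u \<Rightarrow> ('u, 'l) whdts_mor" where
  "incl i = \<lparr>source = stage i, on_states = restrict (unnumber (S i)) (states (stage i)),
     on_actions = restrict (unnumber (L i)) (actions (stage i)), target = X\<rparr>"

lemma dec_\<kappa>: "B \<in> Fpow (states X) \<Longrightarrow> C \<in> Fpow (actions X) \<Longrightarrow>
    \<kappa> (B, C, m) \<in> Index \<and> S (\<kappa> (B, C, m)) = B \<and> L (\<kappa> (B, C, m)) = C \<and> dim (\<kappa> (B, C, m)) = m"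
  unfolding Index_def S_def L_def dim_def dec_def by (simp add: inv_into_f_f[OF \<kappa>])

lemma Index_finite:
  assumes "i \<in> Index"
  shows "finite (S i)" "S i \<subseteq> states X" "finite (L i)" "L i \<subseteq> actions X"
proof -
  obtain B C m where "B \<in> Fpow (states X)" "C \<in> Fpow (actions X)" "i = \<kappa> (B, C, m)"
    using assms unfolding Index_def by auto
  then have "S i \<in> Fpow (states X)" "L i \<in> Fpow (actions X)" using dec_\<kappa> by simp_all
  then show "finite (S i)" "S i \<subseteq> states X" "finite (L i)" "L i \<subseteq> actions X"
    unfolding Fpow_def by simp_all
qed

lemma Index_eqI:
  assumes "i \<in> Index" "j \<in> Index" "S i = S j" "L i = L j" "dim i = dim j"
  shows "i = j"
proof -
  have "\<kappa> (dec i) = i" if "i \<in> Index" for i using that unfolding Index_def dec_def by (rule f_inv_into_f)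
  moreover have "dec i = dec j" using assms(3-5) unfolding S_def L_def dim_def by (simp add: prod_eq_iff)
  ultimately show ?thesis using assms(1,2) by metis
qed

lemma directed_Index: "directed_poset Index below"
  unfolding directed_poset_def
proof (intro conjI ballI impI)
  have "{} \<in> Fpow (states X)" "{} \<in> Fpow (actions X)" unfolding Fpow_def by simp_all
  then show "Index \<noteq> {}" using dec_\<kappa> by blast
next
  fix i j assume ij: "i \<in> Index" "j \<in> Index"
  let ?k = "\<kappa> (S i \<union> S j, L i \<union> L j, max (dim i) (dim j))"
  have "S i \<union> S j \<in> Fpow (states X)" "L i \<union> L j \<in> Fpow (actions X)"
    using Index_finite[OF ij(1)] Index_finite[OF ij(2)] unfolding Fpow_def by simp_all
  from dec_\<kappa>[OF this]
  show "\<exists>k \<in> Index. below i k \<and> below j k" unfolding below_def by (intro bexI[of _ ?k]) auto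
qed (auto simp: below_def intro!: Index_eqI)

lemma unnumber_number: "finite B \<Longrightarrow> x \<in> B \<Longrightarrow> unnumber B (number B x) = x"
  unfolding unnumber_def using number by simp

lemma stage_simps [simp]:
  "states (stage i) = number (S i) ` S i" "actions (stage i) = number (L i) ` L i"
  "t \<in> transitions (stage i) \<longleftrightarrow> t \<in> all_transitions (number (S i) ` S i) (number (L i) ` L i) \<and>
     map_transition (unnumber (S i)) (unnumber (L i)) t \<in> transitions X \<and> length (fst (snd t)) \<le> dim i"
  unfolding stage_def by (auto split: prod.splits)

lemma stage_labelling:
  assumes "i \<in> Index" "u \<in> L i"
  shows "labelling (stage i) (number (L i) u) = labelling X u"
  using assms unnumber_number[OF Index_finite(3)] unfolding stage_def by simp

lemma stage_fin_systems:
  assumes i: "i \<in> Index"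
  shows "stage i \<in> fin_systems \<Sigma> N"
  unfolding fin_systems_def is_whdts_iff mem_Collect_eq
proof (intro conjI)
  show "labelling (stage i) \<in> actions (stage i) \<rightarrow>\<^sub>E \<Sigma>"
  proof
    fix z assume "z \<in> actions (stage i)"
    then obtain u where u: "u \<in> L i" "z = number (L i) u" by auto
    then show "labelling (stage i) z \<in> \<Sigma>"
      using stage_labelling[OF i] WHDTS_labelling[OF X] Index_finite(4)[OF i] by auto
  qed (simp add: stage_def)
  show "transitions (stage i) \<subseteq> all_transitions (states (stage i)) (actions (stage i))" by auto
  show "closed_transitions (transitions (stage i))"
    unfolding stage_def using WHDTS_closed[OF X]
    by (simp add: closed_transitions_Int closed_transitions_all closed_transitions_vimage closed_transitions_length_le)
  show "states (stage i) \<in> Fpow N" "actions (stage i) \<in> Fpow N"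
    using Index_finite[OF i] number unfolding Fpow_def by simp_all
  have "transitions (stage i) \<subseteq> states (stage i) \<times>
      {us. set us \<subseteq> actions (stage i) \<and> length us \<le> dim i} \<times> states (stage i)"
    by (auto simp: all_transitions_def)
  moreover have "finite \<dots>" using Index_finite[OF i] by (auto intro!: finite_lists_length_le)
  ultimately show "finite (transitions (stage i))" by (rule finite_subset)
qed

lemma stage_Obj: "i \<in> Index \<Longrightarrow> stage i \<in> Obj (WHDTS \<Sigma>)"
  by (rule fin_systems_Obj[OF univ stage_fin_systems])

lemma incl_simps:
  assumes "i \<in> Index"
  shows "x \<in> S i \<Longrightarrow> on_states (incl i) (number (S i) x) = x"
    and "u \<in> L i \<Longrightarrow> on_actions (incl i) (number (L i) u) = u"
  using unnumber_number Index_finite[OF assms] unfolding incl_def by simp_all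

lemma incl_push:
  assumes "t \<in> transitions (stage i)"
  shows "push (incl i) t = map_transition (unnumber (S i)) (unnumber (L i)) t"
  by (rule map_transition_cong[of _ "states (stage i)" "actions (stage i)"]) (use assms in \<open>auto simp: incl_def\<close>)

lemma incl_hom:
  assumes i: "i \<in> Index"
  shows "incl i \<in> hom (WHDTS \<Sigma>) (stage i) X"
  unfolding WHDTS_hom_iff
proof (intro conjI ballI stage_Obj i X)
  show "on_states (incl i) \<in> states (stage i) \<rightarrow>\<^sub>E states X"
    using incl_simps(1)[OF i] Index_finite(2)[OF i] by (auto simp: PiE_iff) (simp add: incl_def)
  show "on_actions (incl i) \<in> actions (stage i) \<rightarrow>\<^sub>E actions X"
    using incl_simps(2)[OF i] Index_finite(4)[OF i] by (auto simp: PiE_iff) (simp add: incl_def)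
  show "labelling X (on_actions (incl i) u) = labelling (stage i) u" if "u \<in> actions (stage i)" for u
    using that incl_simps(2)[OF i] stage_labelling[OF i] by auto
  show "push (incl i) t \<in> transitions X" if "t \<in> transitions (stage i)" for t
    unfolding incl_push[OF that] using that by simp
qed (simp_all add: incl_def)

lemma stages_arr_simps:
  assumes "i \<in> Index"
  shows "x \<in> S i \<Longrightarrow> on_states (on_arr stages (i, j)) (number (S i) x) = number (S j) x"
    and "u \<in> L i \<Longrightarrow> on_actions (on_arr stages (i, j)) (number (L i) u) = number (L j) u"
  using unnumber_number Index_finite[OF assms] unfolding stages_def by simp_all

lemma stages_hom:
  assumes i: "i \<in> Index" and j: "j \<in> Index" and ij: "below i j"
  shows "on_arr stages (i, j) \<in> hom (WHDTS \<Sigma>) (stage i) (stage j)"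
  unfolding WHDTS_hom_iff
proof (intro conjI ballI stage_Obj i j)
  have S: "S i \<subseteq> S j" and L: "L i \<subseteq> L j" and dim: "dim i \<le> dim j" using ij unfolding below_def by simp_all
  note st = stages_arr_simps[OF i, of _ j]
  show "on_states (on_arr stages (i, j)) \<in> states (stage i) \<rightarrow>\<^sub>E states (stage j)"
    using st(1) S by (auto simp: PiE_iff) (simp add: stages_def)
  show "on_actions (on_arr stages (i, j)) \<in> actions (stage i) \<rightarrow>\<^sub>E actions (stage j)"
    using st(2) L by (auto simp: PiE_iff) (simp add: stages_def)
  show "labelling (stage j) (on_actions (on_arr stages (i, j)) u) = labelling (stage i) u"
    if "u \<in> actions (stage i)" for u
    using that st(2) L stage_labelling[OF i] stage_labelling[OF j] by auto
  show "push (on_arr stages (i, j)) t \<in> transitions (stage j)" if t: "t \<in> transitions (stage i)" for t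
  proof -
    let ?f = "on_arr stages (i, j)"
    have typed: "t \<in> all_transitions (states (stage i)) (actions (stage i))" using t by simp
    have "push ?f t \<in> all_transitions (states (stage j)) (actions (stage j))"
      by (rule map_transition_all[OF typed]) (use st S L in auto)
    moreover have "map_transition (unnumber (S j)) (unnumber (L j)) (push ?f t)
        = map_transition (unnumber (S j) \<circ> on_states ?f) (unnumber (L j) \<circ> on_actions ?f) t" by (cases t) simp
    moreover have "\<dots> = map_transition (unnumber (S i)) (unnumber (L i)) t"
      by (rule map_transition_cong[OF typed])
        (use st S L unnumber_number Index_finite[OF i] Index_finite[OF j] in \<open>auto simp: subset_iff\<close>)
    moreover have "length (fst (snd (push ?f t))) = length (fst (snd t))" by (cases t) simp
    ultimately show ?thesis using t dim by simp
  qed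
qed (simp_all add: stages_def)

lemma stages_functor: "is_functor (poset_cat Index below) (WHDTS \<Sigma>) stages"
  unfolding is_functor_def
proof (intro conjI ballI category_WHDTS category_poset_cat directed_Index)
  fix i assume "i \<in> Obj (poset_cat Index below)"
  then have i: "i \<in> Index" by simp
  then show "on_obj stages i \<in> Obj (WHDTS \<Sigma>)" using stage_Obj by (simp add: stages_def)
  have "on_arr stages (i, i) = Ident (WHDTS \<Sigma>) (stage i)"
  proof (rule WHDTS_hom_eqI[OF stages_hom WHDTS_Ident_hom[OF stage_Obj]])
    show "below i i" using directed_poset_refl[OF directed_Index i] .
  qed (use i stages_arr_simps[OF i] in auto)
  then show "on_arr stages (Ident (poset_cat Index below) i) = Ident (WHDTS \<Sigma>) (on_obj stages i)"
    by (simp add: stages_def)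
next
  fix m assume m: "m \<in> Arr (poset_cat Index below)"
  then show "on_arr stages m \<in> hom (WHDTS \<Sigma>) (on_obj stages (Dom (poset_cat Index below) m))
      (on_obj stages (Cod (poset_cat Index below) m))"
    using stages_hom by (cases m) (auto simp: stages_def)
next
  fix i j k f g assume "f \<in> hom (poset_cat Index below) i j" "g \<in> hom (poset_cat Index below) j k"
  then have fg: "f = (i, j)" "g = (j, k)" and I: "i \<in> Index" "j \<in> Index" "k \<in> Index" and le: "below i j" "below j k"
    by (simp_all add: poset_cat_hom_iff)
  have ik: "below i k" by (rule directed_poset_trans[OF directed_Index le I])
  have S: "S i \<subseteq> S j" and L: "L i \<subseteq> L j" using le unfolding below_def by simp_all
  note fh = stages_hom[OF I(1,2) le(1)] and gh = stages_hom[OF I(2,3) le(2)]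
  have "on_arr stages (i, k) = Comp (WHDTS \<Sigma>) (on_arr stages (j, k)) (on_arr stages (i, j))"
  proof (rule WHDTS_hom_eqI[OF stages_hom[OF I(1,3) ik] WHDTS_Comp_hom[OF fh gh]])
    fix x assume x: "x \<in> states (stage i)"
    show "on_states (on_arr stages (i, k)) x
        = on_states (Comp (WHDTS \<Sigma>) (on_arr stages (j, k)) (on_arr stages (i, j))) x"
      unfolding WHDTS_Comp_apply(1)[OF fh x]
      using x S stages_arr_simps(1)[OF I(1)] stages_arr_simps(1)[OF I(2)] by auto
  next
    fix x assume x: "x \<in> actions (stage i)"
    show "on_actions (on_arr stages (i, k)) x
        = on_actions (Comp (WHDTS \<Sigma>) (on_arr stages (j, k)) (on_arr stages (i, j))) x"
      unfolding WHDTS_Comp_apply(2)[OF fh x]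
      using x L stages_arr_simps(2)[OF I(1)] stages_arr_simps(2)[OF I(2)] by auto
  qed
  then show "on_arr stages (Comp (poset_cat Index below) g f) = Comp (WHDTS \<Sigma>) (on_arr stages g) (on_arr stages f)"
    by (simp add: fg)
qed

lemma incl_cocone: "cocone (WHDTS \<Sigma>) (poset_cat Index below) stages X incl"
  unfolding cocone_def
proof (intro conjI ballI X)
  fix i assume "i \<in> Obj (poset_cat Index below)"
  then show "incl i \<in> hom (WHDTS \<Sigma>) (on_obj stages i) X" using incl_hom by (simp add: stages_def)
next
  fix m assume "m \<in> Arr (poset_cat Index below)"
  then obtain i j where m: "m = (i, j)" and ij: "i \<in> Index" "j \<in> Index" "below i j" by (cases m) auto
  have S: "S i \<subseteq> S j" and L: "L i \<subseteq> L j" using ij unfolding below_def by simp_all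
  note fh = stages_hom[OF ij]
  have "Comp (WHDTS \<Sigma>) (incl j) (on_arr stages (i, j)) = incl i"
  proof (rule WHDTS_hom_eqI[OF WHDTS_Comp_hom[OF fh incl_hom[OF ij(2)]] incl_hom[OF ij(1)]])
    fix x assume x: "x \<in> states (stage i)"
    show "on_states (Comp (WHDTS \<Sigma>) (incl j) (on_arr stages (i, j))) x = on_states (incl i) x"
      unfolding WHDTS_Comp_apply(1)[OF fh x]
      using x S stages_arr_simps(1)[OF ij(1)] incl_simps(1)[OF ij(1)] incl_simps(1)[OF ij(2)] by auto
  next
    fix x assume x: "x \<in> actions (stage i)"
    show "on_actions (Comp (WHDTS \<Sigma>) (incl j) (on_arr stages (i, j))) x = on_actions (incl i) x"
      unfolding WHDTS_Comp_apply(2)[OF fh x]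
      using x L stages_arr_simps(2)[OF ij(1)] incl_simps(2)[OF ij(1)] incl_simps(2)[OF ij(2)] by auto
  qed
  then show "Comp (WHDTS \<Sigma>) (incl (Cod (poset_cat Index below) m)) (on_arr stages m)
      = incl (Dom (poset_cat Index below) m)" by (simp add: m)
qed

lemma stages_colimit: "colimit (WHDTS \<Sigma>) (poset_cat Index below) stages X incl"
proof (rule WHDTS_colimitI[OF stages_functor incl_cocone])
  have ub: "\<exists>k \<in> Index. below i k \<and> below j k" if "i \<in> Index" "j \<in> Index" for i j
    using directed_poset_ub[OF directed_Index that] by blast
  show "presents_colimit (poset_cat Index below) (\<lambda>i. states (on_obj stages i))
      (\<lambda>m. on_states (on_arr stages m)) (\<lambda>i. on_states (incl i)) (states X)"
  proof (rule directed_presents_colimit)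
    show "states X \<subseteq> (\<Union>i\<in>Index. on_states (incl i) ` states (on_obj stages i))"
    proof
      fix x assume "x \<in> states X"
      then have "{x} \<in> Fpow (states X)" "{} \<in> Fpow (actions X)" unfolding Fpow_def by simp_all
      from dec_\<kappa>[OF this, of 0]
      show "x \<in> (\<Union>i\<in>Index. on_states (incl i) ` states (on_obj stages i))"
        using incl_simps(1)[of "\<kappa> ({x}, {}, 0)" x]
        by (intro UN_I[of "\<kappa> ({x}, {}, 0)"]) (auto simp: stages_def)
    qed
    fix i j x y assume ij: "i \<in> Index" "j \<in> Index" and xy: "x \<in> states (on_obj stages i)" "y \<in> states (on_obj stages j)"
      and eq: "on_states (incl i) x = on_states (incl j) y"
    from xy obtain a b where "a \<in> S i" "x = number (S i) a" "b \<in> S j" "y = number (S j) b" by (auto simp: stages_def)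
    then show "\<exists>k\<in>Index. below i k \<and> below j k \<and>
        on_states (on_arr stages (i, k)) x = on_states (on_arr stages (j, k)) y"
      using ub[OF ij] eq incl_simps(1)[OF ij(1)] incl_simps(1)[OF ij(2)]
        stages_arr_simps(1)[OF ij(1)] stages_arr_simps(1)[OF ij(2)] by auto
  qed
  show "presents_colimit (poset_cat Index below) (\<lambda>i. actions (on_obj stages i))
      (\<lambda>m. on_actions (on_arr stages m)) (\<lambda>i. on_actions (incl i)) (actions X)"
  proof (rule directed_presents_colimit)
    show "actions X \<subseteq> (\<Union>i\<in>Index. on_actions (incl i) ` actions (on_obj stages i))"
    proof
      fix x assume "x \<in> actions X"
      then have "{} \<in> Fpow (states X)" "{x} \<in> Fpow (actions X)" unfolding Fpow_def by simp_all
      from dec_\<kappa>[OF this, of 0]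
      show "x \<in> (\<Union>i\<in>Index. on_actions (incl i) ` actions (on_obj stages i))"
        using incl_simps(2)[of "\<kappa> ({}, {x}, 0)" x]
        by (intro UN_I[of "\<kappa> ({}, {x}, 0)"]) (auto simp: stages_def)
    qed
    fix i j x y assume ij: "i \<in> Index" "j \<in> Index" and xy: "x \<in> actions (on_obj stages i)" "y \<in> actions (on_obj stages j)"
      and eq: "on_actions (incl i) x = on_actions (incl j) y"
    from xy obtain a b where "a \<in> L i" "x = number (L i) a" "b \<in> L j" "y = number (L j) b" by (auto simp: stages_def)
    then show "\<exists>k\<in>Index. below i k \<and> below j k \<and>
        on_actions (on_arr stages (i, k)) x = on_actions (on_arr stages (j, k)) y"
      using ub[OF ij] eq incl_simps(2)[OF ij(1)] incl_simps(2)[OF ij(2)]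
        stages_arr_simps(2)[OF ij(1)] stages_arr_simps(2)[OF ij(2)] by auto
  qed
  fix T
  assume img: "\<And>j t. j \<in> Obj (poset_cat Index below) \<Longrightarrow> t \<in> transitions (on_obj stages j) \<Longrightarrow> push (incl j) t \<in> T"
  show "transitions X \<subseteq> T"
  proof
    fix t assume t: "t \<in> transitions X"
    obtain \<alpha> us \<beta> where t_eq: "t = (\<alpha>, us, \<beta>)" by (cases t)
    \<comment> \<open>the smallest subsystem containing \<open>t\<close>\<close>
    let ?i = "\<kappa> ({\<alpha>, \<beta>}, set us, length us)"
    have "{\<alpha>, \<beta>} \<in> Fpow (states X)" "set us \<in> Fpow (actions X)" "us \<noteq> []"
      using WHDTS_transition_typed[OF X t] unfolding t_eq all_transitions_def Fpow_def by auto
    from dec_\<kappa>[OF this(1,2)] have i: "?i \<in> Index" and S: "S ?i = {\<alpha>, \<beta>}" and L: "L ?i = set us" and dim: "dim ?i = length us"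
      by simp_all
    let ?t = "map_transition (number (S ?i)) (number (L ?i)) t"
    have inverse: "map_transition (unnumber (S ?i)) (unnumber (L ?i)) ?t = t"
      unfolding t_eq using unnumber_number[OF Index_finite(1)[OF i]] unnumber_number[OF Index_finite(3)[OF i]]
      by (auto simp: S L intro!: map_idI)
    have "?t \<in> all_transitions (number (S ?i) ` S ?i) (number (L ?i) ` L ?i)"
      using \<open>us \<noteq> []\<close> unfolding t_eq all_transitions_def S L by simp
    then have "?t \<in> transitions (stage ?i)" using inverse t dim by (simp add: t_eq)
    moreover from incl_push[OF this] have "push (incl ?i) ?t = t" using inverse by simp
    ultimately show "t \<in> T" using img[of ?i ?t] i by (simp add: stages_def)
  qed
qed

end

theorem locally_finitely_presentable_WHDTS:
  fixes \<Sigma> :: "'l set"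
  assumes univ: "regular_universe TYPE('u)" and \<Sigma>: "small TYPE('u) \<Sigma>"
  shows "locally_finitely_presentable TYPE('u) (WHDTS \<Sigma> :: (('u, 'l) whdts, ('u, 'l) whdts_mor) cat)"
proof -
  let ?W = "WHDTS \<Sigma> :: (('u, 'l) whdts, ('u, 'l) whdts_mor) cat"
  obtain \<nu> :: "nat \<Rightarrow> 'u" where \<nu>: "inj \<nu>"
    using infinite_countable_subset[OF infinite_universe[OF univ]] by blast
  have "\<exists>f :: 'u \<Rightarrow> 'u. inj_on f B \<and> f ` B \<subseteq> range \<nu>" if fin: "finite B" for B
  proof -
    obtain f :: "'u \<Rightarrow> nat" where "inj_on f B" using finite_imp_inj_to_nat_seg[OF fin] by blast
    then have "inj_on (\<nu> \<circ> f) B" using \<nu> by (intro comp_inj_on) (auto intro: inj_on_subset)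
    moreover have "(\<nu> \<circ> f) ` B \<subseteq> range \<nu>" by auto
    ultimately show ?thesis by blast
  qed
  then obtain number :: "'u set \<Rightarrow> 'u \<Rightarrow> 'u"
    where number: "\<And>B. finite B \<Longrightarrow> inj_on (number B) B \<and> number B ` B \<subseteq> range \<nu>" by metis
  have small_fin: "small TYPE('u) (fin_systems \<Sigma> (range \<nu>))"
    by (intro small_fin_systems univ \<Sigma> small_countable) simp_all
  have fp: "finitely_presentable TYPE('u) ?W K" if "K \<in> fin_systems \<Sigma> (range \<nu>)" for K
    by (rule finite_imp_finitely_presentable[OF univ fin_systems_Obj[OF univ that]])
      (use that in \<open>simp_all add: fin_systems_def Fpow_def\<close>)
  have "\<exists>(I :: 'u set) le D c. small TYPE('u) I \<and> directed_poset I le \<and>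
      is_functor (poset_cat I le) ?W D \<and> (\<forall>i \<in> I. on_obj D i \<in> fin_systems \<Sigma> (range \<nu>)) \<and>
      colimit ?W (poset_cat I le) D X c" if X: "X \<in> Obj ?W" for X
  proof -
    have "small TYPE('u) (Fpow (states X) \<times> Fpow (actions X) \<times> (UNIV :: nat set))"
      using X unfolding WHDTS_Obj_iff
      by (intro small_Sigma[OF univ] small_Fpow[OF univ]) (simp_all add: small_countable[OF univ])
    moreover obtain \<kappa> :: "'u set \<times> 'u set \<times> nat \<Rightarrow> 'u"
      where \<kappa>: "inj_on \<kappa> (Fpow (states X) \<times> Fpow (actions X) \<times> UNIV)"
      using small_embeds[OF calculation] by blast
    interpret finite_subsystems \<Sigma> X "range \<nu>" number \<kappa> by unfold_locales (fact univ X number \<kappa>)+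
    have "small TYPE('u) Index" unfolding Index_def by (rule small_image) fact
    moreover have "\<forall>i \<in> Index. on_obj stages i \<in> fin_systems \<Sigma> (range \<nu>)"
      using stage_fin_systems by (simp add: stages_def)
    ultimately show ?thesis using directed_Index stages_functor stages_colimit by blast
  qed
  then show ?thesis
    unfolding locally_finitely_presentable_def
    using category_WHDTS cocomplete_WHDTS[OF univ] small_fin fp by blast
qed


section \<open>The forgetful functor\<close>

lemma Set_power_hom_iff:
  fixes A B :: "'l \<Rightarrow> 'u set"
  shows "f \<in> hom (Set_power s \<Sigma>) A B \<longleftrightarrow>
     A \<in> extensional (insert s \<Sigma>) \<and> B \<in> extensional (insert s \<Sigma>) \<and> f \<in> extensional (insert s \<Sigma>) \<and>
     (\<forall>x \<in> insert s \<Sigma>. src (f x) = A x \<and> tgt (f x) = B x \<and> app (f x) \<in> A x \<rightarrow>\<^sub>E B x \<and>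
        small TYPE('u) (A x) \<and> small TYPE('u) (B x))"
  unfolding Set_power_def power_cat_hom_iff set_cat_hom_iff by auto

lemma Set_power_Obj_iff:
  fixes A :: "'l \<Rightarrow> 'u set"
  shows "A \<in> Obj (Set_power s \<Sigma>) \<longleftrightarrow>
    A \<in> extensional (insert s \<Sigma>) \<and> (\<forall>x \<in> insert s \<Sigma>. small TYPE('u) (A x))"
  unfolding Set_power_def power_cat_def by (auto simp: PiE_iff)

lemma Set_power_simps:
  "Ident (Set_power s \<Sigma>) A = (\<lambda>x \<in> insert s \<Sigma>. \<lparr>src = A x, app = (\<lambda>y \<in> A x. y), tgt = A x\<rparr>)"
  "Comp (Set_power s \<Sigma>) g f =
     (\<lambda>x \<in> insert s \<Sigma>. \<lparr>src = src (f x), app = compose (src (f x)) (app (g x)) (app (f x)), tgt = tgt (g x)\<rparr>)"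
  unfolding Set_power_def power_cat_def by simp_all

lemma category_Set_power: "category (Set_power s \<Sigma>)"
  unfolding Set_power_def by (rule category_power_cat[OF category_set_cat])

lemma Set_power_disjoint_simps:
  "A \<in> Obj (Set_power_disjoint s \<Sigma>) \<longleftrightarrow> A \<in> Obj (Set_power s \<Sigma>) \<and> disjoint_family_on A \<Sigma>"
  "f \<in> hom (Set_power_disjoint s \<Sigma>) A B \<longleftrightarrow>
     f \<in> hom (Set_power s \<Sigma>) A B \<and> disjoint_family_on A \<Sigma> \<and> disjoint_family_on B \<Sigma>"
  "Ident (Set_power_disjoint s \<Sigma>) A = Ident (Set_power s \<Sigma>) A"
  "Comp (Set_power_disjoint s \<Sigma>) g f = Comp (Set_power s \<Sigma>) g f"
  unfolding Set_power_disjoint_def by (simp_all add: full_subcat_hom_iff)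

lemma omega_obj_simps:
  assumes "s \<notin> \<Sigma>"
  shows "on_obj (omega s \<Sigma>) X s = states X" and "x \<in> \<Sigma> \<Longrightarrow> on_obj (omega s \<Sigma>) X x = fibre X x"
  unfolding omega_def using assms by auto

lemma omega_arr_simps:
  assumes "s \<notin> \<Sigma>"
  shows "on_arr (omega s \<Sigma>) f s = \<lparr>src = states (source f), app = on_states f, tgt = states (target f)\<rparr>"
    and "x \<in> \<Sigma> \<Longrightarrow> on_arr (omega s \<Sigma>) f x = \<lparr>src = fibre (source f) x,
      app = restrict (on_actions f) (fibre (source f) x), tgt = fibre (target f) x\<rparr>"
  unfolding omega_def using assms by auto

lemma omega_extensional:
  "on_obj (omega s \<Sigma>) X \<in> extensional (insert s \<Sigma>)" "on_arr (omega s \<Sigma>) f \<in> extensional (insert s \<Sigma>)"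
  unfolding omega_def by simp_all

lemma action_in_fibre:
  "X \<in> Obj (WHDTS \<Sigma>) \<Longrightarrow> u \<in> actions X \<Longrightarrow> labelling X u \<in> \<Sigma> \<and> u \<in> fibre X (labelling X u)"
  using WHDTS_labelling unfolding fibre_def by fastforce

lemma disjoint_fibres: "s \<notin> \<Sigma> \<Longrightarrow> disjoint_family_on (on_obj (omega s \<Sigma>) X) \<Sigma>"
  unfolding disjoint_family_on_def by (auto simp: omega_obj_simps fibre_def)

lemma omega_obj:
  fixes X :: "('u, 'l) whdts"
  assumes s: "s \<notin> \<Sigma>" and X: "X \<in> Obj (WHDTS \<Sigma>)"
  shows "on_obj (omega s \<Sigma>) X \<in> Obj (Set_power s \<Sigma>)"
proof -
  have "small TYPE('u) (fibre X x)" for x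
    by (rule small_subset[of _ "actions X"]) (use X in \<open>auto simp: WHDTS_Obj_iff fibre_def\<close>)
  then show ?thesis
    unfolding Set_power_Obj_iff using X by (auto simp: omega_extensional omega_obj_simps[OF s] WHDTS_Obj_iff)
qed

lemma omega_hom:
  assumes s: "s \<notin> \<Sigma>" and f: "f \<in> hom (WHDTS \<Sigma>) X Y"
  shows "on_arr (omega s \<Sigma>) f \<in> hom (Set_power s \<Sigma>) (on_obj (omega s \<Sigma>) X) (on_obj (omega s \<Sigma>) Y)"
proof -
  have "on_states f \<in> states X \<rightarrow>\<^sub>E states Y" using f unfolding WHDTS_hom_iff by simp
  moreover have "on_actions f u \<in> fibre Y x" if "u \<in> fibre X x" for u x
    using WHDTS_mor(6,7)[OF f] that unfolding fibre_def by auto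
  ultimately show ?thesis
    using omega_obj[OF s WHDTS_mor(3)[OF f]] omega_obj[OF s WHDTS_mor(4)[OF f]]
    unfolding Set_power_hom_iff Set_power_Obj_iff
    by (auto simp: omega_extensional omega_obj_simps[OF s] omega_arr_simps[OF s] WHDTS_mor(1,2)[OF f])
qed

lemma omega_functor:
  fixes \<Sigma> :: "'l set"
  assumes s: "s \<notin> \<Sigma>"
  shows "is_functor (WHDTS \<Sigma> :: (('u, 'l) whdts, ('u, 'l) whdts_mor) cat) (Set_power s \<Sigma>) (omega s \<Sigma>)"
  unfolding is_functor_def
proof (intro conjI ballI category_WHDTS category_Set_power omega_obj[OF s])
  fix f assume "f \<in> Arr (WHDTS \<Sigma> :: (('u, 'l) whdts, ('u, 'l) whdts_mor) cat)"
  from omega_hom[OF s WHDTS_Arr_hom[OF this]]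
  show "on_arr (omega s \<Sigma>) f \<in> hom (Set_power s \<Sigma>)
      (on_obj (omega s \<Sigma>) (Dom (WHDTS \<Sigma>) f)) (on_obj (omega s \<Sigma>) (Cod (WHDTS \<Sigma>) f))" by simp
next
  fix X :: "('u, 'l) whdts" assume X: "X \<in> Obj (WHDTS \<Sigma>)"
  show "on_arr (omega s \<Sigma>) (Ident (WHDTS \<Sigma>) X) = Ident (Set_power s \<Sigma>) (on_obj (omega s \<Sigma>) X)"
  proof (rule extensionalityI[OF omega_extensional(2)])
    fix x assume "x \<in> insert s \<Sigma>"
    then show "on_arr (omega s \<Sigma>) (Ident (WHDTS \<Sigma>) X) x = Ident (Set_power s \<Sigma>) (on_obj (omega s \<Sigma>) X) x"
      by (auto simp: Set_power_simps omega_arr_simps[OF s] omega_obj_simps[OF s] fibre_def fun_eq_iff)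
  qed (simp add: Set_power_simps)
next
  fix X Y Z :: "('u, 'l) whdts" and f g
  assume f: "f \<in> hom (WHDTS \<Sigma>) X Y" and g: "g \<in> hom (WHDTS \<Sigma>) Y Z"
  have "on_actions f u \<in> fibre Y x" if "u \<in> fibre X x" for u x
    using WHDTS_mor(6,7)[OF f] that unfolding fibre_def by auto
  then have "on_arr (omega s \<Sigma>) (Comp (WHDTS \<Sigma>) g f) x
      = Comp (Set_power s \<Sigma>) (on_arr (omega s \<Sigma>) g) (on_arr (omega s \<Sigma>) f) x" if "x \<in> insert s \<Sigma>" for x
    using that WHDTS_mor(1,2)[OF f] WHDTS_mor(1,2)[OF g]
    by (auto simp: Set_power_simps omega_arr_simps[OF s] WHDTS_Comp compose_def fun_eq_iff fibre_def)
  then show "on_arr (omega s \<Sigma>) (Comp (WHDTS \<Sigma>) g f)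
      = Comp (Set_power s \<Sigma>) (on_arr (omega s \<Sigma>) g) (on_arr (omega s \<Sigma>) f)"
    by (intro extensionalityI[OF omega_extensional(2)]) (simp_all add: Set_power_simps)
qed

text \<open>
  An action lies in exactly one fibre, the one over its label, so the components of the tuple determine
  the map on actions. This makes \<open>omega\<close> faithful.
\<close>

lemma omega_arr_eq:
  assumes s: "s \<notin> \<Sigma>" and f: "f \<in> hom (WHDTS \<Sigma>) X Y" and eq: "on_arr (omega s \<Sigma>) f = m"
  shows "on_states f = app (m s)" and "u \<in> actions X \<Longrightarrow> on_actions f u = app (m (labelling X u)) u"
proof -
  show "on_states f = app (m s)" unfolding eq[symmetric] omega_arr_simps[OF s] by simp
  assume u: "u \<in> actions X"
  note x = action_in_fibre[OF WHDTS_mor(3)[OF f] u]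
  show "on_actions f u = app (m (labelling X u)) u"
    unfolding eq[symmetric] omega_arr_simps(2)[OF s conjunct1[OF x]] using x WHDTS_mor(1)[OF f] by simp
qed

lemma omega_faithful:
  assumes s: "s \<notin> \<Sigma>" and f: "f \<in> hom (WHDTS \<Sigma>) X Y" and g: "g \<in> hom (WHDTS \<Sigma>) X Y"
    and eq: "on_arr (omega s \<Sigma>) f = on_arr (omega s \<Sigma>) g"
  shows "f = g"
  using omega_arr_eq[OF s f eq] omega_arr_eq[OF s g refl] by (intro WHDTS_hom_eqI[OF f g]) simp_all

text \<open>
  A morphism above an identity fixes all states and actions, so preservation of transitions becomes
  inclusion.
\<close>

lemma omega_over_identity:
  assumes s: "s \<notin> \<Sigma>" and C: "on_obj (omega s \<Sigma>) C = X" and m: "m \<in> hom (WHDTS \<Sigma>) C D"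
    and id: "on_arr (omega s \<Sigma>) m = Ident (Set_power s \<Sigma>) X"
  shows "states C \<subseteq> states D" and "u \<in> actions C \<Longrightarrow> u \<in> actions D \<and> labelling D u = labelling C u"
    and "transitions C \<subseteq> transitions D"
proof -
  have ms: "on_states m x = x" if "x \<in> states C" for x
    using omega_arr_eq(1)[OF s m id] that C omega_obj_simps(1)[OF s, of C] by (simp add: Set_power_simps)
  have ma: "on_actions m v = v" if "v \<in> actions C" for v
    using omega_arr_eq(2)[OF s m id that] action_in_fibre[OF WHDTS_mor(3)[OF m] that]
      C omega_obj_simps(2)[OF s, of _ C] by (auto simp: Set_power_simps)
  show "states C \<subseteq> states D" using WHDTS_mor(5)[OF m] ms by fastforce
  show "u \<in> actions D \<and> labelling D u = labelling C u" if u: "u \<in> actions C" for u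
    using WHDTS_mor(6,7)[OF m u] ma[OF u] by simp
  have "push m t = t" if "t \<in> transitions C" for t
    using map_transition_cong[OF WHDTS_transition_typed[OF WHDTS_mor(3)[OF m] that], of _ id _ id] ms ma
    by (cases t) simp
  then show "transitions C \<subseteq> transitions D" using WHDTS_mor(8)[OF m] by (metis subsetI)
qed

lemma omega_amnestic:
  assumes s: "s \<notin> \<Sigma>" and X: "on_obj (omega s \<Sigma>) A = X" "on_obj (omega s \<Sigma>) B = X"
    and k: "k \<in> hom (WHDTS \<Sigma>) A B" "on_arr (omega s \<Sigma>) k = Ident (Set_power s \<Sigma>) X"
    and l: "l \<in> hom (WHDTS \<Sigma>) B A" "on_arr (omega s \<Sigma>) l = Ident (Set_power s \<Sigma>) X"
  shows "A = B"
proof -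
  note AB = omega_over_identity[OF s X(1) k] and BA = omega_over_identity[OF s X(2) l]
  have act: "actions A = actions B" using AB(2) BA(2) by blast
  have "labelling A = labelling B"
    using WHDTS_labelling[OF WHDTS_mor(3)[OF k(1)]] WHDTS_labelling[OF WHDTS_mor(4)[OF k(1)]] AB(2) act
    by (intro extensionalityI[of _ "actions A"]) (auto simp: PiE_iff)
  then show ?thesis using act AB(1,3) BA(1,3) by auto
qed

section \<open>Initial lifts\<close>

text \<open>
  The coarsest structure on \<open>X\<close> for which all \<open>f i\<close> preserve transitions. Its transition set is an
  intersection of inverse images of closed sets, hence closed.
\<close>

definition initial_system ::
  "'l \<Rightarrow> 'l set \<Rightarrow> ('l \<Rightarrow> 'u set) \<Rightarrow> 'i set \<Rightarrow> ('i \<Rightarrow> ('u, 'l) whdts) \<Rightarrow> ('i \<Rightarrow> 'l \<Rightarrow> 'u set_map) \<Rightarrow> ('u, 'l) whdts" where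
  "initial_system s \<Sigma> X I A f =
     (let L = (\<Union>x \<in> \<Sigma>. X x); lab = (\<lambda>u \<in> L. THE x. x \<in> \<Sigma> \<and> u \<in> X x) in
      \<lparr>states = X s, actions = L, labelling = lab,
       transitions = all_transitions (X s) L \<inter>
         (\<Inter>i \<in> I. {t. map_transition (app (f i s)) (\<lambda>u. app (f i (lab u)) u) t \<in> transitions (A i)})\<rparr>)"

definition initial_arrow ::
  "'l \<Rightarrow> ('u, 'l) whdts \<Rightarrow> ('u, 'l) whdts \<Rightarrow> ('l \<Rightarrow> 'u set_map) \<Rightarrow> ('u, 'l) whdts_mor" where
  "initial_arrow s B A f =
     \<lparr>source = B, on_states = app (f s), on_actions = (\<lambda>u \<in> actions B. app (f (labelling B u)) u), target = A\<rparr>"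

text \<open>
  Conversely to \<open>omega_arr_eq\<close>, a tuple of maps between fibres assembles to a single map on actions
  that preserves labels; only the transitions have to be checked.
\<close>

lemma initial_arrow_hom:
  assumes s: "s \<notin> \<Sigma>" and B: "B \<in> Obj (WHDTS \<Sigma>)" and A: "A \<in> Obj (WHDTS \<Sigma>)"
    and f: "f \<in> hom (Set_power s \<Sigma>) (on_obj (omega s \<Sigma>) B) (on_obj (omega s \<Sigma>) A)"
    and T: "\<And>t. t \<in> transitions B \<Longrightarrow> push (initial_arrow s B A f) t \<in> transitions A"
  shows "initial_arrow s B A f \<in> hom (WHDTS \<Sigma>) B A"
    and "on_arr (omega s \<Sigma>) (initial_arrow s B A f) = f"
proof -
  have fs: "src (f s) = states B" "tgt (f s) = states A" "app (f s) \<in> states B \<rightarrow>\<^sub>E states A"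
    using f by (simp_all add: Set_power_hom_iff omega_obj_simps[OF s])
  have fx: "src (f x) = fibre B x" "tgt (f x) = fibre A x" "app (f x) \<in> fibre B x \<rightarrow>\<^sub>E fibre A x"
    if "x \<in> \<Sigma>" for x
    using f that by (simp_all add: Set_power_hom_iff omega_obj_simps[OF s])
  have act: "app (f (labelling B u)) u \<in> actions A \<and> labelling A (app (f (labelling B u)) u) = labelling B u"
    if u: "u \<in> actions B" for u
    using fx(3)[of "labelling B u"] action_in_fibre[OF B u] by (auto simp: fibre_def)
  show "initial_arrow s B A f \<in> hom (WHDTS \<Sigma>) B A"
    unfolding WHDTS_hom_iff using B A T fs(3) act by (auto simp: initial_arrow_def)
  show "on_arr (omega s \<Sigma>) (initial_arrow s B A f) = f"
  proof (rule extensionalityI[OF omega_extensional(2)])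
    show "f \<in> extensional (insert s \<Sigma>)" using f by (simp add: Set_power_hom_iff)
    fix x assume "x \<in> insert s \<Sigma>"
    then consider "x = s" | "x \<in> \<Sigma>" by blast
    then show "on_arr (omega s \<Sigma>) (initial_arrow s B A f) x = f x"
    proof cases
      case 1
      then show ?thesis using fs by (simp add: omega_arr_simps[OF s] initial_arrow_def)
    next
      case 2
      have "restrict (on_actions (initial_arrow s B A f)) (fibre B x) = app (f x)"
        using fx(3)[OF 2] by (auto simp: initial_arrow_def fibre_def fun_eq_iff PiE_iff extensional_def)
      then show ?thesis
        using fx(1,2)[OF 2] by (simp add: omega_arr_simps(2)[OF s 2] initial_arrow_def)
    qed
  qed
qed

text \<open>
  A tuple \<open>h\<close> into \<open>X\<close> preserves transitions as soon as all \<open>Comp (f i) h\<close> do, because the transitions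
  of \<open>M\<close> are exactly those that all \<open>f i\<close> send to transitions.
\<close>

lemma initial_lift_initial_system:
  fixes \<Sigma> :: "'l set" and X :: "'l \<Rightarrow> 'u set" and I :: "'i set"
  assumes univ: "regular_universe TYPE('u)" and small: "small TYPE('u) \<Sigma>" and s: "s \<notin> \<Sigma>"
    and cone: "cone_into (WHDTS \<Sigma>) (Set_power_disjoint s \<Sigma>) (omega s \<Sigma>) X I A f"
  defines "M \<equiv> initial_system s \<Sigma> X I A f"
  shows "initial_lift (WHDTS \<Sigma>) (Set_power_disjoint s \<Sigma>) (omega s \<Sigma>) X I A f M
    (\<lambda>i \<in> I. initial_arrow s M (A i) (f i))"
proof -
  have X: "X \<in> extensional (insert s \<Sigma>)" "\<And>x. x \<in> insert s \<Sigma> \<Longrightarrow> small TYPE('u) (X x)"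
    and disj: "disjoint_family_on X \<Sigma>"
    using cone unfolding cone_into_def Set_power_disjoint_simps Set_power_Obj_iff by auto
  have A: "A i \<in> Obj (WHDTS \<Sigma>)" and f: "f i \<in> hom (Set_power s \<Sigma>) X (on_obj (omega s \<Sigma>) (A i))"
    if "i \<in> I" for i
    using cone that unfolding cone_into_def Set_power_disjoint_simps by simp_all
  have M: "states M = X s" "actions M = (\<Union>x \<in> \<Sigma>. X x)"
    "transitions M = all_transitions (X s) (actions M) \<inter>
         (\<Inter>i \<in> I. {t. map_transition (app (f i s)) (\<lambda>u. app (f i (labelling M u)) u) t \<in> transitions (A i)})"
    "labelling M \<in> extensional (actions M)"
    unfolding M_def initial_system_def Let_def by simp_all
  have lab: "labelling M u = x" if "x \<in> \<Sigma>" "u \<in> X x" for u x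
  proof -
    have "(THE y. y \<in> \<Sigma> \<and> u \<in> X y) = x"
      using disj that unfolding disjoint_family_on_def by (intro the_equality) auto
    then show ?thesis unfolding M_def initial_system_def Let_def using that by auto
  qed
  have MO: "M \<in> Obj (WHDTS \<Sigma>)"
    unfolding WHDTS_Obj_iff is_whdts_iff
  proof (intro conjI)
    show "labelling M \<in> actions M \<rightarrow>\<^sub>E \<Sigma>" using M(4) lab unfolding M(2) by (auto simp: PiE_iff)
    show "transitions M \<subseteq> all_transitions (states M) (actions M)" unfolding M(1) M(3) by blast
    show "closed_transitions (transitions M)"
      unfolding M(3) by (intro closed_transitions_Int closed_transitions_all closed_transitions_INT closed_transitions_vimage WHDTS_closed[OF A])
    show "small TYPE('u) (states M)" "small TYPE('u) (actions M)"
      unfolding M using X(2) by (auto intro: small_UN[OF univ small])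
  qed
  have fib: "fibre M x = X x" if "x \<in> \<Sigma>" for x
    unfolding fibre_def M(2) using lab that by auto
  have omM: "on_obj (omega s \<Sigma>) M = X"
    by (rule extensionalityI[OF omega_extensional(1) X(1)]) (auto simp: omega_obj_simps[OF s] M(1) fib)
  have fh: "f i \<in> hom (Set_power s \<Sigma>) (on_obj (omega s \<Sigma>) M) (on_obj (omega s \<Sigma>) (A i))" if "i \<in> I" for i
    unfolding omM using f[OF that] .
  have gT: "push (initial_arrow s M (A i) (f i)) t \<in> transitions (A i)"
    if i: "i \<in> I" and t: "t \<in> transitions M" for i t
  proof -
    have "push (initial_arrow s M (A i) (f i)) t
        = map_transition (app (f i s)) (\<lambda>u. app (f i (labelling M u)) u) t"
      by (rule map_transition_cong[OF WHDTS_transition_typed[OF MO t]]) (simp_all add: initial_arrow_def)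
    then show ?thesis using t i unfolding M(3) by simp
  qed
  note g = initial_arrow_hom[OF s MO A fh gT]
  have univ_prop: "\<exists>!k. k \<in> hom (WHDTS \<Sigma>) B M \<and> on_arr (omega s \<Sigma>) k = h"
    if B: "B \<in> Obj (WHDTS \<Sigma>)" and h: "h \<in> hom (Set_power s \<Sigma>) (on_obj (omega s \<Sigma>) B) X"
      and hb: "\<And>i. i \<in> I \<Longrightarrow> hb i \<in> hom (WHDTS \<Sigma>) B (A i) \<and>
        Comp (Set_power s \<Sigma>) (f i) h = on_arr (omega s \<Sigma>) (hb i)" for B h hb
  proof -
    let ?k = "initial_arrow s B M h"
    have hM: "h \<in> hom (Set_power s \<Sigma>) (on_obj (omega s \<Sigma>) B) (on_obj (omega s \<Sigma>) M)" using h omM by simp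
    have hs: "src (h s) = states B" "app (h s) \<in> states B \<rightarrow>\<^sub>E X s"
      using h by (simp_all add: Set_power_hom_iff omega_obj_simps[OF s])
    have hx: "src (h x) = fibre B x" "app (h x) \<in> fibre B x \<rightarrow>\<^sub>E X x" if "x \<in> \<Sigma>" for x
      using h that by (simp_all add: Set_power_hom_iff omega_obj_simps[OF s])
    have "push ?k t \<in> transitions M" if t: "t \<in> transitions B" for t
    proof -
      note typed = WHDTS_transition_typed[OF B t]
      have kx: "on_actions ?k u = app (h (labelling B u)) u \<and> labelling B u \<in> \<Sigma> \<and>
          on_actions ?k u \<in> X (labelling B u)" if "u \<in> actions B" for u
        using that hx(2) action_in_fibre[OF B that] by (auto simp: initial_arrow_def)
      have "push ?k t \<in> all_transitions (X s) (actions M)"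
        by (rule map_transition_all[OF typed]) (use hs(2) kx in \<open>auto simp: initial_arrow_def M(2)\<close>)
      moreover have "map_transition (app (f i s)) (\<lambda>u. app (f i (labelling M u)) u) (push ?k t)
          \<in> transitions (A i)" if i: "i \<in> I" for i
      proof -
        have hbi: "hb i \<in> hom (WHDTS \<Sigma>) B (A i)"
          and eq: "on_arr (omega s \<Sigma>) (hb i) = Comp (Set_power s \<Sigma>) (f i) h" using hb[OF i] by simp_all
        note hb_eq = omega_arr_eq[OF s hbi eq]
        have "app (f i s) (on_states ?k x) = on_states (hb i) x" if "x \<in> states B" for x
          using hb_eq(1) hs(1) that by (simp add: Set_power_simps compose_def initial_arrow_def)
        moreover have "app (f i (labelling M (on_actions ?k u))) (on_actions ?k u) = on_actions (hb i) u"
          if u: "u \<in> actions B" for u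
        proof -
          have "labelling M (on_actions ?k u) = labelling B u" using lab kx[OF u] by blast
          then show ?thesis
            using hb_eq(2)[OF u] kx[OF u] hx(1) action_in_fibre[OF B u]
            by (simp add: Set_power_simps compose_def)
        qed
        ultimately have "map_transition (app (f i s) \<circ> on_states ?k)
            ((\<lambda>u. app (f i (labelling M u)) u) \<circ> on_actions ?k) t = push (hb i) t"
          by (intro map_transition_cong[OF typed]) simp_all
        then show ?thesis unfolding map_transition_comp using WHDTS_mor(8)[OF hbi t] by (simp only:)
      qed
      ultimately show ?thesis unfolding M(3) by simp
    qed
    note k = initial_arrow_hom[OF s B MO hM this]
    show ?thesis
    proof (rule ex1I[of _ ?k])
      show "m = ?k" if "m \<in> hom (WHDTS \<Sigma>) B M \<and> on_arr (omega s \<Sigma>) m = h" for m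
        by (rule omega_faithful[OF s _ k(1)]) (use that k(2) in simp_all)
    qed (use k in simp)
  qed
  show ?thesis
    unfolding initial_lift_def
  proof (intro conjI ballI allI impI MO omM)
    fix B h hb assume "B \<in> Obj (WHDTS \<Sigma>)" "h \<in> hom (Set_power_disjoint s \<Sigma>) (on_obj (omega s \<Sigma>) B) X"
      "\<forall>i \<in> I. hb i \<in> hom (WHDTS \<Sigma>) B (A i) \<and>
        Comp (Set_power_disjoint s \<Sigma>) (f i) h = on_arr (omega s \<Sigma>) (hb i)"
    then show "\<exists>!k. k \<in> hom (WHDTS \<Sigma>) B M \<and> on_arr (omega s \<Sigma>) k = h"
      unfolding Set_power_disjoint_simps by (intro univ_prop[of B h hb]) simp_all
  qed (use g in simp_all)
qed

text \<open>
  Uniqueness: the universal properties of two lifts give morphisms in both directions above the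
  identity of \<open>X\<close>, so the lifts coincide by \<open>omega_amnestic\<close>.
\<close>

theorem topological_omega_disjoint:
  fixes \<Sigma> :: "'l set"
  assumes univ: "regular_universe TYPE('u)" and small: "small TYPE('u) \<Sigma>" and s: "s \<notin> \<Sigma>"
  shows "topological TYPE('i) (WHDTS \<Sigma> :: (('u, 'l) whdts, ('u, 'l) whdts_mor) cat)
    (Set_power_disjoint s \<Sigma>) (omega s \<Sigma>)"
  unfolding topological_def
proof (intro conjI allI impI)
  let ?W = "WHDTS \<Sigma> :: (('u, 'l) whdts, ('u, 'l) whdts_mor) cat" and ?D = "Set_power_disjoint s \<Sigma>"
  show "is_functor ?W ?D (omega s \<Sigma>)"
    unfolding Set_power_disjoint_def by (rule functor_full_subcat[OF omega_functor[OF s]]) (rule disjoint_fibres[OF s])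
  fix X and I :: "'i set" and A f
  assume cone: "cone_into ?W ?D (omega s \<Sigma>) X I A f"
  define M where "M = initial_system s \<Sigma> X I A f"
  define g where "g = (\<lambda>i \<in> I. initial_arrow s M (A i) (f i))"
  have lift: "initial_lift ?W ?D (omega s \<Sigma>) X I A f M g"
    unfolding g_def M_def by (rule initial_lift_initial_system[OF univ small s cone])
  have uniq: "N = M \<and> k = g" if k: "k \<in> extensional I" and N: "initial_lift ?W ?D (omega s \<Sigma>) X I A f N k" for N k
  proof -
    have arrow: "\<exists>m. m \<in> hom ?W B C \<and> on_arr (omega s \<Sigma>) m = Ident (Set_power s \<Sigma>) X"
      if B: "initial_lift ?W ?D (omega s \<Sigma>) X I A f B b" and C: "initial_lift ?W ?D (omega s \<Sigma>) X I A f C c"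
      for B C b c
    proof -
      have BO: "B \<in> Obj ?W" and b: "\<And>i. i \<in> I \<Longrightarrow> b i \<in> hom ?W B (A i)" "on_obj (omega s \<Sigma>) B = X"
        "\<And>i. i \<in> I \<Longrightarrow> on_arr (omega s \<Sigma>) (b i) = f i"
        using B unfolding initial_lift_def by simp_all
      have "X \<in> Obj (Set_power s \<Sigma>)" using omega_obj[OF s BO] b(2) by simp
      then have idh: "Ident (Set_power s \<Sigma>) X \<in> hom ?D (on_obj (omega s \<Sigma>) B) X"
        using category_Ident_hom[OF category_Set_power, of X s \<Sigma>] cone b(2)
        unfolding cone_into_def Set_power_disjoint_simps by simp
      have "Comp ?D (f i) (Ident (Set_power s \<Sigma>) X) = on_arr (omega s \<Sigma>) (b i)" if "i \<in> I" for i
        unfolding Set_power_disjoint_simps b(3)[OF that]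
        by (rule category_Comp_Ident(1)[OF category_Set_power])
          (use cone that in \<open>auto simp: cone_into_def Set_power_disjoint_simps\<close>)
      then have "\<forall>i \<in> I. b i \<in> hom ?W B (A i) \<and>
          Comp ?D (f i) (Ident (Set_power s \<Sigma>) X) = on_arr (omega s \<Sigma>) (b i)" using b(1) by blast
      moreover have "\<forall>B \<in> Obj ?W. \<forall>h \<in> hom ?D (on_obj (omega s \<Sigma>) B) X. \<forall>hb.
          (\<forall>i \<in> I. hb i \<in> hom ?W B (A i) \<and> Comp ?D (f i) h = on_arr (omega s \<Sigma>) (hb i)) \<longrightarrow>
          (\<exists>!k. k \<in> hom ?W B C \<and> on_arr (omega s \<Sigma>) k = h)"
        using C unfolding initial_lift_def by simp
      ultimately have "\<exists>!k. k \<in> hom ?W B C \<and> on_arr (omega s \<Sigma>) k = Ident (Set_power s \<Sigma>) X"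
        using BO idh by blast
      then show ?thesis by (rule ex1_implies_ex)
    qed
    obtain m where m: "m \<in> hom ?W N M" "on_arr (omega s \<Sigma>) m = Ident (Set_power s \<Sigma>) X"
      using arrow[OF N lift] by blast
    obtain m' where m': "m' \<in> hom ?W M N" "on_arr (omega s \<Sigma>) m' = Ident (Set_power s \<Sigma>) X"
      using arrow[OF lift N] by blast
    have om: "on_obj (omega s \<Sigma>) N = X" "on_obj (omega s \<Sigma>) M = X"
      using N lift unfolding initial_lift_def by simp_all
    have NM: "N = M" by (rule omega_amnestic[OF s om m m'])
    have "k i = g i" if i: "i \<in> I" for i
    proof (rule omega_faithful[OF s, of _ M "A i"])
      show "k i \<in> hom ?W M (A i)" "g i \<in> hom ?W M (A i)" "on_arr (omega s \<Sigma>) (k i) = on_arr (omega s \<Sigma>) (g i)"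
        using N lift i unfolding NM initial_lift_def by simp_all
    qed
    then have "k = g" using k by (intro extensionalityI[of k I g]) (simp_all add: g_def)
    then show ?thesis using NM by simp
  qed
  show "\<exists>!(L, g). g \<in> extensional I \<and> initial_lift ?W ?D (omega s \<Sigma>) X I A f L g"
  proof (rule ex1I[of _ "(M, g)"])
    show "case (M, g) of (L, g) \<Rightarrow> g \<in> extensional I \<and> initial_lift ?W ?D (omega s \<Sigma>) X I A f L g"
      using lift by (simp add: g_def)
  qed (use uniq in auto)
qed

text \<open>
  Compose a cone over \<open>X\<close> with an isomorphism \<open>\<phi> : X' \<rightarrow> X\<close> from an object \<open>X'\<close> of the
  subcategory, and take the strict lift \<open>L\<close> over \<open>X'\<close>. Since \<open>h \<mapsto> \<phi>\<^sup>-\<^sup>1 h\<close> is a bijection from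
  morphisms into \<open>X\<close> to morphisms into \<open>X'\<close>, the universal property of \<open>L\<close> becomes the required one.
  Two lifts are compared by their universal properties; faithfulness of \<open>F\<close> makes the comparison
  commute with the lifted cones.
\<close>

lemma topological_imp_upto_iso:
  fixes F :: "('o, 'a, 'p, 'b) func"
  assumes top: "topological TYPE('i) C (full_subcat D P) F" and F: "is_functor C D F"
    and faithful: "\<And>X Y f g. f \<in> hom C X Y \<Longrightarrow> g \<in> hom C X Y \<Longrightarrow> on_arr F f = on_arr F g \<Longrightarrow> f = g"
    and P: "\<And>A. A \<in> Obj C \<Longrightarrow> P (on_obj F A)"
    and dense: "\<And>X. X \<in> Obj D \<Longrightarrow> \<exists>X' \<phi>. P X' \<and> iso D X' X \<phi>"
  shows "topological_upto_iso TYPE('i) C D F"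
  unfolding topological_upto_iso_def
proof (intro conjI F allI impI; (elim conjE)?)
  note C = functor_categories[OF F, THEN conjunct1] and D = functor_categories[OF F, THEN conjunct2]
  fix X and I :: "'i set" and A f
  assume cone: "cone_into C D F X I A f"
  have f: "f i \<in> hom D X (on_obj F (A i))" and A: "A i \<in> Obj C" if "i \<in> I" for i
    using cone that unfolding cone_into_def by simp_all
  have XO: "X \<in> Obj D" using cone unfolding cone_into_def by simp
  show "\<exists>L \<phi> g. initial_lift_upto_iso C D F X I A f L \<phi> g"
  proof -
    obtain X' \<phi> where PX: "P X'" and iso: "iso D X' X \<phi>" using dense[OF XO] by blast
    obtain \<psi> where \<phi>: "\<phi> \<in> hom D X' X" and \<psi>: "\<psi> \<in> hom D X X'"
      and inv: "Comp D \<psi> \<phi> = Ident D X'" "Comp D \<phi> \<psi> = Ident D X" using iso unfolding iso_def by blast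
    let ?f = "\<lambda>i. Comp D (f i) \<phi>"
    have "cone_into C (full_subcat D P) F X' I A ?f"
      using A P category_Comp_hom[OF D \<phi> f] category_hom_Obj[OF D \<phi>] PX
      unfolding cone_into_def by (simp add: full_subcat_hom_iff)
    then obtain L g where L: "initial_lift C (full_subcat D P) F X' I A ?f L g"
      using top unfolding topological_def by blast
    have "initial_lift_upto_iso C D F X I A f L \<phi> g"
      unfolding initial_lift_upto_iso_def
    proof (intro conjI ballI allI impI)
      show "L \<in> Obj C" "iso D (on_obj F L) X \<phi>" using L iso unfolding initial_lift_def by simp_all
      show "g i \<in> hom C L (A i)" "on_arr F (g i) = Comp D (f i) \<phi>" if "i \<in> I" for i
        using L that unfolding initial_lift_def by simp_all
      fix B h hb assume B: "B \<in> Obj C" and h: "h \<in> hom D (on_obj F B) X"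
        and hb: "\<forall>i \<in> I. hb i \<in> hom C B (A i) \<and> Comp D (f i) h = on_arr F (hb i)"
      let ?h = "Comp D \<psi> h"
      have h': "?h \<in> hom D (on_obj F B) X'" by (rule category_Comp_hom[OF D h \<psi>])
      have \<phi>h: "Comp D \<phi> ?h = h"
        using category_assoc[OF D h \<psi> \<phi>] inv(2) category_Comp_Ident(2)[OF D h] by simp
      have "Comp D (?f i) ?h = on_arr F (hb i)" if "i \<in> I" for i
        using category_assoc[OF D h' \<phi> f[OF that]] \<phi>h hb that by simp
      moreover have "?h \<in> hom (full_subcat D P) (on_obj F B) X'"
        using h' P[OF B] PX by (simp add: full_subcat_hom_iff)
      moreover have "\<forall>B \<in> Obj C. \<forall>h \<in> hom (full_subcat D P) (on_obj F B) X'. \<forall>hb.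
          (\<forall>i \<in> I. hb i \<in> hom C B (A i) \<and> Comp D (?f i) h = on_arr F (hb i)) \<longrightarrow>
          (\<exists>!k. k \<in> hom C B L \<and> on_arr F k = h)"
        using L unfolding initial_lift_def by simp
      ultimately have ex1: "\<exists>!k. k \<in> hom C B L \<and> on_arr F k = ?h" using B hb by blast
      have "Comp D \<phi> (on_arr F k) = h \<longleftrightarrow> on_arr F k = ?h" if k: "k \<in> hom C B L" for k
      proof -
        have "on_arr F k \<in> hom D (on_obj F B) X'"
          using functor_hom[OF F k] L unfolding initial_lift_def by simp
        then have "Comp D \<psi> (Comp D \<phi> (on_arr F k)) = on_arr F k"
          using category_assoc[OF D _ \<phi> \<psi>] inv(1) category_Comp_Ident(2)[OF D] by simp
        then show ?thesis using \<phi>h by auto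
      qed
      then show "\<exists>!k. k \<in> hom C B L \<and> Comp D \<phi> (on_arr F k) = h"
        using ex1 by (metis (no_types, lifting))
    qed
    then show ?thesis by blast
  qed
  fix L \<phi> g L' \<phi>' g'
  assume L: "initial_lift_upto_iso C D F X I A f L \<phi> g" and L': "initial_lift_upto_iso C D F X I A f L' \<phi>' g'"
  have comparison: "\<exists>!k. k \<in> hom C M N \<and> Comp D \<chi>' (on_arr F k) = \<chi>"
    if M: "initial_lift_upto_iso C D F X I A f M \<chi> m" and N: "initial_lift_upto_iso C D F X I A f N \<chi>' n"
    for M \<chi> m N \<chi>' n
  proof -
    have MO: "M \<in> Obj C" and \<chi>: "\<chi> \<in> hom D (on_obj F M) X"
      and m: "\<forall>i \<in> I. m i \<in> hom C M (A i) \<and> Comp D (f i) \<chi> = on_arr F (m i)"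
      using M unfolding initial_lift_upto_iso_def iso_def by simp_all
    have "\<forall>B \<in> Obj C. \<forall>h \<in> hom D (on_obj F B) X. \<forall>hb.
        (\<forall>i \<in> I. hb i \<in> hom C B (A i) \<and> Comp D (f i) h = on_arr F (hb i)) \<longrightarrow>
        (\<exists>!k. k \<in> hom C B N \<and> Comp D \<chi>' (on_arr F k) = h)"
      using N unfolding initial_lift_upto_iso_def by simp
    from this[rule_format, OF MO \<chi>, of m] show ?thesis using m by simp
  qed
  have \<phi>: "\<phi> \<in> hom D (on_obj F L) X" and \<phi>': "\<phi>' \<in> hom D (on_obj F L') X"
    and LO: "L \<in> Obj C" "L' \<in> Obj C"
    using L L' unfolding initial_lift_upto_iso_def iso_def by simp_all
  obtain \<theta> where \<theta>: "\<theta> \<in> hom C L L'" "Comp D \<phi>' (on_arr F \<theta>) = \<phi>"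
    using comparison[OF L L'] by blast
  obtain \<eta> where \<eta>: "\<eta> \<in> hom C L' L" "Comp D \<phi> (on_arr F \<eta>) = \<phi>'"
    using comparison[OF L' L] by blast
  have round_trip: "Comp C b a = Ident C M"
    if M: "initial_lift_upto_iso C D F X I A f M \<chi> m" and MO: "M \<in> Obj C" and \<chi>: "\<chi> \<in> hom D (on_obj F M) X"
      and \<chi>': "\<chi>' \<in> hom D (on_obj F N) X" and a: "a \<in> hom C M N" "Comp D \<chi>' (on_arr F a) = \<chi>"
      and b: "b \<in> hom C N M" "Comp D \<chi> (on_arr F b) = \<chi>'" for M \<chi> m N \<chi>' a b
  proof -
    have "Comp D \<chi> (on_arr F (Comp C b a)) = \<chi>"
      using functor_Comp[OF F a(1) b(1)] category_assoc[OF D functor_hom[OF F a(1)] functor_hom[OF F b(1)] \<chi>] a b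
      by simp
    moreover have "Comp D \<chi> (on_arr F (Ident C M)) = \<chi>"
      using functor_Ident[OF F MO] category_Comp_Ident(1)[OF D \<chi>] by simp
    ultimately show ?thesis
      using comparison[OF M M] category_Comp_hom[OF C a(1) b(1)] category_Ident_hom[OF C MO] by (blast elim: ex1E)
  qed
  have iso: "iso C L L' \<theta>"
    unfolding iso_def
    using \<theta>(1) \<eta>(1) round_trip[OF L LO(1) \<phi> \<phi>' \<theta> \<eta>] round_trip[OF L' LO(2) \<phi>' \<phi> \<eta> \<theta>] by blast
  have tri: "Comp C (g' i) \<theta> = g i" if i: "i \<in> I" for i
  proof (rule faithful)
    have gi: "g i \<in> hom C L (A i)" "on_arr F (g i) = Comp D (f i) \<phi>"
      and gi': "g' i \<in> hom C L' (A i)" "on_arr F (g' i) = Comp D (f i) \<phi>'"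
      using L L' i unfolding initial_lift_upto_iso_def by simp_all
    show "Comp C (g' i) \<theta> \<in> hom C L (A i)" by (rule category_Comp_hom[OF C \<theta>(1) gi'(1)])
    show "g i \<in> hom C L (A i)" by fact
    show "on_arr F (Comp C (g' i) \<theta>) = on_arr F (g i)"
      using functor_Comp[OF F \<theta>(1) gi'(1)] gi(2) gi'(2) \<theta>(2)
        category_assoc[OF D functor_hom[OF F \<theta>(1)] \<phi>' f[OF i]] by simp
  qed
  show "\<exists>!\<theta>. iso C L L' \<theta> \<and> Comp D \<phi>' (on_arr F \<theta>) = \<phi> \<and> (\<forall>i \<in> I. Comp C (g' i) \<theta> = g i)"
  proof (rule ex1I[of _ \<theta>])
    show "iso C L L' \<theta> \<and> Comp D \<phi>' (on_arr F \<theta>) = \<phi> \<and> (\<forall>i \<in> I. Comp C (g' i) \<theta> = g i)"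
      using iso \<theta>(2) tri by blast
    fix k assume "iso C L L' k \<and> Comp D \<phi>' (on_arr F k) = \<phi> \<and> (\<forall>i \<in> I. Comp C (g' i) k = g i)"
    then have "k \<in> hom C L L'" "Comp D \<phi>' (on_arr F k) = \<phi>" unfolding iso_def by simp_all
    then show "k = \<theta>" using comparison[OF L L'] \<theta> by (blast elim: ex1E)
  qed
qed

text \<open>
  Tagging each element with its label makes the components at labels disjoint; smallness of the label
  set allows the tags to be taken from the universe.
\<close>

lemma Set_power_disjoint_dense:
  fixes X :: "'l \<Rightarrow> 'u set"
  assumes univ: "regular_universe TYPE('u)" and small: "small TYPE('u) \<Sigma>"
    and X: "X \<in> Obj (Set_power s \<Sigma>)"
  shows "\<exists>X' \<phi>. disjoint_family_on X' \<Sigma> \<and> iso (Set_power s \<Sigma>) X' X \<phi>"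
proof -
  obtain \<sigma> :: "'l \<Rightarrow> 'u" where \<sigma>: "inj_on \<sigma> \<Sigma>" using small_embeds[OF small] by blast
  note pc = injD[OF inj_pair_code[OF infinite_universe[OF univ]]]
  define tag where "tag = (\<lambda>x u. pair_code (\<sigma> x, u))"
  have inj: "inj_on (tag x) B" for x B unfolding tag_def by (rule inj_onI) (blast dest: pc)
  define X' where "X' = (\<lambda>x \<in> insert s \<Sigma>. tag x ` X x)"
  define \<phi> where "\<phi> = (\<lambda>x \<in> insert s \<Sigma>. \<lparr>src = X' x, app = restrict (inv_into (X x) (tag x)) (X' x), tgt = X x\<rparr>)"
  define \<psi> where "\<psi> = (\<lambda>x \<in> insert s \<Sigma>. \<lparr>src = X x, app = restrict (tag x) (X x), tgt = X' x\<rparr>)"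
  have small_X: "small TYPE('u) (X x)" "small TYPE('u) (X' x)" if "x \<in> insert s \<Sigma>" for x
    using X that small_image unfolding Set_power_Obj_iff X'_def by auto
  have ext: "X \<in> extensional (insert s \<Sigma>)" "X' \<in> extensional (insert s \<Sigma>)"
    using X unfolding Set_power_Obj_iff X'_def by auto
  have "disjoint_family_on X' \<Sigma>"
    unfolding disjoint_family_on_def X'_def tag_def using \<sigma> by (auto dest!: pc dest: inj_onD)
  moreover have "\<phi> \<in> hom (Set_power s \<Sigma>) X' X"
    unfolding Set_power_hom_iff using small_X ext by (auto simp: \<phi>_def X'_def inv_into_f_f[OF inj])
  moreover have "\<psi> \<in> hom (Set_power s \<Sigma>) X X'"
    unfolding Set_power_hom_iff using small_X ext by (auto simp: \<psi>_def X'_def)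
  moreover have "Comp (Set_power s \<Sigma>) \<psi> \<phi> = Ident (Set_power s \<Sigma>) X'"
    unfolding Set_power_simps
    by (rule restrict_ext) (auto simp: \<phi>_def \<psi>_def X'_def compose_def fun_eq_iff inv_into_f_f[OF inj])
  moreover have "Comp (Set_power s \<Sigma>) \<phi> \<psi> = Ident (Set_power s \<Sigma>) X"
    unfolding Set_power_simps
    by (rule restrict_ext) (auto simp: \<phi>_def \<psi>_def X'_def compose_def fun_eq_iff inv_into_f_f[OF inj])
  ultimately show ?thesis unfolding iso_def by blast
qed


theorem theorem3p4:
  fixes \<Sigma> :: "'l set" and s :: 'l
  assumes "regular_universe TYPE('u)"
    and "\<Sigma> \<noteq> {}" and "small TYPE('u) \<Sigma>" and "s \<notin> \<Sigma>"
  shows "locally_finitely_presentable TYPE('u)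
           (WHDTS \<Sigma> :: (('u, 'l) whdts, ('u, 'l) whdts_mor) cat) \<and>
         topological_upto_iso TYPE('i)
           (WHDTS \<Sigma> :: (('u, 'l) whdts, ('u, 'l) whdts_mor) cat) (Set_power s \<Sigma>) (omega s \<Sigma>) \<and>
         topological TYPE('i)
           (WHDTS \<Sigma> :: (('u, 'l) whdts, ('u, 'l) whdts_mor) cat) (Set_power_disjoint s \<Sigma>) (omega s \<Sigma>)"
proof (intro conjI)
  let ?W = "WHDTS \<Sigma> :: (('u, 'l) whdts, ('u, 'l) whdts_mor) cat"
  show "locally_finitely_presentable TYPE('u) ?W"
    by (rule locally_finitely_presentable_WHDTS[OF assms(1,3)])
  show top: "topological TYPE('i) ?W (Set_power_disjoint s \<Sigma>) (omega s \<Sigma>)"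
    by (rule topological_omega_disjoint[OF assms(1,3,4)])
  show "topological_upto_iso TYPE('i) ?W (Set_power s \<Sigma>) (omega s \<Sigma>)"
    by (rule topological_imp_upto_iso[OF top[unfolded Set_power_disjoint_def] omega_functor[OF assms(4)]
          omega_faithful[OF assms(4)] disjoint_fibres[OF assms(4)]
          Set_power_disjoint_dense[OF assms(1,3)]])
qed

end
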